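(* Let $a,b,c,d\in\mathbb{R}$ satisfy (C0) together with (C1) or (C2), and consider the system with complete dissipation $$\eta_t+u_x+au_{xxx}-b\eta_{xxt}+(\eta u)_x=\eta_{xx},\qquad u_t+\eta_x+c\eta_{xxx}-du_{xxt}+uu_x=u_{xx},\qquad x\in\mathbb{R}.$$ Assume the system is of KdV--Burgers class, i.e. $\mathrm{order}(\sigma)\ge1$. Then there exists $\epsilon_0>0$ such that every mild solution whose initial datum $v_0$ satisfies $\|v_0\|_{L^1\cap L^2}\le\epsilon_0$ obeys, as $t\to\infty$: (i) if $H$ is of order $0$: $\ \|\eta(t)\|_{L^2}^2+\|u(t)\|_{L^2}^2\le O(t^{-1/2})$; (ii) if $H$ is of order $1$: $\ \|\eta(t)\|_{L^2}^2+\|u(t)\|_{H^1}^2\le O(t^{-1/2})$; (iii) if $H$ is of order $-1$: $\ \|\eta(t)\|_{H^1}^2+\|u(t)\|_{L^2}^2\le O(t^{-1/2})$.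
   Context: Conditions on the real constants: (C0) $a+b+c+d=\frac13$ and $c+d=\frac12(1-\theta^2)\ge 0$ for some $\theta\in[0,1]$; (C1) $b\ge0,\ d\ge0,\ a\le0,\ c\le0$; (C2) $b\ge0,\ d\ge0,\ a=c>0$. Put $\omega_1=\frac{1-a\xi^2}{1+b\xi^2}$, $\omega_2=\frac{1-c\xi^2}{1+d\xi^2}$, $\sigma=(\omega_1\omega_2)^{1/2}$, $\widehat H=(\omega_1/\omega_2)^{1/2}$ (with $0/0=1$), $\alpha=\frac{\xi^2}{1+b\xi^2}$, $\varepsilon=\frac{\xi^2}{1+d\xi^2}$, and $A(\xi)=\begin{pmatrix}\alpha & i\,\mathrm{sgn}(\omega_1)\xi\sigma\\ i\,\mathrm{sgn}(\omega_2)\xi\sigma&\varepsilon\end{pmatrix}$. The order of a nonnegative function $\kappa(\xi)$ is the number $m$ with $\kappa(\xi)\sim C|\xi|^m$ ($C>0$) as $|\xi|\to\infty$. With $\{r\}=1$ if $r\ne0$, $\{0\}=0$: $\mathrm{order}(\sigma)=\{a\}+\{c\}-\{b\}-\{d\}$, and the order of $H$ (the Fourier multiplier with symbol $\widehat H$) is $\{a\}+\{d\}-\{c\}-\{b\}$. The KdV--Burgers class consists of the systems for which, for some $\beta,C>0$, $\|e^{-tA(\xi)}\|\le Ce^{-\beta\xi^2t}$ for all $\xi\in\mathbb{R}$, $t>0$; under complete dissipation this is the case $\mathrm{order}(\sigma)\ge1$. Mild solutions: let $S(t)$ be the Fourier multiplier with matrix symbol $e^{-tA(\xi)}$. If $H$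 has order $0$ or $1$, put $v=(\eta,w)$ with $w=Hu$ and $F(v)=\big((1-b\partial_x^2)^{-1}(\eta\,H^{-1}w),\ \tfrac12H(1-d\partial_x^2)^{-1}((H^{-1}w)^2)\big)$. If $H$ has order $-1$, put $v=(\tau,u)$ with $\tau=H^{-1}\eta$ and $F(v)=\big(H^{-1}(1-b\partial_x^2)^{-1}(u\,H\tau),\ \tfrac12(1-d\partial_x^2)^{-1}(u^2)\big)$. The system is then $v_t+Lv=-\partial_xF(v)$, $L$ having symbol $A$. A mild solution with datum $v_0$ is $v\in C([0,\infty);L^2(\mathbb{R})^2)$ with $v(t)=S(t)v_0-\int_0^tS(t-s)\partial_xF(v(s))\,ds$ for all $t\ge0$. $\|v_0\|_{L^1\cap L^2}=\|v_0\|_{L^1}+\|v_0\|_{L^2}$. *)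

theory Defs
  imports "HOL-Analysis.Analysis" "HOL-Library.Landau_Symbols"
begin

section \<open>The Hilbert space of square integrable functions on the real line\<close>

text \<open>Functions are complex-valued, so that the Fourier transform acts on the same space;
  real-valued solutions of the system are a special case.\<close>

definition square_integrable :: "(real \<Rightarrow> complex) \<Rightarrow> bool" where
  "square_integrable f \<longleftrightarrow>
     f \<in> borel_measurable lborel \<and> integrable lborel (\<lambda>x. (norm (f x))\<^sup>2)"

definition L2_rel :: "(real \<Rightarrow> complex) \<Rightarrow> (real \<Rightarrow> complex) \<Rightarrow> bool" where
  "L2_rel f g \<longleftrightarrow>
     square_integrable f \<and> square_integrable g \<and> (AE x in lborel. f x = g x)"

lemma square_integrable_zero: "square_integrable (\<lambda>x. 0)"
  by (simp add: square_integrable_def)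

lemma square_integrable_scaleR:
  "square_integrable f \<Longrightarrow> square_integrable (\<lambda>x. r *\<^sub>R f x)"
  by (auto simp: square_integrable_def power_mult_distrib)

lemma square_integrable_add:
  assumes "square_integrable f" "square_integrable g"
  shows "square_integrable (\<lambda>x. f x + g x)"
proof -
  have [measurable]: "f \<in> borel_measurable lborel" "g \<in> borel_measurable lborel"
    using assms by (auto simp: square_integrable_def)
  have "integrable lborel (\<lambda>x. 2 * (norm (f x))\<^sup>2 + 2 * (norm (g x))\<^sup>2)"
    using assms by (auto simp: square_integrable_def)
  then have "integrable lborel (\<lambda>x. (norm (f x + g x))\<^sup>2)"
  proof (rule Bochner_Integration.integrable_bound)
    show "AE x in lborel. norm ((norm (f x + g x))\<^sup>2)
            \<le> norm (2 * (norm (f x))\<^sup>2 + 2 * (norm (g x))\<^sup>2)"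
    proof (rule AE_I2)
      fix x
      have "(norm (f x + g x))\<^sup>2 \<le> (norm (f x) + norm (g x))\<^sup>2"
        by (simp add: norm_triangle_ineq power_mono)
      also have "\<dots> \<le> 2 * (norm (f x))\<^sup>2 + 2 * (norm (g x))\<^sup>2"
        using sum_squares_bound[of "norm (f x)" "norm (g x)"]
        by (simp add: power2_sum)
      finally show "norm ((norm (f x + g x))\<^sup>2)
            \<le> norm (2 * (norm (f x))\<^sup>2 + 2 * (norm (g x))\<^sup>2)"
        by simp
    qed
  qed measurable
  then show ?thesis by (simp add: square_integrable_def)
qed

lemma square_integrable_uminus: "square_integrable f \<Longrightarrow> square_integrable (\<lambda>x. - f x)"
  by (auto simp: square_integrable_def)

lemma square_integrable_diff:
  "square_integrable f \<Longrightarrow> square_integrable g \<Longrightarrow> square_integrable (\<lambda>x. f x - g x)"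
  using square_integrable_add[of f "\<lambda>x. - g x"] square_integrable_uminus[of g] by simp

lemma integrable_inner_square_integrable:
  assumes "square_integrable f" "square_integrable g"
  shows "integrable lborel (\<lambda>x. f x \<bullet> g x)"
proof -
  have [measurable]: "f \<in> borel_measurable lborel" "g \<in> borel_measurable lborel"
    using assms by (auto simp: square_integrable_def)
  have "integrable lborel (\<lambda>x. (norm (f x))\<^sup>2 + (norm (g x))\<^sup>2)"
    using assms by (auto simp: square_integrable_def)
  then show ?thesis
  proof (rule Bochner_Integration.integrable_bound)
    show "AE x in lborel. norm (f x \<bullet> g x) \<le> norm ((norm (f x))\<^sup>2 + (norm (g x))\<^sup>2)"
    proof (rule AE_I2)
      fix x
      have "\<bar>f x \<bullet> g x\<bar> \<le> norm (f x) * norm (g x)"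
        by (rule Cauchy_Schwarz_ineq2)
      also have "\<dots> \<le> 2 * norm (f x) * norm (g x)" by simp
      also have "\<dots> \<le> (norm (f x))\<^sup>2 + (norm (g x))\<^sup>2"
        by (rule sum_squares_bound)
      finally show "norm (f x \<bullet> g x) \<le> norm ((norm (f x))\<^sup>2 + (norm (g x))\<^sup>2)" by simp
    qed
  qed measurable
qed

quotient_type L2 = "real \<Rightarrow> complex" / partial: L2_rel
  morphisms rep_L2 abs_L2
proof (rule part_equivpI)
  show "\<exists>f. L2_rel f f"
    using square_integrable_zero by (auto simp: L2_rel_def)
  show "symp L2_rel"
    by (auto simp: symp_def L2_rel_def)
  show "transp L2_rel"
  proof (rule transpI)
    fix f g h assume "L2_rel f g" "L2_rel g h"
    then show "L2_rel f h"
      by (auto simp: L2_rel_def elim: eventually_elim2)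
  qed
qed

lemma square_integrable_rep_L2: "square_integrable (rep_L2 f)"
  using Quotient_rep_reflp[OF Quotient_L2] by (auto simp: L2_rel_def)

instantiation L2 :: real_inner
begin

lift_definition zero_L2 :: L2 is "\<lambda>x. 0"
  by (simp add: L2_rel_def square_integrable_zero)

lift_definition plus_L2 :: "L2 \<Rightarrow> L2 \<Rightarrow> L2" is "\<lambda>f g x. f x + g x"
  by (auto simp: L2_rel_def intro: square_integrable_add elim: eventually_elim2)

lift_definition minus_L2 :: "L2 \<Rightarrow> L2 \<Rightarrow> L2" is "\<lambda>f g x. f x - g x"
  by (auto simp: L2_rel_def intro: square_integrable_diff elim: eventually_elim2)

lift_definition uminus_L2 :: "L2 \<Rightarrow> L2" is "\<lambda>f x. - f x"
  by (auto simp: L2_rel_def intro: square_integrable_uminus elim: eventually_mono)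

lift_definition scaleR_L2 :: "real \<Rightarrow> L2 \<Rightarrow> L2" is "\<lambda>r f x. r *\<^sub>R f x"
  by (auto simp: L2_rel_def intro: square_integrable_scaleR elim: eventually_mono)

lift_definition inner_L2 :: "L2 \<Rightarrow> L2 \<Rightarrow> real" is "\<lambda>f g. \<integral>x. f x \<bullet> g x \<partial>lborel"
proof -
  fix f f' g g' assume 1: "L2_rel f f'" "L2_rel g g'"
  then have [measurable]: "f \<in> borel_measurable lborel" "g \<in> borel_measurable lborel"
      "f' \<in> borel_measurable lborel" "g' \<in> borel_measurable lborel"
    by (auto simp: L2_rel_def square_integrable_def)
  have "AE x in lborel. f x = f' x" "AE x in lborel. g x = g' x"
    using 1 by (auto simp: L2_rel_def)
  then have "AE x in lborel. f x \<bullet> g x = f' x \<bullet> g' x"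
    by eventually_elim simp
  then show "(\<integral>x. f x \<bullet> g x \<partial>lborel) = (\<integral>x. f' x \<bullet> g' x \<partial>lborel)"
    by (intro integral_cong_AE) measurable
qed

definition norm_L2 :: "L2 \<Rightarrow> real" where "norm_L2 f = sqrt (f \<bullet> f)"
definition sgn_L2 :: "L2 \<Rightarrow> L2" where "sgn_L2 f = inverse (norm f) *\<^sub>R f"
definition dist_L2 :: "L2 \<Rightarrow> L2 \<Rightarrow> real" where "dist_L2 f g = norm (f - g)"
definition uniformity_L2 :: "(L2 \<times> L2) filter" where
  "uniformity_L2 = (INF e\<in>{0<..}. principal {(f, g). dist f g < e})"
definition open_L2 :: "L2 set \<Rightarrow> bool" where
  "open_L2 U \<longleftrightarrow> (\<forall>f\<in>U. \<forall>\<^sub>F (f', g) in uniformity. f' = f \<longrightarrow> g \<in> U)"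

instance
proof
  fix f g h :: L2 and r s :: real
  show "f + g + h = f + (g + h)"
    by transfer (auto simp: L2_rel_def add.assoc intro!: square_integrable_add)
  show "f + g = g + f"
    by transfer (auto simp: L2_rel_def add.commute intro!: square_integrable_add)
  show "0 + f = f"
    by transfer (auto simp: L2_rel_def)
  show "- f + f = 0"
    by transfer (auto simp: L2_rel_def square_integrable_zero)
  show "f - g = f + - g"
    by transfer (auto simp: L2_rel_def intro!: square_integrable_diff)
  show "r *\<^sub>R (f + g) = r *\<^sub>R f + r *\<^sub>R g"
    by transfer (auto simp: L2_rel_def scaleR_add_right[symmetric] simp del: scaleR_add_right
          intro!: square_integrable_scaleR square_integrable_add)
  show "(r + s) *\<^sub>R f = r *\<^sub>R f + s *\<^sub>R f"
    by transfer (auto simp: L2_rel_def scaleR_add_left[symmetric] simp del: scaleR_add_left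
          intro!: square_integrable_scaleR)
  show "r *\<^sub>R s *\<^sub>R f = (r * s) *\<^sub>R f"
    by transfer (auto simp: L2_rel_def scaleR_scaleR intro!: square_integrable_scaleR)
  show "1 *\<^sub>R f = f"
    by transfer (auto simp: L2_rel_def)
  show "f \<bullet> g = g \<bullet> f"
    by transfer (simp add: inner_commute)
  show "(f + g) \<bullet> h = f \<bullet> h + g \<bullet> h"
    by transfer (auto simp: L2_rel_def inner_add_left integrable_inner_square_integrable)
  show "r *\<^sub>R f \<bullet> g = r * (f \<bullet> g)"
    by transfer (simp add: L2_rel_def)
  show "0 \<le> f \<bullet> f"
    by transfer simp
  show "f \<bullet> f = 0 \<longleftrightarrow> f = 0"
  proof transfer
    fix f :: "real \<Rightarrow> complex" assume "L2_rel f f"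
    then have f: "square_integrable f" by (simp add: L2_rel_def)
    have "(\<integral>x. f x \<bullet> f x \<partial>lborel) = 0 \<longleftrightarrow> (AE x in lborel. f x \<bullet> f x = 0)"
      by (intro integral_nonneg_eq_0_iff_AE integrable_inner_square_integrable f) simp
    then show "(\<integral>x. f x \<bullet> f x \<partial>lborel) = 0 \<longleftrightarrow> L2_rel f (\<lambda>x. 0)"
      using f by (simp add: L2_rel_def square_integrable_zero)
  qed
qed (fact norm_L2_def sgn_L2_def dist_L2_def uniformity_L2_def open_L2_def)+

end

lemma norm_L2_eq: "norm f = sqrt (\<integral>x. (norm (rep_L2 f x))\<^sup>2 \<partial>lborel)"
proof -
  have "f \<bullet> f = (\<integral>x. rep_L2 f x \<bullet> rep_L2 f x \<partial>lborel)"
    by (simp add: inner_L2.rep_eq)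
  then show ?thesis by (simp add: norm_L2_def power2_norm_eq_inner)
qed


section \<open>Fourier transform and Fourier multipliers\<close>

definition fourier_L1 :: "(real \<Rightarrow> complex) \<Rightarrow> real \<Rightarrow> complex" where
  "fourier_L1 f \<xi> = (\<integral>x. f x * cis (- (x * \<xi>)) \<partial>lborel)"

text \<open>The Fourier transform on \<open>L\<^sup>2\<close> is the limit, in the norm of \<open>L\<^sup>2\<close>, of the transforms of the
  truncations to \<open>[-R, R]\<close>.\<close>

definition fourier :: "L2 \<Rightarrow> L2" where
  "fourier f =
     Lim at_top (\<lambda>R::real. abs_L2 (fourier_L1 (\<lambda>x. indicator {-R..R} x *\<^sub>R rep_L2 f x)))"

text \<open>The element of \<open>L\<^sup>2\<close> whose Fourier transform is the (square integrable) function \<open>g\<close>.\<close>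

definition inv_fourier :: "(real \<Rightarrow> complex) \<Rightarrow> L2" where
  "inv_fourier g = (THE f. AE \<xi> in lborel. rep_L2 (fourier f) \<xi> = g \<xi>)"

definition inv_fourier2 :: "(real \<Rightarrow> complex^2) \<Rightarrow> L2 \<times> L2" where
  "inv_fourier2 g = (inv_fourier (\<lambda>\<xi>. g \<xi> $ 1), inv_fourier (\<lambda>\<xi>. g \<xi> $ 2))"

definition fourier2 :: "L2 \<times> L2 \<Rightarrow> real \<Rightarrow> complex^2" where
  "fourier2 v \<xi> = vector [rep_L2 (fourier (fst v)) \<xi>, rep_L2 (fourier (snd v)) \<xi>]"

definition multiplier :: "(real \<Rightarrow> complex) \<Rightarrow> L2 \<Rightarrow> L2" where
  "multiplier m f = inv_fourier (\<lambda>\<xi>. m \<xi> * rep_L2 (fourier f) \<xi>)"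

definition multiplier2 :: "(real \<Rightarrow> complex^2^2) \<Rightarrow> L2 \<times> L2 \<Rightarrow> L2 \<times> L2" where
  "multiplier2 M v = inv_fourier2 (\<lambda>\<xi>. M \<xi> *v fourier2 v \<xi>)"

definition H1 :: "L2 set" where
  "H1 = {u. integrable lborel (\<lambda>\<xi>. (1 + \<xi>\<^sup>2) * (norm (rep_L2 (fourier u) \<xi>))\<^sup>2)}"

text \<open>With the present normalisation of the Fourier transform, the factor \<open>1/(2 \<pi>)\<close> makes
  the square of this norm equal to \<open>\<parallel>u\<parallel>\<^sup>2 + \<parallel>u\<^sub>x\<parallel>\<^sup>2\<close> (norms of \<open>L\<^sup>2\<close>).\<close>

definition H1_norm :: "L2 \<Rightarrow> real" where
  "H1_norm u =
     sqrt ((\<integral>\<xi>. (1 + \<xi>\<^sup>2) * (norm (rep_L2 (fourier u) \<xi>))\<^sup>2 \<partial>lborel) / (2 * pi))"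

definition in_L1 :: "L2 \<times> L2 \<Rightarrow> bool" where
  "in_L1 v \<longleftrightarrow> integrable lborel (rep_L2 (fst v)) \<and> integrable lborel (rep_L2 (snd v))"

definition L1_norm :: "L2 \<times> L2 \<Rightarrow> real" where
  "L1_norm v = (\<integral>x. norm (rep_L2 (fst v) x, rep_L2 (snd v) x) \<partial>lborel)"

definition matrix_exp :: "complex^2^2 \<Rightarrow> complex^2^2" where
  "matrix_exp B = (\<Sum>n. (((**) B ^^ n) (mat 1)) /\<^sub>R fact n)"

definition has_order :: "(real \<Rightarrow> real) \<Rightarrow> real \<Rightarrow> bool" where
  "has_order \<kappa> m \<longleftrightarrow> (\<exists>C>0. \<kappa> \<sim>[at_infinity] (\<lambda>\<xi>. C * \<bar>\<xi>\<bar> powr m))"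


section \<open>The linearised system\<close>

definition cond_C0 :: "real \<Rightarrow> real \<Rightarrow> real \<Rightarrow> real \<Rightarrow> bool" where
  "cond_C0 a b c d \<longleftrightarrow>
     a + b + c + d = 1/3 \<and> (\<exists>\<theta>\<in>{0..1}. c + d = (1 - \<theta>\<^sup>2) / 2 \<and> c + d \<ge> 0)"

definition cond_C1 :: "real \<Rightarrow> real \<Rightarrow> real \<Rightarrow> real \<Rightarrow> bool" where
  "cond_C1 a b c d \<longleftrightarrow> b \<ge> 0 \<and> d \<ge> 0 \<and> a \<le> 0 \<and> c \<le> 0"

definition cond_C2 :: "real \<Rightarrow> real \<Rightarrow> real \<Rightarrow> real \<Rightarrow> bool" where
  "cond_C2 a b c d \<longleftrightarrow> b \<ge> 0 \<and> d \<ge> 0 \<and> a = c \<and> c > 0"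

definition omega1 :: "real \<Rightarrow> real \<Rightarrow> real \<Rightarrow> real" where
  "omega1 a b \<xi> = (1 - a * \<xi>\<^sup>2) / (1 + b * \<xi>\<^sup>2)"

definition omega2 :: "real \<Rightarrow> real \<Rightarrow> real \<Rightarrow> real" where
  "omega2 c d \<xi> = (1 - c * \<xi>\<^sup>2) / (1 + d * \<xi>\<^sup>2)"

definition sigma_symbol :: "real \<Rightarrow> real \<Rightarrow> real \<Rightarrow> real \<Rightarrow> real \<Rightarrow> real" where
  "sigma_symbol a b c d \<xi> = sqrt (omega1 a b \<xi> * omega2 c d \<xi>)"

text \<open>The case distinction implements the convention \<open>0/0 = 1\<close>.\<close>

definition H_symbol :: "real \<Rightarrow> real \<Rightarrow> real \<Rightarrow> real \<Rightarrow> real \<Rightarrow> real" where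
  "H_symbol a b c d \<xi> =
     (if omega1 a b \<xi> = 0 \<and> omega2 c d \<xi> = 0 then 1 else sqrt (omega1 a b \<xi> / omega2 c d \<xi>))"

definition alpha_symbol :: "real \<Rightarrow> real \<Rightarrow> real" where
  "alpha_symbol b \<xi> = \<xi>\<^sup>2 / (1 + b * \<xi>\<^sup>2)"

definition epsilon_symbol :: "real \<Rightarrow> real \<Rightarrow> real" where
  "epsilon_symbol d \<xi> = \<xi>\<^sup>2 / (1 + d * \<xi>\<^sup>2)"

definition A_symbol :: "real \<Rightarrow> real \<Rightarrow> real \<Rightarrow> real \<Rightarrow> real \<Rightarrow> complex^2^2" where
  "A_symbol a b c d \<xi> = vector
     [vector [of_real (alpha_symbol b \<xi>),
              \<i> * of_real (sgn (omega1 a b \<xi>) * \<xi> * sigma_symbol a b c d \<xi>)],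
      vector [\<i> * of_real (sgn (omega2 c d \<xi>) * \<xi> * sigma_symbol a b c d \<xi>),
              of_real (epsilon_symbol d \<xi>)]]"

definition S_symbol :: "real \<Rightarrow> real \<Rightarrow> real \<Rightarrow> real \<Rightarrow> real \<Rightarrow> real \<Rightarrow> complex^2^2" where
  "S_symbol a b c d t \<xi> = matrix_exp (- (t *\<^sub>R A_symbol a b c d \<xi>))"

definition S_op :: "real \<Rightarrow> real \<Rightarrow> real \<Rightarrow> real \<Rightarrow> real \<Rightarrow> L2 \<times> L2 \<Rightarrow> L2 \<times> L2" where
  "S_op a b c d t = multiplier2 (S_symbol a b c d t)"

definition H_op :: "real \<Rightarrow> real \<Rightarrow> real \<Rightarrow> real \<Rightarrow> L2 \<Rightarrow> L2" where
  "H_op a b c d = multiplier (\<lambda>\<xi>. of_real (H_symbol a b c d \<xi>))"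

definition H_inv_op :: "real \<Rightarrow> real \<Rightarrow> real \<Rightarrow> real \<Rightarrow> L2 \<Rightarrow> L2" where
  "H_inv_op a b c d = multiplier (\<lambda>\<xi>. of_real (1 / H_symbol a b c d \<xi>))"


section \<open>The nonlinearity and mild solutions\<close>

text \<open>Products of elements of \<open>L\<^sup>2\<close> are in general only in \<open>L\<^sup>1\<close>, so \<open>F(v)\<close> need not lie
  in \<open>L\<^sup>2\<close>. It is represented by its Fourier transform, which is a function. The first version
  belongs to \<open>v = (\<eta>, w)\<close> with \<open>w = H u\<close> (order of \<open>H\<close> equal to 0 or 1), the second one to
  \<open>v = (\<tau>, u)\<close> with \<open>\<eta> = H \<tau>\<close> (order of \<open>H\<close> equal to -1).\<close>

definition F_hat_w ::
  "real \<Rightarrow> real \<Rightarrow> real \<Rightarrow> real \<Rightarrow> L2 \<times> L2 \<Rightarrow> real \<Rightarrow> complex^2" where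
  "F_hat_w a b c d v \<xi> =
     (let \<eta> = rep_L2 (fst v); u = rep_L2 (H_inv_op a b c d (snd v)) in
      vector
       [of_real (1 / (1 + b * \<xi>\<^sup>2)) * fourier_L1 (\<lambda>x. \<eta> x * u x) \<xi>,
        of_real (1/2 * H_symbol a b c d \<xi> * (1 / (1 + d * \<xi>\<^sup>2))) * fourier_L1 (\<lambda>x. (u x)\<^sup>2) \<xi>])"

definition F_hat_tau ::
  "real \<Rightarrow> real \<Rightarrow> real \<Rightarrow> real \<Rightarrow> L2 \<times> L2 \<Rightarrow> real \<Rightarrow> complex^2" where
  "F_hat_tau a b c d v \<xi> =
     (let \<eta> = rep_L2 (H_op a b c d (fst v)); u = rep_L2 (snd v) in
      vector
       [of_real (1 / H_symbol a b c d \<xi> * (1 / (1 + b * \<xi>\<^sup>2))) * fourier_L1 (\<lambda>x. u x * \<eta> x) \<xi>,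
        of_real (1/2 * (1 / (1 + d * \<xi>\<^sup>2))) * fourier_L1 (\<lambda>x. (u x)\<^sup>2) \<xi>])"

text \<open>\<open>S(t - s) \<partial>\<^sub>x F(v(s))\<close>, where \<open>G\<close> is the Fourier transform of \<open>F(v(s))\<close> and \<open>r = t - s\<close>.\<close>

definition S_dx_op ::
  "real \<Rightarrow> real \<Rightarrow> real \<Rightarrow> real \<Rightarrow> real \<Rightarrow> (real \<Rightarrow> complex^2) \<Rightarrow> L2 \<times> L2" where
  "S_dx_op a b c d r G =
     inv_fourier2 (\<lambda>\<xi>. S_symbol a b c d r \<xi> *v ((\<i> * of_real \<xi>) *s G \<xi>))"

text \<open>The Duhamel term is a vector-valued gauge integral, which extends the Bochner integral and
  ignores the endpoint \<open>s = t\<close>, where the integrand need not be an element of \<open>L\<^sup>2\<close>.\<close>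

definition mild_solution ::
  "real \<Rightarrow> real \<Rightarrow> real \<Rightarrow> real \<Rightarrow> (L2 \<times> L2 \<Rightarrow> real \<Rightarrow> complex^2)
     \<Rightarrow> L2 \<times> L2 \<Rightarrow> (real \<Rightarrow> L2 \<times> L2) \<Rightarrow> bool" where
  "mild_solution a b c d F_hat v0 v \<longleftrightarrow>
     continuous_on {0..} v \<and>
     (\<forall>t\<ge>0. \<exists>I. ((\<lambda>s. S_dx_op a b c d (t - s) (F_hat (v s))) has_integral I) {0..t} \<and>
              v t = S_op a b c d t v0 - I)"

end

theory Submission
  imports Defs "HOL-Probability.Characteristic_Functions"
begin

text \<open>The proof is the classical bootstrap for small solutions of a parabolic equation with a quadratic
  nonlinearity in divergence form, carried out on the Fourier side.

  \<^emph>\<open>Linear part.\<close> If \<open>\<sigma>\<close> is unbounded, the coefficients leave three cases (lemma \<open>KdV_Burgers_cases\<close>): both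
  components of the linear system are damped at the rate \<open>\<xi>\<^sup>2\<close>, or exactly one of them is, while the damping of the
  other one stays bounded at high frequencies. In the latter cases the coupling \<open>\<xi> \<sigma>\<close> has the size of \<open>\<xi>\<^sup>2\<close>, and
  an energy with a small mixed term shows that the strong damping acts on both components
  (\<open>energy_decay\<close>, \<open>coercive_coupled\<close>). Hence the symbol of the linear flow is bounded by a multiple of
  \<open>exp (- \<beta> \<xi>\<^sup>2 t)\<close>. Integrating this bound over the frequencies, the flow of integrable and square integrable
  data decays like \<open>t powr (-1/4)\<close> in \<open>L\<^sup>2\<close> (\<open>semigroup_decay\<close>).

  \<^emph>\<open>Nonlinear part.\<close> In the variables \<open>v\<close> the transform of \<open>F(v)\<close> is bounded by a multiple of
  \<open>(norm v)\<^sup>2\<close>: the transform of a product is bounded by the norms of its factors, and the symbols in front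
  of the products are bounded (\<open>F_hat_w_bound\<close>, \<open>F_hat_tau_bound\<close>). Together with the derivative, the flow
  turns this into the integrable kernel \<open>(t - s) powr (-3/4)\<close> in Duhamel's formula, and a bound of \<open>norm (v s)\<close>
  by \<open>M (1 + s) powr (-1/4)\<close> reproduces itself with a constant of order \<open>M\<^sup>2\<close> (\<open>duhamel_bound\<close>). For small
  data a continuity argument makes the bound hold for all times (\<open>small_solution_decay\<close>). Finally \<open>u\<close> or
  \<open>\<eta>\<close> is recovered from \<open>v\<close> by a multiplier that is bounded, and of order \<open>-1\<close> when a bound in \<open>H\<^sup>1\<close> is claimed.

  \<^emph>\<open>Fourier analysis.\<close> Everything rests on Plancherel's theorem and on the surjectivity of the transform
  on \<open>L\<^sup>2\<close>, without which neither the limit defining \<open>fourier\<close> nor the description defining \<open>inv_fourier\<close>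
  would be meaningful. The isometry is proved with a Gaussian regularisation
  (\<open>regularised_energy\<close>), Young's inequality and density of bounded continuous functions. Surjectivity needs no
  inversion formula: by the multiplication formula the adjoint of the transform is again the transform up to
  conjugations, hence isometric up to a factor, and this forces the composition of both to be a multiple of the
  identity (\<open>fourier_fourier_adj\<close>).\<close>

section \<open>The space of square integrable functions\<close>

lemma rep_L2_measurable [measurable]: "rep_L2 f \<in> borel_measurable borel"
  using square_integrable_rep_L2[of f] by (simp add: square_integrable_def)

lemma L2_rel_refl: "square_integrable f \<Longrightarrow> L2_rel f f"
  by (simp add: L2_rel_def)

lemma rep_abs_L2:
  assumes "square_integrable f"
  shows "AE x in lborel. rep_L2 (abs_L2 f) x = f x"
  using Quotient_rep_abs[OF Quotient_L2, OF L2_rel_refl[OF assms]] by (simp add: L2_rel_def)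

lemma abs_rep_L2: "abs_L2 (rep_L2 f) = f"
  by (rule Quotient_abs_rep[OF Quotient_L2])

lemma abs_L2_eqI:
  assumes "square_integrable f" "square_integrable g" "AE x in lborel. f x = g x"
  shows "abs_L2 f = abs_L2 g"
  using Quotient_rel_abs[OF Quotient_L2, of f g] assms by (simp add: L2_rel_def)

lemma L2_eqI:
  assumes "AE x in lborel. rep_L2 f x = rep_L2 g x"
  shows "f = g"
  using abs_L2_eqI[OF square_integrable_rep_L2 square_integrable_rep_L2 assms]
  by (simp add: abs_rep_L2)

lemma abs_L2_diff:
  "square_integrable f \<Longrightarrow> square_integrable g \<Longrightarrow> abs_L2 f - abs_L2 g = abs_L2 (\<lambda>x. f x - g x)"
  by (rule minus_L2.abs_eq) (auto intro: L2_rel_refl)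

lemma inner_abs_L2:
  "square_integrable f \<Longrightarrow> square_integrable g \<Longrightarrow> abs_L2 f \<bullet> abs_L2 g = (LBINT x. f x \<bullet> g x)"
  by (rule inner_L2.abs_eq) (auto intro: L2_rel_refl)

lemma norm_abs_L2_sq:
  "square_integrable f \<Longrightarrow> (norm (abs_L2 f))^2 = (LBINT x. (norm (f x))^2)"
  by (simp add: power2_norm_eq_inner inner_abs_L2)

lemma norm_L2_sq: "(norm (f::L2))^2 = (LBINT x. (norm (rep_L2 f x))^2)"
  using norm_abs_L2_sq[OF square_integrable_rep_L2, of f] by (simp add: abs_rep_L2)

lemma nn_integral_norm_abs_L2:
  assumes "square_integrable f"
  shows "(\<integral>\<^sup>+x. ennreal ((norm (f x))^2) \<partial>lborel) = ennreal ((norm (abs_L2 f))^2)"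
  using assms by (simp add: norm_abs_L2_sq nn_integral_eq_integral square_integrable_def)

lemma square_integrable_nnI:
  assumes "f \<in> borel_measurable lborel" "(\<integral>\<^sup>+x. ennreal ((norm (f x))^2) \<partial>lborel) < \<infinity>"
  shows "square_integrable f"
  using assms by (auto simp: square_integrable_def integrable_iff_bounded)

lemma norm_abs_L2_le:
  assumes "f \<in> borel_measurable lborel"
    "(\<integral>\<^sup>+x. ennreal ((norm (f x))^2) \<partial>lborel) \<le> ennreal (C^2)" "C \<ge> 0"
  shows "square_integrable f" "norm (abs_L2 f) \<le> C"
proof -
  show si: "square_integrable f"
    using assms(1) le_less_trans[OF assms(2) ennreal_less_top]
    by (intro square_integrable_nnI) simp_all
  have "ennreal ((norm (abs_L2 f))^2) \<le> ennreal (C^2)"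
    using assms(2) unfolding nn_integral_norm_abs_L2[OF si] .
  then have "(norm (abs_L2 f))^2 \<le> C^2"
    by (subst (asm) ennreal_le_iff) simp_all
  then show "norm (abs_L2 f) \<le> C" using assms(3) by (rule power2_le_imp_le)
qed

lemma square_integrable_bound:
  assumes "square_integrable g" "f \<in> borel_measurable lborel" "AE x in lborel. norm (f x) \<le> C * norm (g x)"
  shows "square_integrable f"
proof -
  have [measurable]: "f \<in> borel_measurable lborel" "g \<in> borel_measurable lborel"
    using assms by (auto simp: square_integrable_def)
  have "integrable lborel (\<lambda>x. C^2 * (norm (g x))^2)"
    using assms by (auto simp: square_integrable_def)
  then have "integrable lborel (\<lambda>x. (norm (f x))^2)"
  proof (rule Bochner_Integration.integrable_bound)
    show "AE x in lborel. norm ((norm (f x))^2) \<le> norm (C^2 * (norm (g x))^2)"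
      using assms(3)
    proof eventually_elim
      case (elim x)
      then have "(norm (f x))^2 \<le> (C * norm (g x))^2" by (intro power_mono) auto
      then show ?case by (simp add: power_mult_distrib)
    qed
  qed measurable
  then show ?thesis using assms by (simp add: square_integrable_def)
qed

lemma tendsto_abs_L2I:
  fixes s :: "'i \<Rightarrow> real \<Rightarrow> complex"
  assumes s: "\<And>n. square_integrable (s n)" and f: "square_integrable f"
    and lim: "((\<lambda>n. LBINT x. (norm (s n x - f x))^2) \<longlongrightarrow> 0) F"
  shows "((\<lambda>n. abs_L2 (s n)) \<longlongrightarrow> abs_L2 f) F"
proof -
  have "(LBINT x. (norm (s n x - f x))^2) = (norm (abs_L2 (s n) - abs_L2 f))^2" for n
    by (simp add: abs_L2_diff s f norm_abs_L2_sq square_integrable_diff)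
  with lim have "((\<lambda>n. sqrt ((norm (abs_L2 (s n) - abs_L2 f))^2)) \<longlongrightarrow> sqrt 0) F"
    by (intro tendsto_real_sqrt) simp
  then have "((\<lambda>n. norm (abs_L2 (s n) - abs_L2 f)) \<longlongrightarrow> 0) F" by simp
  then show ?thesis by (simp add: tendsto_norm_zero_iff LIM_zero_iff)
qed

text \<open>The core of the Riesz--Fischer theorem. The squared increments, weighted by powers of two, have
  an integrable sum, which forces pointwise convergence almost everywhere; Fatou's lemma then turns
  the pointwise limit into a limit in the mean.\<close>

lemma L2_fast_Cauchy_converges:
  fixes s :: "nat \<Rightarrow> L2"
  assumes fast: "\<And>n. norm (s (Suc n) - s n) \<le> (1/2)^n"
  shows "convergent s"
proof -
  define r where "r n = rep_L2 (s n)" for n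
  have si: "square_integrable (r n)" for n
    unfolding r_def by (rule square_integrable_rep_L2)
  have s_eq: "s n = abs_L2 (r n)" for n by (simp add: r_def abs_rep_L2)
  have [measurable]: "r n \<in> borel_measurable borel" for n by (simp add: r_def)
  define d where "d n x = norm (r (Suc n) x - r n x)" for n x
  have [measurable]: "d n \<in> borel_measurable borel" for n unfolding d_def by measurable
  have nd: "(\<integral>\<^sup>+x. ennreal ((norm (r m x - r n x))^2) \<partial>lborel) = ennreal ((norm (s m - s n))^2)" for m n
    using nn_integral_norm_abs_L2[OF square_integrable_diff[OF si si], of m n]
    by (simp add: s_eq abs_L2_diff si)
  have "(\<integral>\<^sup>+x. (\<Sum>n. ennreal (2^n * (d n x)^2)) \<partial>lborel) = (\<Sum>n. \<integral>\<^sup>+x. ennreal (2^n * (d n x)^2) \<partial>lborel)"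
    by (rule nn_integral_suminf) measurable
  also have "\<dots> \<le> (\<Sum>n. ennreal ((1/2)^n))"
  proof (rule suminf_le)
    fix n
    have "(\<integral>\<^sup>+x. ennreal (2^n * (d n x)^2) \<partial>lborel) = ennreal (2^n) * (\<integral>\<^sup>+x. ennreal ((d n x)^2) \<partial>lborel)"
      by (subst nn_integral_cmult[symmetric]) (auto simp: ennreal_mult)
    also have "\<dots> = ennreal (2^n * (norm (s (Suc n) - s n))^2)"
      by (simp add: d_def nd ennreal_mult)
    also have "\<dots> \<le> ennreal (2^n * ((1/2)^n)^2)"
      by (intro ennreal_leI mult_left_mono power_mono fast) auto
    also have "2^n * ((1/2)^n)^2 = (1/2::real)^n"
      by (simp add: power2_eq_square power_divide)
    finally show "(\<integral>\<^sup>+x. ennreal (2^n * (d n x)^2) \<partial>lborel) \<le> ennreal ((1/2)^n)" .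
  qed auto
  also have "\<dots> = ennreal (\<Sum>n. (1/2)^n)" by (rule suminf_ennreal2) (auto simp: summable_geometric)
  finally have fin: "(\<integral>\<^sup>+x. (\<Sum>n. ennreal (2^n * (d n x)^2)) \<partial>lborel) \<noteq> \<infinity>"
    unfolding infinity_ennreal_def by (rule neq_top_trans[rotated]) simp
  have "AE x in lborel. (\<Sum>n. ennreal (2^n * (d n x)^2)) \<noteq> \<infinity>"
    by (rule nn_integral_noteq_infinite[OF _ fin]) measurable
  then have conv: "AE x in lborel. convergent (\<lambda>n. r n x)"
  proof eventually_elim
    case (elim x)
    have sm: "summable (\<lambda>n. 2^n * (d n x)^2)"
      by (rule summable_suminf_not_top) (use elim in simp_all)
    have "summable (\<lambda>n. ((1/2)^n + 2^n * (d n x)^2))"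
      by (intro summable_add sm summable_geometric) auto
    then have "summable (\<lambda>n. d n x)"
    proof (rule summable_comparison_test')
      fix n
      have one: "sqrt ((1/2)^n) * sqrt (2^n) = 1"
        by (subst real_sqrt_mult[symmetric], subst power_mult_distrib[symmetric]) simp
      have "2 * d n x = 2 * (sqrt ((1/2)^n) * (sqrt (2^n) * d n x))"
        using one by (simp add: mult.assoc[symmetric])
      also have "\<dots> \<le> (sqrt ((1/2)^n))^2 + (sqrt (2^n) * d n x)^2"
        using sum_squares_bound[of "sqrt ((1/2)^n)" "sqrt (2^n) * d n x"] by (simp add: mult.assoc)
      also have "\<dots> = (1/2)^n + 2^n * (d n x)^2" by (simp add: power_mult_distrib)
      finally have "2 * d n x \<le> (1/2)^n + 2^n * (d n x)^2" .
      moreover have "0 \<le> d n x" by (simp add: d_def)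
      ultimately show "norm (d n x) \<le> (1/2)^n + 2^n * (d n x)^2" by simp
    qed
    then have "summable (\<lambda>n. r (Suc n) x - r n x)"
      unfolding d_def by (rule summable_norm_cancel)
    then have "convergent (\<lambda>n. (\<Sum>i<n. r (Suc i) x - r i x) + r 0 x)"
      by (intro convergent_add convergent_const) (simp add: summable_iff_convergent)
    then show ?case using sum_lessThan_telescope[of "\<lambda>i. r i x"] by simp
  qed
  define f where "f x = lim (\<lambda>n. r n x)" for x
  have fm [measurable]: "f \<in> borel_measurable borel" unfolding f_def by measurable
  have dist_le: "norm (s m - s n) \<le> 2 * (1/2)^n" if "n \<le> m" for m n
  proof -
    have 1: "norm (s (n+k) - s n) \<le> (\<Sum>i<k. (1/2)^(n+i))" for k
    proof (induction k)
      case (Suc k)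
      have "norm (s (n + Suc k) - s n) \<le> norm (s (Suc (n+k)) - s (n+k)) + norm (s (n+k) - s n)"
        using norm_triangle_ineq[of "s (Suc (n+k)) - s (n+k)" "s (n+k) - s n"] by simp
      with Suc fast[of "n+k"] show ?case by simp
    qed simp
    have 2: "(\<Sum>i<k. (1/2)^(n+i)) \<le> 2 * (1/2::real)^n" for k
    proof -
      have "(\<Sum>i<k. (1/2)^(n+i)) = (1/2::real)^n * (\<Sum>i<k. (1/2)^i)"
        by (simp add: power_add sum_distrib_left)
      also have "\<dots> \<le> (1/2::real)^n * 2"
        by (intro mult_left_mono) (simp_all add: geometric_sum)
      finally show ?thesis by (simp add: mult.commute)
    qed
    show ?thesis using order_trans[OF 1 2, of "m - n"] that by simp
  qed
  have fatou: "(\<integral>\<^sup>+x. ennreal ((norm (f x - r n x))^2) \<partial>lborel) \<le> ennreal ((2 * (1/2)^n)^2)" for n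
  proof -
    have "(\<integral>\<^sup>+x. ennreal ((norm (f x - r n x))^2) \<partial>lborel)
        = (\<integral>\<^sup>+x. liminf (\<lambda>m. ennreal ((norm (r m x - r n x))^2)) \<partial>lborel)"
    proof (rule nn_integral_cong_AE)
      from conv show "AE x in lborel. ennreal ((norm (f x - r n x))^2)
          = liminf (\<lambda>m. ennreal ((norm (r m x - r n x))^2))"
      proof eventually_elim
        case (elim x)
        then have "(\<lambda>m. r m x) \<longlonglongrightarrow> f x" by (simp add: f_def convergent_LIMSEQ_iff)
        then have "(\<lambda>m. ennreal ((norm (r m x - r n x))^2)) \<longlonglongrightarrow> ennreal ((norm (f x - r n x))^2)"
          by (intro tendsto_ennrealI tendsto_intros)
        then show ?case by (subst lim_imp_Liminf) auto
      qed
    qed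
    also have "\<dots> \<le> liminf (\<lambda>m. \<integral>\<^sup>+x. ennreal ((norm (r m x - r n x))^2) \<partial>lborel)"
      by (rule nn_integral_liminf) measurable
    also have "\<dots> = liminf (\<lambda>m. ennreal ((norm (s m - s n))^2))" by (simp add: nd)
    also have "\<dots> \<le> ennreal ((2 * (1/2)^n)^2)"
    proof (rule Liminf_le)
      show "\<forall>\<^sub>F m in sequentially. ennreal ((norm (s m - s n))^2) \<le> ennreal ((2 * (1/2)^n)^2)"
        using eventually_ge_at_top[of n]
        by eventually_elim (intro ennreal_leI power_mono dist_le, auto)
    qed simp
    finally show ?thesis .
  qed
  have sid: "square_integrable (\<lambda>x. f x - r n x)" "norm (abs_L2 (\<lambda>x. f x - r n x)) \<le> 2 * (1/2)^n" for n
  proof -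
    have m: "(\<lambda>x. f x - r n x) \<in> borel_measurable lborel" by measurable
    have c: "0 \<le> 2 * (1/2::real)^n" by simp
    show "square_integrable (\<lambda>x. f x - r n x)" by (rule norm_abs_L2_le(1)[OF m fatou c])
    show "norm (abs_L2 (\<lambda>x. f x - r n x)) \<le> 2 * (1/2)^n" by (rule norm_abs_L2_le(2)[OF m fatou c])
  qed
  have sf: "square_integrable f"
    using square_integrable_add[OF sid(1) si, of 0 0] by simp
  have le: "norm (s n - abs_L2 f) \<le> 2 * (1/2)^n" for n
    using sid(2)[of n] unfolding abs_L2_diff[OF sf si, symmetric] s_eq
    by (subst norm_minus_commute)
  have "(\<lambda>n. s n - abs_L2 f) \<longlonglongrightarrow> 0"
  proof (rule Lim_null_comparison)
    show "\<forall>\<^sub>F n in sequentially. norm (s n - abs_L2 f) \<le> 2 * (1/2)^n"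
      by (intro always_eventually allI le)
    show "(\<lambda>n. 2 * (1/2::real)^n) \<longlonglongrightarrow> 0"
      by (simp add: LIMSEQ_power_zero tendsto_mult_right_zero)
  qed
  then have "s \<longlonglongrightarrow> abs_L2 f" by (rule LIM_zero_cancel)
  then show ?thesis by (rule convergentI)
qed

section \<open>Plancherel's theorem\<close>

lemma norm_cis_mult [simp]: "norm (z * cis t) = norm z" "norm (cis t * z) = norm z"
  by (simp_all add: norm_mult)

lemma measurable_cis [measurable]: "cis \<in> borel_measurable borel"
  by (intro borel_measurable_continuous_onI continuous_intros)

lemma measurable_cnj [measurable]: "cnj \<in> borel_measurable borel"
  by (intro borel_measurable_continuous_onI continuous_intros)

lemma integrable_mult_cis:
  assumes "integrable lborel f" "g \<in> borel_measurable borel"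
  shows "integrable lborel (\<lambda>x. f x * cis (g x))"
proof (rule Bochner_Integration.integrable_bound[OF assms(1)])
  show "(\<lambda>x. f x * cis (g x)) \<in> borel_measurable lborel"
    using assms by measurable
qed simp

lemma fourier_L1_measurable [measurable]:
  assumes [measurable]: "f \<in> borel_measurable borel"
  shows "fourier_L1 f \<in> borel_measurable borel"
proof -
  have "(\<lambda>\<xi>. LBINT x. f x * cis (- (x * \<xi>))) \<in> borel_measurable lborel"
    by (rule lborel.borel_measurable_lebesgue_integral) measurable
  then show ?thesis by (simp add: fourier_L1_def[abs_def])
qed

lemma norm_fourier_L1_le: "norm (fourier_L1 f \<xi>) \<le> (LBINT x. norm (f x))"
  unfolding fourier_L1_def
  by (rule order_trans[OF integral_norm_bound]) simp

lemma fourier_L1_diff: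
  assumes "integrable lborel f" "integrable lborel g"
  shows "fourier_L1 (\<lambda>x. f x - g x) \<xi> = fourier_L1 f \<xi> - fourier_L1 g \<xi>"
  using assms by (simp add: fourier_L1_def left_diff_distrib integrable_mult_cis)

lemma lborel_integral_reflect:
  fixes f :: "real \<Rightarrow> complex"
  shows "(LBINT x. f (- x)) = (LBINT x. f x)"
  by (subst (2) lborel_integral_real_affine[where c="-1" and t=0]) simp_all

lemma fourier_L1_cnj:
  "cnj (fourier_L1 f \<xi>) = fourier_L1 (\<lambda>x. cnj (f (- x))) \<xi>"
proof -
  have "cnj (fourier_L1 f \<xi>) = (LBINT x. cnj (f x) * cis (x * \<xi>))"
    unfolding fourier_L1_def by (simp add: cis_cnj flip: Bochner_Integration.integral_cnj)
  also have "\<dots> = (LBINT x. cnj (f (- x)) * cis (- (x * \<xi>)))"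
    using lborel_integral_reflect[of "\<lambda>x. cnj (f x) * cis (x * \<xi>)"] by simp
  finally show ?thesis by (simp add: fourier_L1_def)
qed

text \<open>This is Fubini's theorem, since the kernel of the transform is symmetric.\<close>

lemma fourier_L1_multiplication_formula:
  assumes f: "integrable lborel f" and g: "integrable lborel g"
  shows "(LBINT \<xi>. fourier_L1 f \<xi> * g \<xi>) = (LBINT x. f x * fourier_L1 g x)"
proof -
  have [measurable]: "f \<in> borel_measurable borel" "g \<in> borel_measurable borel"
    using f g by auto
  have "integrable (lborel \<Otimes>\<^sub>M lborel) (\<lambda>(x, \<xi>). f x * cis (- (x * \<xi>)) * g \<xi>)"
  proof (rule lborel_pair.Fubini_integrable)
    show "(\<lambda>(x, \<xi>). f x * cis (- (x * \<xi>)) * g \<xi>) \<in> borel_measurable (lborel \<Otimes>\<^sub>M lborel)"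
      by measurable
    have "integrable lborel (\<lambda>x. norm (f x) * (LBINT \<xi>. norm (g \<xi>)))"
      using f by (intro integrable_mult_left integrable_norm)
    then show "integrable lborel (\<lambda>x. LBINT \<xi>. norm (case (x, \<xi>) of (x, \<xi>) \<Rightarrow> f x * cis (- (x * \<xi>)) * g \<xi>))"
      by (simp add: norm_mult)
    show "AE x in lborel. integrable lborel (\<lambda>\<xi>. case (x, \<xi>) of (x, \<xi>) \<Rightarrow> f x * cis (- (x * \<xi>)) * g \<xi>)"
      using integrable_mult_cis[OF g] by (auto simp: mult_ac)
  qed
  from lborel_pair.Fubini_integral[OF this]
  have "(LBINT \<xi>. (LBINT x. f x * cis (- (x * \<xi>)) * g \<xi>))
      = (LBINT x. (LBINT \<xi>. f x * cis (- (x * \<xi>)) * g \<xi>))" by simp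
  moreover have "(LBINT x. f x * cis (- (x * \<xi>)) * g \<xi>) = fourier_L1 f \<xi> * g \<xi>" for \<xi>
    unfolding fourier_L1_def by (rule integral_mult_left_zero)
  moreover have "(LBINT \<xi>. f x * cis (- (x * \<xi>)) * g \<xi>) = f x * fourier_L1 g x" for x
    unfolding fourier_L1_def by (subst integral_mult_right_zero[symmetric]) (simp add: mult_ac)
  ultimately show ?thesis by (simp only:)
qed

text \<open>The characteristic function of the standard normal law, rescaled. The result is \<open>2 \<pi>\<close> times a
  probability density in \<open>z\<close>, and this is where the constant in Plancherel's theorem comes from.\<close>

lemma fourier_L1_gaussian:
  assumes e: "e > 0"
  shows "fourier_L1 (\<lambda>x. of_real (exp (- e * x^2 / 2))) z = of_real (2 * pi * normal_density 0 (sqrt e) z)"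
proof -
  define t where "t = - z / sqrt e"
  have "complex_of_real (exp (- (t^2) / 2)) = char std_normal_distribution t"
    by (simp add: char_std_normal_distribution)
  also have "\<dots> = (LBINT x. std_normal_density x *\<^sub>R iexp (t * x))"
    unfolding char_def by (subst integral_density) (auto simp: normal_density_nonneg)
  also have "\<dots> = sqrt e *\<^sub>R (LBINT x. std_normal_density (sqrt e * x) *\<^sub>R iexp (t * (sqrt e * x)))"
    using e by (subst lborel_integral_real_affine[where c="sqrt e" and t=0]) simp_all
  also have "(LBINT x. std_normal_density (sqrt e * x) *\<^sub>R iexp (t * (sqrt e * x)))
      = (LBINT x. (1 / sqrt (2 * pi)) *\<^sub>R (of_real (exp (- e * x^2 / 2)) * cis (- (x * z))))"
  proof (rule Bochner_Integration.integral_cong)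
    fix x
    have "t * (sqrt e * x) = - (x * z)" using e by (simp add: t_def)
    moreover have "std_normal_density (sqrt e * x) = (1 / sqrt (2 * pi)) * exp (- e * x^2 / 2)"
      using e by (simp add: std_normal_density_def power_mult_distrib)
    ultimately show "std_normal_density (sqrt e * x) *\<^sub>R iexp (t * (sqrt e * x))
        = (1 / sqrt (2 * pi)) *\<^sub>R (of_real (exp (- e * x^2 / 2)) * cis (- (x * z)))"
      by (simp add: cis_conv_exp scaleR_conv_of_real)
  qed simp
  also have "\<dots> = (1 / sqrt (2 * pi)) *\<^sub>R fourier_L1 (\<lambda>x. of_real (exp (- e * x^2 / 2))) z"
    by (simp add: fourier_L1_def)
  finally have "fourier_L1 (\<lambda>x. of_real (exp (- e * x^2 / 2))) z
      = (sqrt (2 * pi) / sqrt e) *\<^sub>R complex_of_real (exp (- (t^2) / 2))"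
    using e by simp
  also have "\<dots> = of_real (sqrt (2 * pi) / sqrt e * exp (- (t^2) / 2))"
    by (simp add: scaleR_conv_of_real)
  also have "sqrt (2 * pi) / sqrt e * exp (- (t^2) / 2) = 2 * pi * normal_density 0 (sqrt e) z"
  proof -
    have "2 * pi / sqrt (2 * pi * e) = sqrt (2 * pi) / sqrt e"
      using e by (simp add: real_sqrt_mult field_simps)
    moreover have "2 * pi * normal_density 0 (sqrt e) z = 2 * pi / sqrt (2 * pi * e) * exp (- (t^2) / 2)"
      using e by (simp add: normal_density_def t_def power_divide mult.commute)
    ultimately show ?thesis by simp
  qed
  finally show ?thesis .
qed

lemma integrable_gaussian:
  assumes "e > 0"
  shows "integrable lborel (\<lambda>x::real. exp (- e * x^2 / 2))"
proof -
  have "integrable lborel (\<lambda>x. sqrt (2 * pi * (1 / e)) * normal_density 0 (sqrt (1 / e)) x)"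
    using assms by (intro integrable_mult_right integrable_normal_density) simp
  also have "(\<lambda>x. sqrt (2 * pi * (1 / e)) * normal_density 0 (sqrt (1 / e)) x) = (\<lambda>x. exp (- e * x^2 / 2))"
    using assms by (auto simp: normal_density_def fun_eq_iff)
  finally show ?thesis .
qed

text \<open>Convolution of the conjugate of \<open>f\<close> with a centred normal density; the conjugate is built in because
  only the sesquilinear form \<open>\<integral> f * mollified_cnj \<sigma> f\<close> is used.\<close>

definition mollified_cnj :: "real \<Rightarrow> (real \<Rightarrow> complex) \<Rightarrow> real \<Rightarrow> complex" where
  "mollified_cnj \<sigma> f x = (LBINT y. cnj (f y) * of_real (normal_density 0 \<sigma> (x - y)))"

lemma mollified_cnj_measurable [measurable]:
  assumes [measurable]: "f \<in> borel_measurable borel"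
  shows "mollified_cnj \<sigma> f \<in> borel_measurable borel"
  unfolding mollified_cnj_def[abs_def] by measurable

text \<open>The energy of the transform, regularised by a Gaussian weight, is a quadratic form in \<open>f\<close>
  whose kernel is an approximate identity.\<close>

lemma regularised_energy:
  assumes f: "integrable lborel f" and e: "e > 0"
  shows "(LBINT \<xi>. (norm (fourier_L1 f \<xi>))^2 * exp (- e * \<xi>^2 / 2))
    = 2 * pi * (LBINT x. f x * mollified_cnj (sqrt e) f x)"
proof -
  have [measurable]: "f \<in> borel_measurable borel" using f by auto
  define w where "w \<xi> = complex_of_real (exp (- e * \<xi>^2 / 2))" for \<xi> :: real
  have w: "integrable lborel w" unfolding w_def
    using integrable_gaussian[OF e] by (intro integrable_of_real)
  have [measurable]: "w \<in> borel_measurable borel" using w by auto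
  define g where "g \<xi> = cnj (fourier_L1 f \<xi>) * w \<xi>" for \<xi>
  have g: "integrable lborel g" unfolding g_def
  proof (rule Bochner_Integration.integrable_bound)
    show "integrable lborel (\<lambda>\<xi>. (LBINT x. norm (f x)) *\<^sub>R w \<xi>)" using w by simp
    show "AE \<xi> in lborel. norm (cnj (fourier_L1 f \<xi>) * w \<xi>) \<le> norm ((LBINT x. norm (f x)) *\<^sub>R w \<xi>)"
      by (rule AE_I2) (auto simp: norm_mult norm_fourier_L1_le intro!: mult_right_mono)
  qed measurable
  have fr: "integrable lborel (\<lambda>y. cnj (f (- y)))"
    using lborel_integrable_real_affine[OF f, of "-1" 0] by simp
  have ghat: "fourier_L1 g x = 2 * pi * mollified_cnj (sqrt e) f x" for x
  proof -
    have wx: "integrable lborel (\<lambda>\<xi>. w \<xi> * cis (- (\<xi> * x)))" by (intro integrable_mult_cis w) simp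
    have what: "fourier_L1 (\<lambda>\<xi>. w \<xi> * cis (- (\<xi> * x))) y = of_real (2 * pi * normal_density 0 (sqrt e) (x + y))" for y
    proof -
      have "fourier_L1 (\<lambda>\<xi>. w \<xi> * cis (- (\<xi> * x))) y = fourier_L1 w (x + y)"
        unfolding fourier_L1_def by (simp add: mult.assoc cis_mult distrib_left add.commute)
      also have "\<dots> = of_real (2 * pi * normal_density 0 (sqrt e) (x + y))"
        unfolding w_def by (rule fourier_L1_gaussian[OF e])
      finally show ?thesis .
    qed
    have "fourier_L1 g x = (LBINT \<xi>. fourier_L1 (\<lambda>y. cnj (f (- y))) \<xi> * (w \<xi> * cis (- (\<xi> * x))))"
      by (subst fourier_L1_def) (simp add: g_def fourier_L1_cnj mult_ac)
    also have "\<dots> = (LBINT y. cnj (f (- y)) * fourier_L1 (\<lambda>\<xi>. w \<xi> * cis (- (\<xi> * x))) y)"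
      by (rule fourier_L1_multiplication_formula[OF fr wx])
    also have "\<dots> = (LBINT y. cnj (f y) * of_real (2 * pi * normal_density 0 (sqrt e) (x - y)))"
      using lborel_integral_reflect[of "\<lambda>y. cnj (f y) * of_real (2 * pi * normal_density 0 (sqrt e) (x - y))"]
      unfolding what by simp
    also have "\<dots> = (LBINT y. (2 * pi) * (cnj (f y) * of_real (normal_density 0 (sqrt e) (x - y))))"
      by (simp add: mult_ac)
    also have "\<dots> = 2 * pi * mollified_cnj (sqrt e) f x"
      unfolding mollified_cnj_def by (rule integral_mult_right_zero)
    finally show ?thesis .
  qed
  have "complex_of_real (LBINT \<xi>. (norm (fourier_L1 f \<xi>))^2 * exp (- e * \<xi>^2 / 2))
      = (LBINT \<xi>. of_real ((norm (fourier_L1 f \<xi>))^2 * exp (- e * \<xi>^2 / 2)))"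
    by (rule integral_complex_of_real[symmetric])
  also have "\<dots> = (LBINT \<xi>. fourier_L1 f \<xi> * g \<xi>)"
    by (intro Bochner_Integration.integral_cong refl)
      (simp add: g_def w_def complex_norm_square mult.assoc[symmetric] flip: of_real_power)
  also have "\<dots> = (LBINT x. f x * fourier_L1 g x)"
    by (rule fourier_L1_multiplication_formula[OF f g])
  also have "\<dots> = (LBINT x. (2 * pi) * (f x * mollified_cnj (sqrt e) f x))"
    by (simp add: ghat mult_ac)
  also have "\<dots> = 2 * pi * (LBINT x. f x * mollified_cnj (sqrt e) f x)"
    by (rule integral_mult_right_zero)
  finally show ?thesis .
qed

lemma ennreal_norm_integral_le:
  fixes f :: "'a \<Rightarrow> complex"
  shows "ennreal (norm (integral\<^sup>L M f)) \<le> (\<integral>\<^sup>+x. ennreal (norm (f x)) \<partial>M)"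
proof (cases "integrable M f")
  case True
  then show ?thesis by (rule integral_norm_bound_ennreal)
next
  case False
  then show ?thesis by (simp add: not_integrable_integral_eq)
qed

lemma nn_integral_normal_density:
  assumes "\<sigma> > 0"
  shows "(\<integral>\<^sup>+y. ennreal (normal_density 0 \<sigma> (x - y)) \<partial>lborel) = 1"
    "(\<integral>\<^sup>+y. ennreal (normal_density 0 \<sigma> (y - x)) \<partial>lborel) = 1"
proof -
  have eq: "normal_density 0 \<sigma> (x - y) = normal_density x \<sigma> y" "normal_density 0 \<sigma> (y - x) = normal_density x \<sigma> y" for y
    by (simp_all add: normal_density_def power2_commute)
  have "(\<integral>\<^sup>+y. ennreal (normal_density x \<sigma> y) \<partial>lborel) = ennreal (LBINT y. normal_density x \<sigma> y)"
    using assms by (intro nn_integral_eq_integral integrable_normal_density) (auto simp: normal_density_nonneg)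
  also have "\<dots> = 1" using assms by simp
  finally show "(\<integral>\<^sup>+y. ennreal (normal_density 0 \<sigma> (x - y)) \<partial>lborel) = 1"
    "(\<integral>\<^sup>+y. ennreal (normal_density 0 \<sigma> (y - x)) \<partial>lborel) = 1"
    by (simp_all add: eq)
qed

text \<open>Young's inequality for the convolution with a probability density.\<close>

lemma mollified_form_le:
  assumes f: "square_integrable f" and s: "\<sigma> > 0"
  shows "norm (LBINT x. f x * mollified_cnj \<sigma> f x)
    \<le> (LBINT x. (norm (f x))^2)"
proof -
  let ?n = "normal_density 0 \<sigma>"
  let ?q = "\<lambda>x y. ennreal ((norm (f x))^2 / 2) * ennreal (?n (x - y)) + ennreal ((norm (f y))^2 / 2) * ennreal (?n (x - y))"
  let ?N = "LBINT x. (norm (f x))^2"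
  have [measurable]: "f \<in> borel_measurable borel" using f by (simp add: square_integrable_def)
  have n0: "0 \<le> ?n x" for x by (simp add: normal_density_nonneg)
  have N: "(\<integral>\<^sup>+x. ennreal ((norm (f x))^2) \<partial>lborel) = ennreal ?N"
    using f by (intro nn_integral_eq_integral) (auto simp: square_integrable_def)
  have "ennreal (norm (LBINT x. f x * mollified_cnj \<sigma> f x))
      \<le> (\<integral>\<^sup>+x. ennreal (norm (f x * mollified_cnj \<sigma> f x)) \<partial>lborel)"
    by (rule ennreal_norm_integral_le)
  also have "\<dots> \<le> (\<integral>\<^sup>+x. (\<integral>\<^sup>+y. ?q x y \<partial>lborel) \<partial>lborel)"
  proof (rule nn_integral_mono)
    fix x
    have "ennreal (norm (f x * mollified_cnj \<sigma> f x))
        = ennreal (norm (LBINT y. f x * (cnj (f y) * of_real (?n (x - y)))))"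
      by (simp add: mollified_cnj_def)
    also have "\<dots> \<le> (\<integral>\<^sup>+y. ennreal (norm (f x * (cnj (f y) * of_real (?n (x - y))))) \<partial>lborel)"
      by (rule ennreal_norm_integral_le)
    also have "\<dots> \<le> (\<integral>\<^sup>+y. ?q x y \<partial>lborel)"
    proof (rule nn_integral_mono)
      fix y
      have "norm (f x * (cnj (f y) * of_real (?n (x - y)))) = (norm (f x) * norm (f y)) * ?n (x - y)"
        by (simp add: norm_mult n0)
      also have "\<dots> \<le> ((norm (f x))^2 / 2 + (norm (f y))^2 / 2) * ?n (x - y)"
        using sum_squares_bound[of "norm (f x)" "norm (f y)"] by (intro mult_right_mono n0) simp
      finally show "ennreal (norm (f x * (cnj (f y) * of_real (?n (x - y)))))
          \<le> ?q x y"
        by (simp add: n0 distrib_right flip: ennreal_mult ennreal_plus)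
    qed
    finally show "ennreal (norm (f x * mollified_cnj \<sigma> f x))
      \<le> (\<integral>\<^sup>+y. ?q x y \<partial>lborel)" .
  qed
  also have "\<dots> = (\<integral>\<^sup>+x. (\<integral>\<^sup>+y. ennreal ((norm (f x))^2 / 2) * ennreal (?n (x - y)) \<partial>lborel) \<partial>lborel)
      + (\<integral>\<^sup>+x. (\<integral>\<^sup>+y. ennreal ((norm (f y))^2 / 2) * ennreal (?n (x - y)) \<partial>lborel) \<partial>lborel)"
    by (subst nn_integral_add[symmetric]) (auto intro!: nn_integral_cong nn_integral_add)
  also have "(\<integral>\<^sup>+x. (\<integral>\<^sup>+y. ennreal ((norm (f y))^2 / 2) * ennreal (?n (x - y)) \<partial>lborel) \<partial>lborel)
      = (\<integral>\<^sup>+y. (\<integral>\<^sup>+x. ennreal ((norm (f y))^2 / 2) * ennreal (?n (x - y)) \<partial>lborel) \<partial>lborel)"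
    by (rule lborel_pair.Fubini') measurable
  also have "\<dots> = (\<integral>\<^sup>+y. ennreal ((norm (f y))^2 / 2) \<partial>lborel)"
    by (intro nn_integral_cong) (simp add: nn_integral_cmult nn_integral_normal_density s)
  also have "(\<integral>\<^sup>+x. (\<integral>\<^sup>+y. ennreal ((norm (f x))^2 / 2) * ennreal (?n (x - y)) \<partial>lborel) \<partial>lborel)
      = (\<integral>\<^sup>+y. ennreal ((norm (f y))^2 / 2) \<partial>lborel)"
    by (intro nn_integral_cong) (simp add: nn_integral_cmult nn_integral_normal_density s)
  also have "(\<integral>\<^sup>+y. ennreal ((norm (f y))^2 / 2) \<partial>lborel) + (\<integral>\<^sup>+y. ennreal ((norm (f y))^2 / 2) \<partial>lborel)
      = (\<integral>\<^sup>+y. ennreal ((norm (f y))^2) \<partial>lborel)"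
    by (subst nn_integral_add[symmetric]) (auto intro!: nn_integral_cong simp flip: ennreal_plus)
  also note N
  finally show ?thesis by (subst (asm) ennreal_le_iff) auto
qed

text \<open>The Gaussian weight is removed along a sequence, so that Fatou's lemma and dominated
  convergence apply directly.\<close>

definition reg :: "nat \<Rightarrow> real" where "reg n = 1 / real (Suc n)"

lemma reg_pos: "reg n > 0" by (simp add: reg_def)

lemma reg_tendsto: "reg \<longlonglongrightarrow> 0"
  unfolding reg_def using LIMSEQ_inverse_real_of_nat by (simp add: inverse_eq_divide)

lemma integrable_regularised_energy:
  assumes [measurable]: "f \<in> borel_measurable borel" and e: "e > 0"
  shows "integrable lborel (\<lambda>\<xi>. (norm (fourier_L1 f \<xi>))^2 * exp (- e * \<xi>^2 / 2))"
proof (rule Bochner_Integration.integrable_bound)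
  show "integrable lborel (\<lambda>\<xi>. (LBINT x. norm (f x))^2 * exp (- e * \<xi>^2 / 2))"
    using integrable_gaussian[OF e] by (rule integrable_mult_right)
  show "AE \<xi> in lborel. norm ((norm (fourier_L1 f \<xi>))^2 * exp (- e * \<xi>^2 / 2))
      \<le> norm ((LBINT x. norm (f x))^2 * exp (- e * \<xi>^2 / 2))"
    by (intro AE_I2) (auto simp: abs_mult intro!: mult_right_mono power_mono norm_fourier_L1_le)
qed measurable

text \<open>Half of Plancherel's theorem. It holds for all functions that are integrable and square
  integrable, because it uses only Young's inequality for the regularised energy and Fatou's lemma.\<close>

lemma fourier_L1_contraction:
  assumes f: "integrable lborel f" and f2: "square_integrable f"
  shows "(\<integral>\<^sup>+\<xi>. ennreal ((norm (fourier_L1 f \<xi>))^2) \<partial>lborel) \<le> ennreal (2 * pi * (LBINT x. (norm (f x))^2))"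
proof -
  let ?N = "LBINT x. (norm (f x))^2"
  let ?w = "\<lambda>n \<xi>. (norm (fourier_L1 f \<xi>))^2 * exp (- reg n * \<xi>^2 / 2)"
  have [measurable]: "f \<in> borel_measurable borel" using f by auto
  have le: "(\<integral>\<^sup>+\<xi>. ennreal (?w n \<xi>) \<partial>lborel) \<le> ennreal (2 * pi * ?N)" for n
  proof -
    let ?I = "LBINT \<xi>. ?w n \<xi>"
    have "?I \<le> norm (complex_of_real ?I)" by simp
    also have "\<dots> \<le> 2 * pi * ?N"
      unfolding regularised_energy[OF f reg_pos]
      using mollified_form_le[OF f2, of "sqrt (reg n)"] reg_pos[of n] by (simp add: norm_mult)
    finally have "?I \<le> 2 * pi * ?N" .
    moreover have "(\<integral>\<^sup>+\<xi>. ennreal (?w n \<xi>) \<partial>lborel) = ennreal ?I"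
      by (intro nn_integral_eq_integral integrable_regularised_energy reg_pos) auto
    ultimately show ?thesis by (simp add: ennreal_leI)
  qed
  have "(\<integral>\<^sup>+\<xi>. ennreal ((norm (fourier_L1 f \<xi>))^2) \<partial>lborel)
      = (\<integral>\<^sup>+\<xi>. liminf (\<lambda>n. ennreal (?w n \<xi>)) \<partial>lborel)"
  proof (rule nn_integral_cong)
    fix \<xi>
    have "(\<lambda>n. ennreal (?w n \<xi>)) \<longlonglongrightarrow> ennreal ((norm (fourier_L1 f \<xi>))^2 * exp (- 0 * \<xi>^2 / 2))"
      by (intro tendsto_ennrealI tendsto_intros reg_tendsto) simp
    then show "ennreal ((norm (fourier_L1 f \<xi>))^2) = liminf (\<lambda>n. ennreal (?w n \<xi>))"
      by (subst lim_imp_Liminf) auto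
  qed
  also have "\<dots> \<le> liminf (\<lambda>n. \<integral>\<^sup>+\<xi>. ennreal (?w n \<xi>) \<partial>lborel)"
    by (rule nn_integral_liminf) measurable
  also have "\<dots> \<le> ennreal (2 * pi * ?N)"
    by (rule Liminf_le) (use le in simp_all)
  finally show ?thesis .
qed

lemma mollifier_limit:
  assumes cont: "continuous_on UNIV f" and bd: "\<And>x. norm (f x) \<le> B"
  shows "(\<lambda>n. mollified_cnj (sqrt (reg n)) f x) \<longlonglongrightarrow> cnj (f x)"
    "norm (mollified_cnj (sqrt (reg n)) f x) \<le> B"
proof -
  have [measurable]: "f \<in> borel_measurable borel" using cont by (rule borel_measurable_continuous_onI)
  have eq: "mollified_cnj (sqrt (reg n)) f x
      = (LBINT z. std_normal_density z *\<^sub>R cnj (f (x - sqrt (reg n) * z)))" for n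
  proof -
    have s: "sqrt (reg n) > 0" using reg_pos[of n] by simp
    have "mollified_cnj (sqrt (reg n)) f x
        = sqrt (reg n) *\<^sub>R (LBINT z. cnj (f (x - sqrt (reg n) * z)) * of_real (normal_density 0 (sqrt (reg n)) (sqrt (reg n) * z)))"
      unfolding mollified_cnj_def
      using s by (subst lborel_integral_real_affine[where c="- sqrt (reg n)" and t=x]) simp_all
    also have "\<dots> = (LBINT z. sqrt (reg n) *\<^sub>R (cnj (f (x - sqrt (reg n) * z)) * of_real (normal_density 0 (sqrt (reg n)) (sqrt (reg n) * z))))"
      by (rule integral_scaleR_right[symmetric])
    also have "\<dots> = (LBINT z. std_normal_density z *\<^sub>R cnj (f (x - sqrt (reg n) * z)))"
    proof (intro Bochner_Integration.integral_cong refl)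
      fix z
      have "sqrt (reg n) * normal_density 0 (sqrt (reg n)) (sqrt (reg n) * z) = std_normal_density z"
        using s by (simp add: normal_density_def power_mult_distrib real_sqrt_mult)
      then show "sqrt (reg n) *\<^sub>R (cnj (f (x - sqrt (reg n) * z)) * of_real (normal_density 0 (sqrt (reg n)) (sqrt (reg n) * z)))
          = std_normal_density z *\<^sub>R cnj (f (x - sqrt (reg n) * z))"
        by (simp add: scaleR_conv_of_real flip: of_real_mult)
    qed
    finally show ?thesis .
  qed
  have int: "integrable lborel (\<lambda>z. std_normal_density z * B)"
    by (intro integrable_mult_left integrable_normal_density) simp
  have bd': "norm (std_normal_density z *\<^sub>R cnj (f y)) \<le> std_normal_density z * B" for z y
    using bd[of y] by (simp add: mult_left_mono normal_density_nonneg)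
  have "(\<lambda>n. LBINT z. std_normal_density z *\<^sub>R cnj (f (x - sqrt (reg n) * z))) \<longlonglongrightarrow> (LBINT z. std_normal_density z *\<^sub>R cnj (f x))"
  proof (rule integral_dominated_convergence[OF _ _ int])
    show "AE z in lborel. (\<lambda>n. std_normal_density z *\<^sub>R cnj (f (x - sqrt (reg n) * z))) \<longlonglongrightarrow> std_normal_density z *\<^sub>R cnj (f x)"
    proof (intro AE_I2 tendsto_intros)
      fix z
      have "(\<lambda>n. x - sqrt (reg n) * z) \<longlonglongrightarrow> x - sqrt 0 * z"
        by (intro tendsto_intros reg_tendsto)
      then show "(\<lambda>n. f (x - sqrt (reg n) * z)) \<longlonglongrightarrow> f x"
        using continuous_on_tendsto_compose[OF cont] by simp
    qed
    show "AE z in lborel. norm (std_normal_density z *\<^sub>R cnj (f (x - sqrt (reg n) * z))) \<le> std_normal_density z * B" for n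
      by (intro AE_I2 bd')
  qed measurable
  then show "(\<lambda>n. mollified_cnj (sqrt (reg n)) f x) \<longlonglongrightarrow> cnj (f x)"
    unfolding eq by simp
  show "norm (mollified_cnj (sqrt (reg n)) f x) \<le> B"
  proof -
    have "norm (LBINT z. std_normal_density z *\<^sub>R cnj (f (x - sqrt (reg n) * z))) \<le> (LBINT z. std_normal_density z * B)"
    proof (rule order_trans[OF integral_norm_bound integral_mono'[OF int bd']])
      show "0 \<le> std_normal_density z * B" for z
        using order_trans[OF norm_ge_zero bd'] .
    qed
    then show ?thesis unfolding eq by simp
  qed
qed

text \<open>The other half, on functions for which mollification converges pointwise: the quadratic form
  tends to \<open>\<integral> |f|^2\<close>, while the regularised energy never exceeds the full one.\<close>

lemma fourier_L1_expansion:
  assumes cont: "continuous_on UNIV f" and bd: "\<And>x. norm (f x) \<le> B" and f: "integrable lborel f"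
    and f2: "square_integrable f"
  shows "2 * pi * (LBINT x. (norm (f x))^2) \<le> (LBINT \<xi>. (norm (fourier_L1 f \<xi>))^2)"
proof -
  let ?I = "\<lambda>n. mollified_cnj (sqrt (reg n)) f"
  let ?w = "\<lambda>n \<xi>. (norm (fourier_L1 f \<xi>))^2 * exp (- reg n * \<xi>^2 / 2)"
  have [measurable]: "f \<in> borel_measurable borel" using f by auto
  have fin: "integrable lborel (\<lambda>\<xi>. (norm (fourier_L1 f \<xi>))^2)"
    using fourier_L1_contraction[OF f f2] by (auto simp: integrable_iff_bounded intro: le_less_trans)
  have "(\<lambda>n. 2 * pi * (LBINT x. f x * ?I n x)) \<longlonglongrightarrow> 2 * pi * (LBINT x. f x * cnj (f x))"
  proof (intro tendsto_mult tendsto_const integral_dominated_convergence[where w="\<lambda>x. norm (f x) * B"])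
    show "integrable lborel (\<lambda>x. norm (f x) * B)" using f by simp
    show "AE x in lborel. (\<lambda>n. f x * ?I n x) \<longlonglongrightarrow> f x * cnj (f x)"
      by (intro AE_I2 tendsto_mult tendsto_const mollifier_limit[OF cont bd])
    show "AE x in lborel. norm (f x * ?I n x) \<le> norm (f x) * B" for n
      by (intro AE_I2) (simp add: norm_mult mult_left_mono mollifier_limit[OF cont bd])
  qed measurable
  also have "(LBINT x. f x * cnj (f x)) = of_real (LBINT x. (norm (f x))^2)"
    by (simp add: complex_norm_square[symmetric] flip: of_real_power)
  finally have "(\<lambda>n. complex_of_real (LBINT \<xi>. ?w n \<xi>))
      \<longlonglongrightarrow> of_real (2 * pi * (LBINT x. (norm (f x))^2))"
    unfolding regularised_energy[OF f reg_pos] by simp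
  then have "(\<lambda>n. LBINT \<xi>. ?w n \<xi>)
      \<longlonglongrightarrow> 2 * pi * (LBINT x. (norm (f x))^2)"
    by (simp only: tendsto_of_real_iff)
  then show ?thesis
  proof (rule LIMSEQ_le_const2)
    show "\<exists>N. \<forall>n\<ge>N. (LBINT \<xi>. ?w n \<xi>)
        \<le> (LBINT \<xi>. (norm (fourier_L1 f \<xi>))^2)"
    proof (intro exI allI impI integral_mono fin integrable_regularised_energy reg_pos)
      fix n \<xi>
      have "exp (- reg n * \<xi>^2 / 2) \<le> 1" using reg_pos[of n] by simp
      then show "?w n \<xi> \<le> (norm (fourier_L1 f \<xi>))^2"
        by (intro mult_left_le) auto
    qed auto
  qed
qed

subsection \<open>Density\<close>

lemma square_integrable_dominated:
  fixes w :: "real \<Rightarrow> real"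
  assumes "f \<in> borel_measurable lborel" "integrable lborel (\<lambda>x. (w x)^2)" "AE x in lborel. norm (f x) \<le> w x"
  shows "square_integrable f"
proof -
  have [measurable]: "f \<in> borel_measurable borel" using assms by simp
  have "integrable lborel (\<lambda>x. (norm (f x))^2)"
  proof (rule Bochner_Integration.integrable_bound[OF assms(2)])
    show "AE x in lborel. norm ((norm (f x))^2) \<le> norm ((w x)^2)"
      using assms(3) by eventually_elim (simp add: power_mono)
  qed measurable
  then show ?thesis using assms(1) by (simp add: square_integrable_def)
qed

lemma abs_L2_dominated_convergence:
  fixes s :: "nat \<Rightarrow> real \<Rightarrow> complex" and w :: "real \<Rightarrow> real"
  assumes s [measurable]: "\<And>n. s n \<in> borel_measurable lborel" and f [measurable]: "f \<in> borel_measurable lborel"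
    and w: "integrable lborel (\<lambda>x. (w x)^2)"
    and bound: "\<And>n. AE x in lborel. norm (s n x) \<le> w x" "AE x in lborel. norm (f x) \<le> w x"
    and lim: "AE x in lborel. (\<lambda>n. s n x) \<longlonglongrightarrow> f x"
  shows "(\<lambda>n. abs_L2 (s n)) \<longlonglongrightarrow> abs_L2 f"
proof (rule tendsto_abs_L2I)
  show "square_integrable (s n)" for n by (rule square_integrable_dominated[OF s w bound(1)])
  show "square_integrable f" by (rule square_integrable_dominated[OF f w bound(2)])
  have "(\<lambda>n. LBINT x. (norm (s n x - f x))^2) \<longlonglongrightarrow> (\<integral>(x::real). 0 \<partial>lborel)"
  proof (rule integral_dominated_convergence[where w="\<lambda>x. 4 * (w x)^2"])
    show "AE x in lborel. (\<lambda>n. (norm (s n x - f x))^2) \<longlonglongrightarrow> 0"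
      using lim
    proof eventually_elim
      case (elim x)
      then have "(\<lambda>n. (norm (s n x - f x))^2) \<longlonglongrightarrow> (norm (f x - f x))^2"
        by (intro tendsto_intros)
      then show ?case by simp
    qed
    show "AE x in lborel. norm ((norm (s n x - f x))^2) \<le> 4 * (w x)^2" for n
      using bound(1)[of n] bound(2)
    proof eventually_elim
      case (elim x)
      then have "norm (s n x - f x) \<le> 2 * w x"
        using norm_triangle_ineq4[of "s n x" "f x"] by linarith
      then have "(norm (s n x - f x))^2 \<le> (2 * w x)^2" by (intro power_mono) auto
      then show ?case by (simp add: power_mult_distrib)
    qed
    show "integrable lborel (\<lambda>x. 4 * (w x)^2)" using w by simp
  qed measurable
  then show "(\<lambda>n. LBINT x. (norm (s n x - f x))^2) \<longlonglongrightarrow> 0" by simp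
qed

text \<open>Radial retraction onto a ball: unlike setting large values to zero, it preserves continuity of
  the approximating functions.\<close>

definition clamp_norm :: "real \<Rightarrow> complex \<Rightarrow> complex" where
  "clamp_norm B z = (B / max B (norm z)) *\<^sub>R z"

lemma clamp_norm:
  assumes "B > 0"
  shows "continuous_on UNIV (clamp_norm B)" "norm (clamp_norm B z) \<le> B" "norm z \<le> B \<Longrightarrow> clamp_norm B z = z"
proof -
  have "max B (norm z) > 0" for z :: complex using assms by (simp add: less_max_iff_disj)
  then have nz: "max B (norm z) \<noteq> 0" for z :: complex by (metis less_irrefl)
  then show "continuous_on UNIV (clamp_norm B)"
    unfolding clamp_norm_def by (intro continuous_intros) auto
  have "B * norm z \<le> B * max B (norm z)" using assms by (intro mult_left_mono) auto
  then show "norm (clamp_norm B z) \<le> B"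
    using assms by (simp add: clamp_norm_def abs_mult divide_le_eq less_max_iff_disj)
  show "norm z \<le> B \<Longrightarrow> clamp_norm B z = z" using assms by (simp add: clamp_norm_def max_def)
qed

definition cutoff :: "real \<Rightarrow> real \<Rightarrow> real" where
  "cutoff B x = max 0 (min 1 (B + 1 - \<bar>x\<bar>))"

lemma cutoff:
  "continuous_on UNIV (cutoff B)" "0 \<le> cutoff B x" "cutoff B x \<le> indicator {-(B+1)..B+1} x"
  "\<bar>x\<bar> \<le> B \<Longrightarrow> cutoff B x = 1"
  unfolding cutoff_def by (intro continuous_intros) (auto simp: indicator_def)

text \<open>First the function is cut off where it or its argument is large. A measurable function is an almost
  everywhere limit of continuous ones; retracting these onto a ball and cutting them off outside an
  interval provides the common square integrable majorant for dominated convergence.\<close>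

lemma dense_bounded_continuous:
  assumes f: "square_integrable f" and \<delta>: "\<delta> > 0"
  obtains g B where "continuous_on UNIV g" "\<And>x. norm (g x) \<le> B" "integrable lborel g"
    "square_integrable g" "norm (abs_L2 f - abs_L2 g) < \<delta>"
proof -
  have fm [measurable]: "f \<in> borel_measurable borel" using f by (simp add: square_integrable_def)
  define r where "r n x = (if \<bar>x\<bar> \<le> real n \<and> norm (f x) \<le> real n then f x else 0)" for n x
  have rm [measurable]: "r n \<in> borel_measurable borel" for n unfolding r_def by measurable
  have "(\<lambda>n. abs_L2 (r n)) \<longlonglongrightarrow> abs_L2 f"
  proof (rule abs_L2_dominated_convergence[where w="\<lambda>x. norm (f x)"])
    show "integrable lborel (\<lambda>x. (norm (f x))^2)" using f by (simp add: square_integrable_def)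
    show "AE x in lborel. (\<lambda>n. r n x) \<longlonglongrightarrow> f x"
    proof (intro AE_I2 tendsto_eventually)
      fix x
      obtain N where N: "real N \<ge> max \<bar>x\<bar> (norm (f x))" using real_arch_simple by blast
      show "\<forall>\<^sub>F n in sequentially. r n x = f x"
        using eventually_ge_at_top[of N]
        by eventually_elim (use N in \<open>auto simp: r_def\<close>)
    qed
  qed (auto simp: r_def)
  then have "\<forall>\<^sub>F n in sequentially. dist (abs_L2 (r n)) (abs_L2 f) < \<delta> / 2"
    using \<delta> by (intro tendstoD) simp_all
  then have "\<forall>\<^sub>F n in sequentially. dist (abs_L2 (r n)) (abs_L2 f) < \<delta> / 2 \<and> n \<ge> 1"
    using eventually_ge_at_top by (rule eventually_conj)
  then obtain n where n: "dist (abs_L2 (r n)) (abs_L2 f) < \<delta> / 2" "n \<ge> 1"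
    by (auto simp: eventually_sequentially)
  let ?B = "real n"
  have B: "?B > 0" using n by simp
  have rb: "norm (r n x) \<le> ?B" for x by (simp add: r_def)
  have rs: "\<bar>x\<bar> > ?B \<Longrightarrow> r n x = 0" for x by (simp add: r_def)
  have "r n \<in> borel_measurable (lebesgue_on UNIV)"
    using measurable_completion[of "r n" lborel borel] rm[of n] by (simp add: lebesgue_on_UNIV_eq)
  then have "r n measurable_on UNIV" by (subst measurable_on_iff_borel_measurable) simp_all
  then obtain N h where N: "negligible N" and h: "\<And>k. continuous_on UNIV (h k)"
      and lim: "\<And>x. x \<notin> N \<Longrightarrow> (\<lambda>k. h k x) \<longlonglongrightarrow> r n x"
    unfolding measurable_on_def by auto
  define g where "g k x = cutoff ?B x *\<^sub>R clamp_norm ?B (h k x)" for k x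
  have gc: "continuous_on UNIV (g k)" for k
    unfolding g_def
    by (intro continuous_on_scaleR cutoff continuous_on_compose2[OF clamp_norm(1)[OF B] h]) auto
  have gb': "norm (g k x) \<le> ?B * indicator {-(?B+1)..?B+1} x" for k x
    using cutoff(2,3)[of ?B x] clamp_norm(2)[OF B, of "h k x"]
    by (auto simp: g_def mult.commute[of ?B] intro!: mult_mono)
  have gb: "norm (g k x) \<le> ?B" for k x
    using gb'[of k x] by (rule order_trans) (auto simp: indicator_def)
  have gm [measurable]: "g k \<in> borel_measurable borel" for k
    using gc by (rule borel_measurable_continuous_onI)
  have w1: "integrable lborel (\<lambda>x. ?B * indicator {-(?B+1)..?B+1} x)"
    by simp
  have w2: "integrable lborel (\<lambda>x. (?B * indicator {-(?B+1)..?B+1} x)^2)"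
  proof -
    have eq: "(?B * indicator {-(?B+1)..?B+1} x)^2 = ?B^2 * indicator {-(?B+1)..?B+1} x" for x :: real
      by (simp add: indicator_def)
    show ?thesis unfolding eq by simp
  qed
  have gi: "integrable lborel (g k)" for k
    by (rule Bochner_Integration.integrable_bound[OF w1])
      (use gb' gm in \<open>auto intro!: AE_I2 order_trans[OF gb' abs_ge_self]\<close>)
  have g2: "square_integrable (g k)" for k
    by (rule square_integrable_dominated[OF _ w2]) (use gb' gm in \<open>auto intro!: AE_I2\<close>)
  have "(\<lambda>k. abs_L2 (g k)) \<longlonglongrightarrow> abs_L2 (r n)"
  proof (rule abs_L2_dominated_convergence[OF _ _ w2])
    show "AE x in lborel. norm (g k x) \<le> ?B * indicator {-(?B+1)..?B+1} x" for k
      by (intro AE_I2 gb')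
    show "AE x in lborel. norm (r n x) \<le> ?B * indicator {-(?B+1)..?B+1} x"
      using rb rs by (intro AE_I2) (auto simp: indicator_def)
    have "AE x in lebesgue. x \<notin> N"
      using N by (simp add: AE_not_in negligible_iff_null_sets)
    then have "AE x in lborel. x \<notin> N"
      by (simp add: AE_completion_iff)
    then show "AE x in lborel. (\<lambda>k. g k x) \<longlonglongrightarrow> r n x"
    proof eventually_elim
      case (elim x)
      have "(\<lambda>k. g k x) \<longlonglongrightarrow> cutoff ?B x *\<^sub>R clamp_norm ?B (r n x)"
        unfolding g_def using lim[OF elim]
        by (intro tendsto_intros continuous_on_tendsto_compose[OF clamp_norm(1)[OF B]]) auto
      moreover have "cutoff ?B x *\<^sub>R clamp_norm ?B (r n x) = r n x"
        using cutoff(4)[of x ?B] rs[of x] clamp_norm(3)[OF B rb[of x]] by (cases "\<bar>x\<bar> \<le> ?B") auto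
      ultimately show ?case by simp
    qed
  qed measurable
  then have "\<forall>\<^sub>F k in sequentially. dist (abs_L2 (g k)) (abs_L2 (r n)) < \<delta> / 2"
    using \<delta> by (intro tendstoD) simp_all
  then obtain k where k: "dist (abs_L2 (g k)) (abs_L2 (r n)) < \<delta> / 2"
    by (auto simp: eventually_sequentially)
  have "norm (abs_L2 f - abs_L2 (g k)) < \<delta>"
    using dist_triangle[of "abs_L2 f" "abs_L2 (g k)" "abs_L2 (r n)"] k n
    by (simp add: dist_commute dist_norm[symmetric])
  then show ?thesis using that[OF gc gb gi g2] by blast
qed

subsection \<open>The transform on the intersection of the Lebesgue spaces\<close>

lemma fourier_L1_bounded_L2:
  assumes f: "integrable lborel f" and f2: "square_integrable f"
  shows "square_integrable (fourier_L1 f)" "norm (abs_L2 (fourier_L1 f)) \<le> sqrt (2 * pi) * norm (abs_L2 f)"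
proof -
  have m: "fourier_L1 f \<in> borel_measurable lborel" using f by simp
  have eq: "(sqrt (2 * pi) * norm (abs_L2 f))^2 = 2 * pi * (LBINT x. (norm (f x))^2)"
    by (simp add: power_mult_distrib norm_abs_L2_sq f2)
  have "(\<integral>\<^sup>+\<xi>. ennreal ((norm (fourier_L1 f \<xi>))^2) \<partial>lborel) \<le> ennreal ((sqrt (2 * pi) * norm (abs_L2 f))^2)"
    unfolding eq by (rule fourier_L1_contraction[OF f f2])
  from norm_abs_L2_le[OF m this] show "square_integrable (fourier_L1 f)"
    "norm (abs_L2 (fourier_L1 f)) \<le> sqrt (2 * pi) * norm (abs_L2 f)" by simp_all
qed

lemma abs_fourier_L1_diff:
  assumes "integrable lborel f" "square_integrable f" "integrable lborel g" "square_integrable g"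
  shows "abs_L2 (fourier_L1 f) - abs_L2 (fourier_L1 g) = abs_L2 (fourier_L1 (\<lambda>x. f x - g x))"
proof -
  have "fourier_L1 (\<lambda>x. f x - g x) = (\<lambda>\<xi>. fourier_L1 f \<xi> - fourier_L1 g \<xi>)"
    using assms by (intro ext fourier_L1_diff)
  then show ?thesis using assms by (simp add: abs_L2_diff fourier_L1_bounded_L2)
qed

text \<open>The contraction property extends the lower bound from the dense class of bounded continuous
  functions to all of \<open>L\<^sup>1 \<inter> L\<^sup>2\<close>.\<close>

theorem Plancherel_L1_L2:
  assumes f: "integrable lborel f" and f2: "square_integrable f"
  shows "norm (abs_L2 (fourier_L1 f)) = sqrt (2 * pi) * norm (abs_L2 f)"
proof (rule antisym)
  let ?c = "sqrt (2 * pi)"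
  have c: "?c > 0" by simp
  show "norm (abs_L2 (fourier_L1 f)) \<le> ?c * norm (abs_L2 f)"
    by (rule fourier_L1_bounded_L2[OF f f2])
  show "?c * norm (abs_L2 f) \<le> norm (abs_L2 (fourier_L1 f))"
  proof (rule field_le_epsilon)
    fix e :: real assume e: "e > 0"
    define \<delta> where "\<delta> = e / (2 * ?c)"
    have \<delta>: "\<delta> > 0" using e by (simp add: \<delta>_def)
    obtain g B where g: "continuous_on UNIV g" "\<And>x. norm (g x) \<le> B" "integrable lborel g"
      "square_integrable g" "norm (abs_L2 f - abs_L2 g) < \<delta>"
      by (rule dense_bounded_continuous[OF f2 \<delta>]) blast
    have "(?c * norm (abs_L2 g))^2 \<le> (norm (abs_L2 (fourier_L1 g)))^2"
      using fourier_L1_expansion[OF g(1-4)] fourier_L1_bounded_L2(1)[OF g(3,4)] g(4)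
      by (simp add: power_mult_distrib norm_abs_L2_sq)
    then have 1: "?c * norm (abs_L2 g) \<le> norm (abs_L2 (fourier_L1 g))" by (rule power2_le_imp_le) simp
    have "norm (abs_L2 (fourier_L1 f) - abs_L2 (fourier_L1 g)) = norm (abs_L2 (fourier_L1 (\<lambda>x. f x - g x)))"
      by (simp add: abs_fourier_L1_diff f f2 g)
    also have "\<dots> \<le> ?c * norm (abs_L2 (\<lambda>x. f x - g x))"
      using f f2 g by (intro fourier_L1_bounded_L2 square_integrable_diff) auto
    also have "\<dots> = ?c * norm (abs_L2 f - abs_L2 g)" using f2 g by (simp add: abs_L2_diff)
    also have "\<dots> \<le> ?c * \<delta>" using g(5) c by (intro mult_left_mono) auto
    finally have 2: "norm (abs_L2 (fourier_L1 f) - abs_L2 (fourier_L1 g)) \<le> ?c * \<delta>" .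
    have 3: "?c * norm (abs_L2 f) \<le> ?c * (norm (abs_L2 g) + \<delta>)"
      using g(5) norm_triangle_sub[of "abs_L2 f" "abs_L2 g"] c by (intro mult_left_mono) auto
    have "?c * \<delta> + ?c * \<delta> = e" using c by (simp add: \<delta>_def)
    moreover have "norm (abs_L2 (fourier_L1 g)) \<le> norm (abs_L2 (fourier_L1 f)) + ?c * \<delta>"
      using 2 norm_triangle_sub[of "abs_L2 (fourier_L1 g)" "abs_L2 (fourier_L1 f)"]
      by (simp add: norm_minus_commute)
    ultimately show "?c * norm (abs_L2 f) \<le> norm (abs_L2 (fourier_L1 f)) + e"
      using 1 3 unfolding distrib_left by linarith
  qed
qed

subsection \<open>The transform on the Hilbert space\<close>

definition trunc :: "real \<Rightarrow> (real \<Rightarrow> complex) \<Rightarrow> real \<Rightarrow> complex" where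
  "trunc R f x = indicator {-R..R} x *\<^sub>R f x"

lemma trunc_measurable [measurable]:
  "f \<in> borel_measurable borel \<Longrightarrow> trunc R f \<in> borel_measurable borel"
  unfolding trunc_def[abs_def] by measurable

lemma norm_trunc_le: "norm (trunc R f x) \<le> norm (f x)"
  by (simp add: trunc_def indicator_def)

lemma square_integrable_trunc:
  assumes "square_integrable f"
  shows "square_integrable (trunc R f)"
  using assms by (intro square_integrable_bound[OF assms, where C=1])
    (auto simp: norm_trunc_le square_integrable_def)

text \<open>On a bounded interval the square of the modulus controls the modulus.\<close>

lemma integrable_trunc:
  assumes f: "square_integrable f"
  shows "integrable lborel (trunc R f)"
proof (rule Bochner_Integration.integrable_bound)
  have [measurable]: "f \<in> borel_measurable borel" using f by (simp add: square_integrable_def)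
  show "integrable lborel (\<lambda>x. indicator {-R..R} x + (norm (f x))^2)"
    using f by (intro Bochner_Integration.integrable_add integrable_real_indicator)
      (auto simp: square_integrable_def emeasure_lborel_Icc_eq)
  show "trunc R f \<in> borel_measurable lborel" by simp
  show "AE x in lborel. norm (trunc R f x) \<le> norm (indicator {-R..R} x + (norm (f x))^2)"
  proof (rule AE_I2)
    fix x
    have "0 \<le> (norm (f x))^2" by simp
    moreover have "norm (f x) \<le> 1 + (norm (f x))^2"
      using sum_squares_bound[of "norm (f x)" 1] norm_ge_zero[of "f x"]
      unfolding one_power2 mult_1_right by linarith
    ultimately show "norm (trunc R f x) \<le> norm (indicator {-R..R} x + (norm (f x))^2)"
      by (simp add: trunc_def indicator_def)
  qed
qed

lemma tendsto_trunc:
  assumes f: "square_integrable f"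
  shows "((\<lambda>R. abs_L2 (trunc R f)) \<longlongrightarrow> abs_L2 f) at_top"
proof (rule tendsto_abs_L2I[OF square_integrable_trunc[OF f] f])
  have [measurable]: "f \<in> borel_measurable borel" using f by (simp add: square_integrable_def)
  have "((\<lambda>R. LBINT x. (norm (trunc R f x - f x))^2) \<longlongrightarrow> (\<integral>(x::real). 0 \<partial>lborel)) at_top"
  proof (rule integral_dominated_convergence_at_top[where w="\<lambda>x. (norm (f x))^2"])
    show "integrable lborel (\<lambda>x. (norm (f x))^2)" using f by (simp add: square_integrable_def)
    show "\<forall>\<^sub>F R in at_top. AE x in lborel. norm ((norm (trunc R f x - f x))^2) \<le> (norm (f x))^2"
      by (intro always_eventually allI AE_I2) (simp add: trunc_def indicator_def)
    show "AE x in lborel. ((\<lambda>R. (norm (trunc R f x - f x))^2) \<longlongrightarrow> 0) at_top"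
    proof (intro AE_I2 tendsto_eventually)
      fix x
      show "\<forall>\<^sub>F R in at_top. (norm (trunc R f x - f x))^2 = 0"
        using eventually_ge_at_top[of "\<bar>x\<bar>"]
        by eventually_elim (auto simp: trunc_def indicator_def)
    qed
  qed measurable
  then show "((\<lambda>R. LBINT x. (norm (trunc R f x - f x))^2) \<longlongrightarrow> 0) at_top" by simp
qed

text \<open>Convergence along \<open>at_top\<close> is reduced to a fast Cauchy sequence \<open>h (R n)\<close>; the comparison with the
  convergent \<open>k\<close> both selects the points \<open>R n\<close> and controls \<open>h\<close> between them.\<close>

lemma tendsto_of_comparison:
  fixes h k :: "real \<Rightarrow> L2"
  assumes k: "(k \<longlongrightarrow> l) at_top" and C: "C > 0"
    and hk: "\<And>R S. norm (h R - h S) \<le> C * norm (k R - k S)"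
  shows "\<exists>y. (h \<longlongrightarrow> y) at_top"
proof -
  have "\<exists>R. \<forall>S\<ge>R. norm (k S - l) < (1/2)^n / (2 * C)" for n
    using tendstoD[OF k, of "(1/2)^n / (2 * C)"] C by (simp add: eventually_at_top_linorder dist_norm)
  then obtain R where R: "\<And>n S. S \<ge> R n \<Longrightarrow> norm (k S - l) < (1/2)^n / (2 * C)" by metis
  have le: "norm (h S - h (R n)) \<le> (1/2)^n" if "norm (k S - l) \<le> (1/2)^n / (2 * C)" for S n
  proof -
    have "norm (k S - k (R n)) \<le> norm (k S - l) + norm (k (R n) - l)"
      using norm_triangle_ineq4[of "k S - l" "k (R n) - l"] by simp
    also have "\<dots> \<le> (1/2)^n / (2 * C) + (1/2)^n / (2 * C)"
      using that R[of n "R n"] by simp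
    also have "\<dots> = (1/2)^n / C" by simp
    finally have "C * norm (k S - k (R n)) \<le> C * ((1/2)^n / C)" using C by (intro mult_left_mono) auto
    with hk[of S "R n"] C show ?thesis by simp
  qed
  have "convergent (\<lambda>n. h (R n))"
  proof (rule L2_fast_Cauchy_converges)
    fix n
    have "norm (k (R (Suc n)) - l) \<le> (1/2)^Suc n / (2 * C)" using R[of "Suc n" "R (Suc n)"] by simp
    also have "\<dots> \<le> (1/2)^n / (2 * C)" using C by (intro divide_right_mono) auto
    finally show "norm (h (R (Suc n)) - h (R n)) \<le> (1/2)^n" by (rule le)
  qed
  then obtain y where y: "(\<lambda>n. h (R n)) \<longlonglongrightarrow> y" by (auto simp: convergent_def)
  have "(h \<longlongrightarrow> y) at_top"
  proof (rule tendstoI)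
    fix e :: real assume e: "e > 0"
    have "\<forall>\<^sub>F n in sequentially. dist (h (R n)) y < e / 2" using y e by (intro tendstoD) auto
    moreover have "\<forall>\<^sub>F n in sequentially. dist ((1/2::real)^n) 0 < e / 2"
      using e by (intro tendstoD) (auto simp: LIMSEQ_power_zero)
    ultimately have "\<forall>\<^sub>F n in sequentially. dist (h (R n)) y < e / 2 \<and> (1/2::real)^n < e / 2"
      by eventually_elim (auto simp: dist_real_def)
    then obtain n where n: "dist (h (R n)) y < e / 2" "(1/2::real)^n < e / 2"
      by (auto simp: eventually_sequentially)
    show "\<forall>\<^sub>F S in at_top. dist (h S) y < e"
      using eventually_ge_at_top[of "R n"]
    proof eventually_elim
      case (elim S)
      have "dist (h S) (h (R n)) \<le> (1/2)^n"
        using le[of S n] R[OF elim] by (simp add: dist_norm)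
      then show ?case using n dist_triangle[of "h S" y "h (R n)"] by simp
    qed
  qed
  then show ?thesis by blast
qed

lemma fourier_tendsto:
  assumes g: "square_integrable g" "f = abs_L2 g"
  shows "((\<lambda>R. abs_L2 (fourier_L1 (trunc R g))) \<longlongrightarrow> fourier f) at_top"
proof -
  let ?h = "\<lambda>R. abs_L2 (fourier_L1 (trunc R g))" and ?k = "\<lambda>R. abs_L2 (trunc R g)"
  note t = integrable_trunc[OF g(1)] square_integrable_trunc[OF g(1)]
  have "norm (?h R - ?h S) \<le> sqrt (2 * pi) * norm (?k R - ?k S)" for R S
    by (simp add: abs_fourier_L1_diff abs_L2_diff t Plancherel_L1_L2 square_integrable_diff)
  then obtain y where y: "(?h \<longlongrightarrow> y) at_top"
    using tendsto_of_comparison[OF tendsto_trunc[OF g(1)], of "sqrt (2 * pi)" ?h] by auto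
  have "AE x in lborel. rep_L2 f x = g x" using g by (simp add: rep_abs_L2)
  then have "fourier_L1 (trunc R (rep_L2 f)) = fourier_L1 (trunc R g)" for R
    unfolding fourier_L1_def trunc_def using g(1)
    by (intro ext integral_cong_AE) (auto simp: square_integrable_def elim: eventually_mono)
  then have "fourier f = Lim at_top ?h"
    unfolding fourier_def by (simp add: trunc_def[abs_def])
  also have "\<dots> = y" by (rule tendsto_Lim[OF _ y]) simp
  finally show ?thesis using y by simp
qed

lemmas fourier_rep_tendsto = fourier_tendsto[OF square_integrable_rep_L2 abs_rep_L2[symmetric]]

theorem Plancherel: "norm (fourier f) = sqrt (2 * pi) * norm f"
proof (rule tendsto_unique[OF trivial_limit_at_top_linorder])
  have "((\<lambda>R. norm (abs_L2 (fourier_L1 (trunc R (rep_L2 f))))) \<longlongrightarrow> norm (fourier f)) at_top"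
    by (intro tendsto_norm fourier_rep_tendsto)
  then show "((\<lambda>R. sqrt (2 * pi) * norm (abs_L2 (trunc R (rep_L2 f)))) \<longlongrightarrow> norm (fourier f)) at_top"
    by (simp add: Plancherel_L1_L2 integrable_trunc square_integrable_trunc square_integrable_rep_L2)
  have "((\<lambda>R. abs_L2 (trunc R (rep_L2 f))) \<longlongrightarrow> f) at_top"
    using tendsto_trunc[OF square_integrable_rep_L2, of f] by (simp add: abs_rep_L2)
  then show "((\<lambda>R. sqrt (2 * pi) * norm (abs_L2 (trunc R (rep_L2 f)))) \<longlongrightarrow> sqrt (2 * pi) * norm f) at_top"
    by (intro tendsto_intros)
qed

lemma fourier_diff: "fourier (f - g) = fourier f - fourier g"
proof (rule tendsto_unique[OF trivial_limit_at_top_linorder])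
  let ?f = "rep_L2 f" and ?g = "rep_L2 g"
  note si = square_integrable_rep_L2
  have fg: "f - g = abs_L2 (\<lambda>x. ?f x - ?g x)"
    using abs_L2_diff[OF si si, of f g] by (simp add: abs_rep_L2)
  have eq: "abs_L2 (fourier_L1 (trunc R (\<lambda>x. ?f x - ?g x)))
      = abs_L2 (fourier_L1 (trunc R ?f)) - abs_L2 (fourier_L1 (trunc R ?g))" for R
  proof -
    have "trunc R (\<lambda>x. ?f x - ?g x) = (\<lambda>x. trunc R ?f x - trunc R ?g x)"
      by (auto simp: trunc_def scaleR_diff_right)
    then show ?thesis
      by (simp add: abs_fourier_L1_diff integrable_trunc square_integrable_trunc si)
  qed
  show "((\<lambda>R. abs_L2 (fourier_L1 (trunc R (\<lambda>x. ?f x - ?g x)))) \<longlongrightarrow> fourier (f - g)) at_top"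
    by (rule fourier_tendsto[OF square_integrable_diff[OF si si] fg])
  show "((\<lambda>R. abs_L2 (fourier_L1 (trunc R (\<lambda>x. ?f x - ?g x)))) \<longlongrightarrow> fourier f - fourier g) at_top"
    unfolding eq by (intro tendsto_diff fourier_rep_tendsto)
qed

lemma fourier_inj: "fourier f = fourier g \<Longrightarrow> f = g"
  using Plancherel[of "f - g"] by (simp add: fourier_diff)

lemma fourier_eq_fourier_L1:
  assumes "integrable lborel (rep_L2 f)"
  shows "fourier f = abs_L2 (fourier_L1 (rep_L2 f))"
proof (rule tendsto_unique[OF trivial_limit_at_top_linorder])
  let ?f = "rep_L2 f"
  note si = square_integrable_rep_L2[of f]
  show "((\<lambda>R. abs_L2 (fourier_L1 (trunc R ?f))) \<longlongrightarrow> fourier f) at_top"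
    by (rule fourier_rep_tendsto)
  have "((\<lambda>R. abs_L2 (trunc R ?f) - abs_L2 ?f) \<longlongrightarrow> 0) at_top"
    using tendsto_trunc[OF si] by (rule LIM_zero)
  then have "((\<lambda>R. sqrt (2 * pi) * norm (abs_L2 (trunc R ?f) - abs_L2 ?f)) \<longlongrightarrow> sqrt (2 * pi) * norm (0::L2)) at_top"
    by (intro tendsto_intros)
  moreover have "norm (abs_L2 (fourier_L1 (trunc R ?f)) - abs_L2 (fourier_L1 ?f)) = sqrt (2 * pi) * norm (abs_L2 (trunc R ?f) - abs_L2 ?f)" for R
    using assms by (simp add: abs_fourier_L1_diff abs_L2_diff integrable_trunc si square_integrable_trunc Plancherel_L1_L2 square_integrable_diff)
  ultimately have "((\<lambda>R. norm (abs_L2 (fourier_L1 (trunc R ?f)) - abs_L2 (fourier_L1 ?f))) \<longlongrightarrow> 0) at_top"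
    by simp
  then show "((\<lambda>R. abs_L2 (fourier_L1 (trunc R ?f))) \<longlongrightarrow> abs_L2 (fourier_L1 ?f)) at_top"
    by (simp add: tendsto_norm_zero_iff LIM_zero_iff)
qed

text \<open>Conjugation turns the transform into its adjoint.\<close>

definition cnj_L2 :: "L2 \<Rightarrow> L2" where
  "cnj_L2 f = abs_L2 (\<lambda>x. cnj (rep_L2 f x))"

lemma square_integrable_cnj: "square_integrable f \<Longrightarrow> square_integrable (\<lambda>x. cnj (f x))"
  by (auto simp: square_integrable_def)

lemma cnj_abs_L2: "square_integrable f \<Longrightarrow> cnj_L2 (abs_L2 f) = abs_L2 (\<lambda>x. cnj (f x))"
  unfolding cnj_L2_def using rep_abs_L2[of f]
  by (intro abs_L2_eqI square_integrable_cnj square_integrable_rep_L2)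
    (auto elim: eventually_mono)

lemma cnj_L2_diff: "cnj_L2 f - cnj_L2 g = cnj_L2 (f - g)"
proof -
  note si = square_integrable_rep_L2
  have "f - g = abs_L2 (\<lambda>x. rep_L2 f x - rep_L2 g x)"
    using abs_L2_diff[OF si si, of f g] by (simp add: abs_rep_L2)
  then have "cnj_L2 (f - g) = abs_L2 (\<lambda>x. cnj (rep_L2 f x - rep_L2 g x))"
    by (simp add: cnj_abs_L2 square_integrable_diff si)
  then show ?thesis
    by (simp add: cnj_L2_def abs_L2_diff square_integrable_cnj si)
qed

lemma norm_cnj_L2: "norm (cnj_L2 f) = norm f"
proof -
  have "(norm (cnj_L2 f))^2 = (norm f)^2"
    unfolding cnj_L2_def
    by (subst norm_abs_L2_sq) (simp_all add: square_integrable_cnj square_integrable_rep_L2 norm_L2_sq)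
  then show ?thesis by simp
qed

lemma tendsto_cnj_L2:
  assumes "(h \<longlongrightarrow> y) F"
  shows "((\<lambda>n. cnj_L2 (h n)) \<longlongrightarrow> cnj_L2 y) F"
proof -
  have "((\<lambda>n. norm (cnj_L2 (h n) - cnj_L2 y)) \<longlongrightarrow> 0) F"
    unfolding cnj_L2_diff norm_cnj_L2 using assms by (simp add: tendsto_norm_zero_iff LIM_zero_iff)
  then show ?thesis by (simp add: tendsto_norm_zero_iff LIM_zero_iff)
qed

definition fourier_adj :: "L2 \<Rightarrow> L2" where
  "fourier_adj g = cnj_L2 (fourier (cnj_L2 g))"

lemma norm_fourier_adj: "norm (fourier_adj g) = sqrt (2 * pi) * norm g"
  by (simp add: fourier_adj_def norm_cnj_L2 Plancherel)

lemma inner_complex_Re: "z \<bullet> w = Re (z * cnj w)" for z w :: complex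
  by (simp add: inner_complex_def)

lemma fourier_adjoint_L1:
  assumes f: "integrable lborel f" "square_integrable f" and g: "integrable lborel g" "square_integrable g"
  shows "abs_L2 (fourier_L1 f) \<bullet> abs_L2 g = abs_L2 f \<bullet> abs_L2 (\<lambda>x. cnj (fourier_L1 (\<lambda>y. cnj (g y)) x))"
proof -
  have gc: "integrable lborel (\<lambda>y. cnj (g y))" "square_integrable (\<lambda>y. cnj (g y))"
    using g by (auto intro: square_integrable_cnj)
  have gh: "square_integrable (fourier_L1 (\<lambda>y. cnj (g y)))" by (rule fourier_L1_bounded_L2[OF gc])
  have 1: "(LBINT x. h x \<bullet> k x) = Re (LBINT x. h x * cnj (k x))"
    if "square_integrable h" "square_integrable k" for h k
  proof -
    have [measurable]: "h \<in> borel_measurable borel" "k \<in> borel_measurable borel"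
      using that by (auto simp: square_integrable_def)
    have "integrable lborel (\<lambda>x. (norm (h x))^2 + (norm (k x))^2)"
      using that by (auto simp: square_integrable_def)
    then have "integrable lborel (\<lambda>x. h x * cnj (k x))"
    proof (rule Bochner_Integration.integrable_bound)
      show "AE x in lborel. norm (h x * cnj (k x)) \<le> norm ((norm (h x))^2 + (norm (k x))^2)"
      proof (intro AE_I2)
        fix x
        have "2 * (norm (h x) * norm (k x)) \<le> (norm (h x))^2 + (norm (k x))^2"
          using sum_squares_bound[of "norm (h x)" "norm (k x)"] by (simp add: mult.assoc)
        moreover have "0 \<le> norm (h x) * norm (k x)" by simp
        ultimately show "norm (h x * cnj (k x)) \<le> norm ((norm (h x))^2 + (norm (k x))^2)"
          unfolding norm_mult complex_mod_cnj real_norm_def by linarith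
      qed
    qed measurable
    then show ?thesis unfolding inner_complex_Re by (rule integral_Re)
  qed
  have "abs_L2 (fourier_L1 f) \<bullet> abs_L2 g = Re (LBINT x. fourier_L1 f x * cnj (g x))"
    using f g by (simp add: inner_abs_L2 fourier_L1_bounded_L2 1)
  also have "\<dots> = Re (LBINT x. f x * fourier_L1 (\<lambda>y. cnj (g y)) x)"
    by (rule arg_cong[where f=Re, OF fourier_L1_multiplication_formula[OF f(1) gc(1)]])
  also have "\<dots> = abs_L2 f \<bullet> abs_L2 (\<lambda>x. cnj (fourier_L1 (\<lambda>y. cnj (g y)) x))"
    using 1[OF f(2) square_integrable_cnj[OF gh]]
    by (simp add: inner_abs_L2 f(2) square_integrable_cnj gh)
  finally show ?thesis .
qed

lemma fourier_adjoint: "fourier f \<bullet> g = f \<bullet> fourier_adj g"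
proof (rule tendsto_unique[OF trivial_limit_at_top_linorder])
  let ?f = "rep_L2 f" and ?g = "rep_L2 g"
  note si = square_integrable_rep_L2
  note t = integrable_trunc[OF si] square_integrable_trunc[OF si]
  note c = square_integrable_cnj[OF si]
  have lim: "((\<lambda>R. abs_L2 (trunc R (rep_L2 h))) \<longlongrightarrow> h) at_top" for h
    using tendsto_trunc[OF si, of h] by (simp add: abs_rep_L2)
  show "((\<lambda>R. abs_L2 (fourier_L1 (trunc R ?f)) \<bullet> abs_L2 (trunc R ?g)) \<longlongrightarrow> fourier f \<bullet> g) at_top"
    by (intro tendsto_inner fourier_rep_tendsto lim)
  have "((\<lambda>R. abs_L2 (fourier_L1 (trunc R (\<lambda>x. cnj (?g x))))) \<longlongrightarrow> fourier (cnj_L2 g)) at_top"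
    by (rule fourier_tendsto[OF c]) (simp add: cnj_L2_def)
  then have "((\<lambda>R. abs_L2 (trunc R ?f) \<bullet> cnj_L2 (abs_L2 (fourier_L1 (trunc R (\<lambda>x. cnj (?g x)))))) \<longlongrightarrow> f \<bullet> fourier_adj g) at_top"
    unfolding fourier_adj_def by (intro tendsto_inner tendsto_cnj_L2 lim)
  moreover have "abs_L2 (fourier_L1 (trunc R ?f)) \<bullet> abs_L2 (trunc R ?g)
      = abs_L2 (trunc R ?f) \<bullet> cnj_L2 (abs_L2 (fourier_L1 (trunc R (\<lambda>x. cnj (?g x)))))" for R
  proof -
    have "(\<lambda>y. cnj (trunc R ?g y)) = trunc R (\<lambda>x. cnj (?g x))"
      by (auto simp: trunc_def)
    then show ?thesis
      by (simp add: fourier_adjoint_L1 t cnj_abs_L2 fourier_L1_bounded_L2 integrable_trunc square_integrable_trunc c)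
  qed
  ultimately show "((\<lambda>R. abs_L2 (fourier_L1 (trunc R ?f)) \<bullet> abs_L2 (trunc R ?g)) \<longlongrightarrow> f \<bullet> fourier_adj g) at_top"
    by simp
qed

text \<open>Up to constants the transform is an isometry with isometric adjoint, and such a map
  inverts its adjoint: expanding the square of the norm of the difference of the two sides gives 0.\<close>

lemma fourier_fourier_adj: "fourier (fourier_adj g) = (2 * pi) *\<^sub>R g"
proof -
  let ?h = "fourier (fourier_adj g)"
  have s: "(norm ?h)^2 = (2 * pi)^2 * (norm g)^2"
    by (simp add: Plancherel norm_fourier_adj power_mult_distrib power2_eq_square[of pi])
  have i: "?h \<bullet> g = 2 * pi * (norm g)^2"
    unfolding fourier_adjoint power2_norm_eq_inner[symmetric] norm_fourier_adj
    by (simp add: power_mult_distrib)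
  have sq: "(norm (x - r *\<^sub>R y))^2 = (norm x)^2 - 2 * r * (x \<bullet> y) + r^2 * (norm y)^2" for x y :: L2 and r
    unfolding power2_norm_eq_inner inner_diff_left inner_diff_right inner_scaleR_left inner_scaleR_right
      inner_commute[of y x] by (simp only: power2_eq_square algebra_simps)
  have "(norm (?h - (2 * pi) *\<^sub>R g))^2 = 0"
    unfolding sq s i by (simp add: power2_eq_square)
  then show ?thesis by simp
qed

lemma fourier_surj: "\<exists>f. fourier f = g"
proof
  show "fourier (fourier_adj ((1 / (2 * pi)) *\<^sub>R g)) = g"
    by (simp add: fourier_fourier_adj)
qed

text \<open>Injectivity and surjectivity of the transform make the description that defines \<open>inv_fourier\<close>
  a proper one.\<close>

lemma rep_inv_fourier:
  assumes g: "square_integrable g"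
  shows "AE \<xi> in lborel. rep_L2 (fourier (inv_fourier g)) \<xi> = g \<xi>"
proof -
  obtain f where "fourier f = abs_L2 g" using fourier_surj by blast
  then have f: "AE \<xi> in lborel. rep_L2 (fourier f) \<xi> = g \<xi>" using rep_abs_L2[OF g] by simp
  show ?thesis unfolding inv_fourier_def
  proof (rule theI[where P="\<lambda>f. AE \<xi> in lborel. rep_L2 (fourier f) \<xi> = g \<xi>", OF f])
    fix f' assume "AE \<xi> in lborel. rep_L2 (fourier f') \<xi> = g \<xi>"
    then have "AE \<xi> in lborel. rep_L2 (fourier f') \<xi> = rep_L2 (fourier f) \<xi>"
      using f by eventually_elim simp
    then show "f' = f" by (rule L2_eqI[THEN fourier_inj])
  qed
qed

lemma norm_inv_fourier:
  assumes g: "square_integrable g"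
  shows "2 * pi * (norm (inv_fourier g))^2 = (LBINT \<xi>. (norm (g \<xi>))^2)"
proof -
  have "2 * pi * (norm (inv_fourier g))^2 = (norm (fourier (inv_fourier g)))^2"
    by (simp add: Plancherel power_mult_distrib)
  also have "fourier (inv_fourier g) = abs_L2 g"
    using abs_L2_eqI[OF square_integrable_rep_L2 g rep_inv_fourier[OF g]] by (simp add: abs_rep_L2)
  finally show ?thesis by (simp add: norm_abs_L2_sq g)
qed

section \<open>Estimates for vector-valued Fourier multipliers\<close>

lemma norm_complex2_sq: "(norm (x :: complex^2))^2 = (norm (x $ 1))^2 + (norm (x $ 2))^2"
  by (simp add: norm_vec_def L2_set_def sum_2)

lemma norm_prod_sq: "(norm v)^2 = (norm (fst v))^2 + (norm (snd v))^2"
  by (simp add: norm_prod_def)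

lemma matrix_vector_2:
  "((M :: complex^2^2) *v x) $ i = M $ i $ 1 * x $ 1 + M $ i $ 2 * x $ 2"
  by (simp add: matrix_vector_mult_def sum_2)

lemma norm_inv_fourier2_le:
  fixes g :: "real \<Rightarrow> complex^2" and w :: "real \<Rightarrow> real"
  assumes m: "\<And>i. (\<lambda>\<xi>. g \<xi> $ i) \<in> borel_measurable borel"
    and w: "integrable lborel (\<lambda>\<xi>. (w \<xi>)^2)"
    and le: "AE \<xi> in lborel. norm (g \<xi>) \<le> w \<xi>"
    and C: "(LBINT \<xi>. (w \<xi>)^2) \<le> 2 * pi * C^2" "0 \<le> C"
  shows "norm (inv_fourier2 g) \<le> C"
proof -
  have comp: "square_integrable (\<lambda>\<xi>. g \<xi> $ i)" for i
  proof (rule square_integrable_dominated[OF _ w])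
    show "(\<lambda>\<xi>. g \<xi> $ i) \<in> borel_measurable lborel" using m by simp
    show "AE \<xi> in lborel. norm (g \<xi> $ i) \<le> w \<xi>"
      using le by eventually_elim (rule order_trans[OF Finite_Cartesian_Product.norm_nth_le])
  qed
  have "2 * pi * (norm (inv_fourier2 g))^2
      = (LBINT \<xi>. (norm (g \<xi> $ 1))^2) + (LBINT \<xi>. (norm (g \<xi> $ 2))^2)"
    by (simp add: inv_fourier2_def norm_prod_sq distrib_left norm_inv_fourier comp)
  also have "\<dots> = (LBINT \<xi>. (norm (g \<xi>))^2)"
    using comp by (simp add: norm_complex2_sq square_integrable_def)
  also have "\<dots> \<le> (LBINT \<xi>. (w \<xi>)^2)"
  proof (rule integral_mono_AE[OF _ w])
    show "integrable lborel (\<lambda>\<xi>. (norm (g \<xi>))^2)"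
      using comp by (simp add: norm_complex2_sq square_integrable_def)
    show "AE \<xi> in lborel. (norm (g \<xi>))^2 \<le> (w \<xi>)^2"
      using le by eventually_elim (simp add: power_mono)
  qed
  also note C(1)
  finally have "(norm (inv_fourier2 g))^2 \<le> C^2" by simp
  then show ?thesis using C(2) by (rule power2_le_imp_le)
qed

lemma fourier2_nth: "fourier2 v \<xi> $ 1 = rep_L2 (fourier (fst v)) \<xi>" "fourier2 v \<xi> $ 2 = rep_L2 (fourier (snd v)) \<xi>"
  by (simp_all add: fourier2_def)

lemma fourier2_measurable: "(\<lambda>\<xi>. fourier2 v \<xi> $ i) \<in> borel_measurable borel"
  using exhaust_2[of i] by (auto simp: fourier2_nth rep_L2_measurable)

lemma Plancherel2:
  "integrable lborel (\<lambda>\<xi>. (norm (fourier2 v \<xi>))^2)"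
  "(LBINT \<xi>. (norm (fourier2 v \<xi>))^2) = 2 * pi * (norm v)^2"
proof -
  have i: "integrable lborel (\<lambda>\<xi>. (norm (rep_L2 f \<xi>))^2)" for f
    using square_integrable_rep_L2 by (simp add: square_integrable_def)
  then show "integrable lborel (\<lambda>\<xi>. (norm (fourier2 v \<xi>))^2)"
    by (simp add: norm_complex2_sq fourier2_nth)
  show "(LBINT \<xi>. (norm (fourier2 v \<xi>))^2) = 2 * pi * (norm v)^2"
    by (simp add: norm_complex2_sq fourier2_nth i norm_prod_sq distrib_left Plancherel
        power_mult_distrib flip: norm_L2_sq)
qed

text \<open>For integrable data the transform is a bounded function; this is the source of the decay in time.\<close>

lemma norm_fourier2_le_L1:
  assumes v: "in_L1 v"
  shows "AE \<xi> in lborel. norm (fourier2 v \<xi>) \<le> 2 * L1_norm v"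
proof -
  let ?f = "rep_L2 (fst v)" and ?g = "rep_L2 (snd v)"
  have i: "integrable lborel ?f" "integrable lborel ?g" using v by (auto simp: in_L1_def)
  have ip: "integrable lborel (\<lambda>x. norm (?f x, ?g x))"
  proof (rule Bochner_Integration.integrable_bound)
    show "integrable lborel (\<lambda>x. norm (?f x) + norm (?g x))" using i by simp
    show "AE x in lborel. norm (norm (?f x, ?g x)) \<le> norm (norm (?f x) + norm (?g x))"
      by (intro AE_I2) (simp add: norm_Pair_le)
  qed measurable
  have le: "(LBINT x. norm (?f x)) \<le> L1_norm v" "(LBINT x. norm (?g x)) \<le> L1_norm v"
    unfolding L1_norm_def using i ip
    by (auto intro!: integral_mono norm_fst_le norm_snd_le)
  have "AE \<xi> in lborel. norm (rep_L2 (fourier h) \<xi>) \<le> L1_norm v"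
    if h: "integrable lborel (rep_L2 h)" "(LBINT x. norm (rep_L2 h x)) \<le> L1_norm v" for h
  proof -
    have "AE \<xi> in lborel. rep_L2 (fourier h) \<xi> = fourier_L1 (rep_L2 h) \<xi>"
      unfolding fourier_eq_fourier_L1[OF h(1)]
      by (intro rep_abs_L2 fourier_L1_bounded_L2 h square_integrable_rep_L2)
    then show ?thesis
      by eventually_elim (use norm_fourier_L1_le h(2) in \<open>auto intro: order_trans\<close>)
  qed
  from this[OF i(1) le(1)] this[OF i(2) le(2)]
  show ?thesis
  proof eventually_elim
    case (elim \<xi>)
    have "norm (fourier2 v \<xi>) \<le> norm (fourier2 v \<xi> $ 1) + norm (fourier2 v \<xi> $ 2)"
      by (rule power2_le_imp_le) (auto simp: norm_complex2_sq power2_sum)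
    with elim show ?case by (simp add: fourier2_nth)
  qed
qed

lemma gaussian_integral:
  assumes "e > 0"
  shows "(\<integral>(x::real). exp (- e * x^2 / 2) \<partial>lborel) = sqrt (2 * pi / e)"
proof -
  have "complex_of_real (\<integral>(x::real). exp (- e * x^2 / 2) \<partial>lborel) = fourier_L1 (\<lambda>x. of_real (exp (- e * x^2 / 2))) 0"
    by (simp add: fourier_L1_def)
  also have "\<dots> = of_real (2 * pi * normal_density 0 (sqrt e) 0)"
    by (rule fourier_L1_gaussian[OF assms])
  finally have "(\<integral>(x::real). exp (- e * x^2 / 2) \<partial>lborel) = 2 * pi * normal_density 0 (sqrt e) 0"
    by (simp only: of_real_eq_iff)
  also have "\<dots> = sqrt (2 * pi / e)"
    using assms by (simp add: normal_density_def real_sqrt_divide real_sqrt_mult field_simps)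
  finally show ?thesis .
qed

lemma powr_square: "((x::real) powr a)^2 = x powr (2 * a)"
  unfolding power2_eq_square mult_2 by (rule powr_add[symmetric])

text \<open>The integral of the squared bound is \<open>K\<^sup>2 sqrt (pi / \<kappa>)\<close>; estimating \<open>sqrt pi\<close> by \<open>2 \<pi>\<close> cancels the
  constant in Plancherel's theorem.\<close>

lemma norm_inv_fourier2_gaussian:
  fixes g :: "real \<Rightarrow> complex^2"
  assumes m: "\<And>i. (\<lambda>\<xi>. g \<xi> $ i) \<in> borel_measurable borel"
    and le: "AE \<xi> in lborel. norm (g \<xi>) \<le> K * exp (- \<kappa> * \<xi>^2 / 2)" and \<kappa>: "\<kappa> > 0" and K: "K \<ge> 0"
  shows "norm (inv_fourier2 g) \<le> K * \<kappa> powr (-1/4)"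
proof (rule norm_inv_fourier2_le[OF m _ le])
  have w: "(K * exp (- \<kappa> * \<xi>^2 / 2))^2 = K^2 * exp (- (2 * \<kappa>) * \<xi>^2 / 2)" for \<xi>
    by (simp add: power_mult_distrib flip: exp_of_nat_mult)
  have e: "2 * \<kappa> > 0" using \<kappa> by simp
  show "integrable lborel (\<lambda>\<xi>. (K * exp (- \<kappa> * \<xi>^2 / 2))^2)"
    unfolding w by (intro integrable_mult_right integrable_gaussian e)
  have "(LBINT \<xi>. (K * exp (- \<kappa> * \<xi>^2 / 2))^2) = K^2 * sqrt (2 * pi / (2 * \<kappa>))"
    unfolding w by (subst integral_mult_right_zero, subst gaussian_integral[OF e]) simp
  also have "sqrt (2 * pi / (2 * \<kappa>)) = sqrt pi * \<kappa> powr (-1/2)"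
    using \<kappa> by (simp add: powr_half_sqrt powr_minus real_sqrt_divide field_simps)
  also have "\<dots> \<le> (2 * pi) * \<kappa> powr (-1/2)"
  proof (rule mult_right_mono)
    have "sqrt pi \<le> sqrt (pi * pi)" using pi_gt3 by (intro real_sqrt_le_mono) simp
    then show "sqrt pi \<le> 2 * pi" using pi_gt3 by simp
  qed simp
  also have "\<kappa> powr (-1/2) = (\<kappa> powr (-1/4))^2" by (simp add: powr_square)
  finally show "(LBINT \<xi>. (K * exp (- \<kappa> * \<xi>^2 / 2))^2) \<le> 2 * pi * (K * \<kappa> powr (-1/4))^2"
    by (simp add: power_mult_distrib mult_left_mono mult.assoc mult.left_commute)
qed (use K in simp)

text \<open>The linear flow enters only through the pointwise bound of its symbol by a heat kernel. The decay
  rates are obtained by integrating this bound over all frequencies.\<close>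

locale parabolic_symbol =
  fixes S :: "real \<Rightarrow> real \<Rightarrow> complex^2^2" and C \<beta> :: real
  assumes C: "C > 0" and beta: "\<beta> > 0"
    and measurable_S: "\<And>t i j. (\<lambda>\<xi>. S t \<xi> $ i $ j) \<in> borel_measurable borel"
    and S_bound: "\<And>t \<xi> x. t \<ge> 0 \<Longrightarrow> norm (S t \<xi> *v x) \<le> C * exp (- \<beta> * \<xi>^2 * t) * norm x"
begin

lemma measurable_S_apply:
  assumes "\<And>i. (\<lambda>\<xi>. g \<xi> $ i) \<in> borel_measurable borel"
  shows "(\<lambda>\<xi>. (S t \<xi> *v g \<xi>) $ i) \<in> borel_measurable borel"
  unfolding matrix_vector_2
  by (intro borel_measurable_add borel_measurable_times measurable_S assms)

lemma semigroup_bounded: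
  assumes t: "t \<ge> 0"
  shows "norm (multiplier2 (S t) v) \<le> C * norm v"
  unfolding multiplier2_def
proof (rule norm_inv_fourier2_le[where w="\<lambda>\<xi>. C * norm (fourier2 v \<xi>)"])
  show "(\<lambda>\<xi>. (S t \<xi> *v fourier2 v \<xi>) $ i) \<in> borel_measurable borel" for i
    by (intro measurable_S_apply fourier2_measurable)
  show "integrable lborel (\<lambda>\<xi>. (C * norm (fourier2 v \<xi>))^2)"
    using Plancherel2(1) by (simp add: power_mult_distrib)
  show "(LBINT \<xi>. (C * norm (fourier2 v \<xi>))^2) \<le> 2 * pi * (C * norm v)^2"
    by (simp add: power_mult_distrib Plancherel2(2))
  show "AE \<xi> in lborel. norm (S t \<xi> *v fourier2 v \<xi>) \<le> C * norm (fourier2 v \<xi>)"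
  proof (rule AE_I2)
    fix \<xi>
    have "exp (- \<beta> * \<xi>^2 * t) \<le> 1" using beta t by simp
    then have "C * exp (- \<beta> * \<xi>^2 * t) * norm (fourier2 v \<xi>) \<le> C * 1 * norm (fourier2 v \<xi>)"
      using C by (intro mult_right_mono mult_left_mono) auto
    with S_bound[OF t, of \<xi> "fourier2 v \<xi>"]
    show "norm (S t \<xi> *v fourier2 v \<xi>) \<le> C * norm (fourier2 v \<xi>)" by simp
  qed
qed (use C in simp)

lemma semigroup_decay_L1:
  assumes v: "in_L1 v" and t: "t > 0"
  shows "norm (multiplier2 (S t) v) \<le> 2 * C * (2 * \<beta>) powr (-1/4) * t powr (-1/4) * L1_norm v"
proof -
  have L: "L1_norm v \<ge> 0" by (simp add: L1_norm_def)
  have "norm (multiplier2 (S t) v) \<le> 2 * C * L1_norm v * (2 * \<beta> * t) powr (-1/4)"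
    unfolding multiplier2_def
  proof (rule norm_inv_fourier2_gaussian)
    show "(\<lambda>\<xi>. (S t \<xi> *v fourier2 v \<xi>) $ i) \<in> borel_measurable borel" for i
      by (intro measurable_S_apply fourier2_measurable)
    show "AE \<xi> in lborel. norm (S t \<xi> *v fourier2 v \<xi>) \<le> 2 * C * L1_norm v * exp (- (2 * \<beta> * t) * \<xi>^2 / 2)"
      using norm_fourier2_le_L1[OF v]
    proof eventually_elim
      case (elim \<xi>)
      have "C * exp (- \<beta> * \<xi>^2 * t) * norm (fourier2 v \<xi>) \<le> C * exp (- \<beta> * \<xi>^2 * t) * (2 * L1_norm v)"
        using C elim by (intro mult_left_mono) auto
      with S_bound[of t \<xi> "fourier2 v \<xi>"] t show ?case by (simp add: mult_ac)
    qed
  qed (use C L beta t in simp_all)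
  then show ?thesis using beta t by (simp add: powr_mult mult_ac)
qed

abbreviation semigroup_derivative :: "real \<Rightarrow> (real \<Rightarrow> complex^2) \<Rightarrow> L2 \<times> L2" where
  "semigroup_derivative r G \<equiv> inv_fourier2 (\<lambda>\<xi>. S r \<xi> *v ((\<i> * of_real \<xi>) *s G \<xi>))"

text \<open>The nonlinear term is a derivative of a function whose transform is merely bounded. The factor \<open>\<xi>\<close>
  costs \<open>r powr (-1/2)\<close> and the integration over the frequencies \<open>r powr (-1/4)\<close>; the sum of the exponents
  stays above \<open>-1\<close>, so the singularity at \<open>r = 0\<close> is integrable in Duhamel's formula.\<close>

lemma semigroup_derivative_decay:
  assumes G: "\<And>i. (\<lambda>\<xi>. G \<xi> $ i) \<in> borel_measurable borel" "\<And>\<xi>. norm (G \<xi>) \<le> B" and r: "r > 0"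
  shows "norm (semigroup_derivative r G)
    \<le> C * \<beta> powr (-3/4) * r powr (-3/4) * B"
proof -
  have B: "B \<ge> 0" using order_trans[OF norm_ge_zero G(2)] .
  define K where "K = C * B * (\<beta> * r) powr (-1/2)"
  have K: "K \<ge> 0" using C B by (simp add: K_def)
  have br: "\<beta> * r > 0" using beta r by simp
  have "norm (semigroup_derivative r G) \<le> K * (\<beta> * r) powr (-1/4)"
  proof (rule norm_inv_fourier2_gaussian[OF _ _ br K])
    show "(\<lambda>\<xi>. (S r \<xi> *v ((\<i> * of_real \<xi>) *s G \<xi>)) $ i) \<in> borel_measurable borel" for i
      by (rule measurable_S_apply)
        (use G(1) in \<open>simp add: vector_scalar_mult_def borel_measurable_times\<close>)
    show "AE \<xi> in lborel. norm (S r \<xi> *v ((\<i> * of_real \<xi>) *s G \<xi>)) \<le> K * exp (- (\<beta> * r) * \<xi>^2 / 2)"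
    proof (rule AE_I2)
      fix \<xi>
      \<comment> \<open>the factor from the derivative is absorbed by half of the exponent\<close>
      define y where "y = \<beta> * r * \<xi>^2"
      have y: "y \<ge> 0" using br by (simp add: y_def)
      have "sqrt y \<le> sqrt (exp y)" using exp_ge_add_one_self[of y] by (intro real_sqrt_le_mono) linarith
      also have "sqrt (exp y) = exp (y / 2)"
        by (rule real_sqrt_unique) (simp_all flip: exp_of_nat_mult)
      finally have "sqrt y * exp (- y) \<le> exp (y / 2) * exp (- y)" by (intro mult_right_mono) auto
      then have 1: "sqrt y * exp (- y) \<le> exp (- y / 2)" by (simp flip: exp_add)
      have 2: "\<bar>\<xi>\<bar> = (\<beta> * r) powr (-1/2) * sqrt y"
        using br beta r by (simp add: y_def real_sqrt_mult powr_minus powr_half_sqrt field_simps)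
      have nG: "norm ((\<i> * of_real \<xi>) *s G \<xi>) = \<bar>\<xi>\<bar> * norm (G \<xi>)"
      proof -
        have "(norm ((\<i> * of_real \<xi>) *s G \<xi>))^2 = (\<bar>\<xi>\<bar> * norm (G \<xi>))^2"
          by (simp add: norm_complex2_sq power_mult_distrib norm_mult distrib_left)
        then show ?thesis by (rule power2_eq_imp_eq) simp_all
      qed
      have "norm (S r \<xi> *v ((\<i> * of_real \<xi>) *s G \<xi>)) \<le> C * exp (- y) * (\<bar>\<xi>\<bar> * norm (G \<xi>))"
        using S_bound[of r \<xi> "(\<i> * of_real \<xi>) *s G \<xi>"] r unfolding nG by (simp add: y_def mult_ac)
      also have "\<dots> \<le> C * exp (- y) * (\<bar>\<xi>\<bar> * B)"
        using C G(2) by (intro mult_left_mono) auto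
      also have "\<dots> = K * (sqrt y * exp (- y))" unfolding 2 K_def by (simp add: mult_ac)
      also have "\<dots> \<le> K * exp (- y / 2)" using 1 K by (rule mult_left_mono)
      finally show "norm (S r \<xi> *v ((\<i> * of_real \<xi>) *s G \<xi>)) \<le> K * exp (- (\<beta> * r) * \<xi>^2 / 2)"
        by (simp add: y_def mult_ac)
    qed
  qed
  also have "K * (\<beta> * r) powr (-1/4) = C * B * (\<beta> * r) powr (-3/4)"
    by (simp add: K_def mult.assoc flip: powr_add)
  finally show ?thesis using beta r by (simp add: powr_mult mult_ac)
qed

end

section \<open>Decay of small mild solutions\<close>

text \<open>Either \<open>1 + s\<close> or \<open>t - s\<close> is at least half of their sum \<open>1 + t\<close>. The pointwise splitting replaces the
  evaluation of a Beta integral by two elementary integrals.\<close>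

lemma duhamel_kernel_split:
  fixes s t :: real
  assumes "0 \<le> s" "s < t"
  shows "(t - s) powr (-3/4) * (1 + s) powr (-1/2)
    \<le> ((1 + t) / 2) powr (-1/2) * (t - s) powr (-3/4) + ((1 + t) / 2) powr (-3/4) * (1 + s) powr (-1/2)"
proof (cases "1 + s \<ge> (1 + t) / 2")
  case True
  then have "(1 + s) powr (-1/2) \<le> ((1 + t) / 2) powr (-1/2)"
    using assms by (intro powr_mono2') auto
  then have "(t - s) powr (-3/4) * (1 + s) powr (-1/2) \<le> (t - s) powr (-3/4) * ((1 + t) / 2) powr (-1/2)"
    by (intro mult_left_mono) auto
  then show ?thesis by (simp add: mult.commute add_increasing2)
next
  case False
  then have "(t - s) powr (-3/4) \<le> ((1 + t) / 2) powr (-3/4)"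
    using assms by (intro powr_mono2') auto
  then have "(t - s) powr (-3/4) * (1 + s) powr (-1/2) \<le> ((1 + t) / 2) powr (-3/4) * (1 + s) powr (-1/2)"
    by (intro mult_right_mono) auto
  then show ?thesis by (simp add: add_increasing)
qed

lemma has_integral_Abel_kernel:
  fixes t :: real
  assumes "t \<ge> 0"
  shows "((\<lambda>s. (t - s) powr (-3/4)) has_integral 4 * t powr (1/4)) {0..t}"
proof -
  have "((\<lambda>s. (t - s) powr (-3/4)) has_integral (- 4 * (t - t) powr (1/4) - (- 4 * (t - 0) powr (1/4)))) {0..t}"
  proof (rule fundamental_theorem_of_calculus_interior)
    show "continuous_on {0..t} (\<lambda>s. - 4 * (t - s) powr (1/4))"
      by (intro continuous_intros continuous_on_powr') auto
    fix s assume s: "s \<in> {0<..<t}"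
    then have "((\<lambda>s. - 4 * (t - s) powr (1/4)) has_real_derivative (t - s) powr (-3/4)) (at s)"
      by (auto intro!: derivative_eq_intros)
    then show "((\<lambda>s. - 4 * (t - s) powr (1/4)) has_vector_derivative (t - s) powr (-3/4)) (at s)"
      by (simp add: has_real_derivative_iff_has_vector_derivative)
  qed (use assms in simp)
  then show ?thesis by simp
qed

lemma has_integral_shifted_root:
  fixes t :: real
  assumes "t \<ge> 0"
  shows "((\<lambda>s. (1 + s) powr (-1/2)) has_integral 2 * (1 + t) powr (1/2) - 2) {0..t}"
proof -
  have "((\<lambda>s. (1 + s) powr (-1/2)) has_integral (2 * (1 + t) powr (1/2) - 2 * (1 + 0) powr (1/2))) {0..t}"
  proof (rule fundamental_theorem_of_calculus)
    fix s assume s: "s \<in> {0..t}"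
    then have "((\<lambda>s. 2 * (1 + s) powr (1/2)) has_real_derivative (1 + s) powr (-1/2)) (at s within {0..t})"
      by (auto intro!: derivative_eq_intros)
    then show "((\<lambda>s. 2 * (1 + s) powr (1/2)) has_vector_derivative (1 + s) powr (-1/2)) (at s within {0..t})"
      by (simp add: has_real_derivative_iff_has_vector_derivative)
  qed (use assms in simp)
  then show ?thesis by simp
qed

text \<open>Pairing the integral with its own value reduces the estimate to real integrands, whose gauge
  integrals can be compared directly. At the endpoint \<open>s = t\<close> the integrand may be arbitrary, but a
  single point is negligible. The resulting rate is that of the linear flow, because
  \<open>-3/4 - 1/2 + 1 = -1/4\<close>.\<close>

lemma duhamel_bound:
  fixes f :: "real \<Rightarrow> 'a::real_inner"
  assumes f: "(f has_integral I) {0..t}" and t: "t \<ge> 0" and B: "B \<ge> 0"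
    and le: "\<And>s. 0 \<le> s \<Longrightarrow> s < t \<Longrightarrow> norm (f s) \<le> B * ((t - s) powr (-3/4) * (1 + s) powr (-1/2))"
  shows "norm I \<le> 12 * B * (1 + t) powr (-1/4)"
proof (cases "I = 0")
  case True
  then show ?thesis using B by simp
next
  case False
  let ?P = "((1 + t) / 2) powr (-1/2)" and ?Q = "((1 + t) / 2) powr (-3/4)"
  define h where "h s = (if s = t then 0 else f s \<bullet> I)" for s
  define g where "g s = norm I * B * (?P * (t - s) powr (-3/4) + ?Q * (1 + s) powr (-1/2))" for s
  have "((\<lambda>x. x \<bullet> I) \<circ> f has_integral I \<bullet> I) {0..t}"
    by (rule has_integral_linear[OF f bounded_linear_inner_left])
  then have "(h has_integral I \<bullet> I) {0..t}"
    by (rule has_integral_spike_finite[of "{t}", rotated 2]) (auto simp: h_def)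
  moreover have "(g has_integral norm I * B * (?P * (4 * t powr (1/4)) + ?Q * (2 * (1 + t) powr (1/2) - 2))) {0..t}"
    unfolding g_def
    by (intro has_integral_mult_right has_integral_add has_integral_Abel_kernel has_integral_shifted_root t)
  moreover have "h s \<le> g s" if s: "s \<in> {0..t}" for s
  proof (cases "s = t")
    case True
    then show ?thesis using B by (simp add: h_def g_def)
  next
    case False
    then have st: "0 \<le> s" "s < t" using s by auto
    have "h s \<le> norm (f s) * norm I"
      using False norm_cauchy_schwarz[of "f s" I] by (simp add: h_def)
    also have "\<dots> \<le> (B * ((t - s) powr (-3/4) * (1 + s) powr (-1/2))) * norm I"
      by (intro mult_right_mono le st) simp
    also have "\<dots> \<le> (B * (?P * (t - s) powr (-3/4) + ?Q * (1 + s) powr (-1/2))) * norm I"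
      using B by (intro mult_right_mono mult_left_mono duhamel_kernel_split st) auto
    finally show ?thesis by (simp add: g_def mult_ac)
  qed
  ultimately have "I \<bullet> I \<le> norm I * B * (?P * (4 * t powr (1/4)) + ?Q * (2 * (1 + t) powr (1/2) - 2))"
    by (rule has_integral_le)
  also have "\<dots> \<le> norm I * B * (12 * (1 + t) powr (-1/4))"
  proof (rule mult_left_mono)
    have two: "2 powr (1/2) \<le> (2::real)" "2 powr (3/4) \<le> (2::real)"
      using powr_mono[of "1/2" 1 "2::real"] powr_mono[of "3/4" 1 "2::real"] by simp_all
    have P: "?P = 2 powr (1/2) * (1 + t) powr (-1/2)" and Q: "?Q = 2 powr (3/4) * (1 + t) powr (-3/4)"
      using t by (simp_all add: powr_divide powr_minus divide_simps)
    have "?P * (4 * t powr (1/4)) \<le> (2 * (1 + t) powr (-1/2)) * (4 * (1 + t) powr (1/4))"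
    proof (rule mult_mono)
      show "?P \<le> 2 * (1 + t) powr (-1/2)" unfolding P using two by (intro mult_right_mono) auto
      show "4 * t powr (1/4) \<le> 4 * (1 + t) powr (1/4)" using t by (intro mult_left_mono powr_mono2) auto
    qed simp_all
    also have "\<dots> = 8 * (1 + t) powr (-1/4)" by (simp flip: powr_add)
    finally have 1: "?P * (4 * t powr (1/4)) \<le> 8 * (1 + t) powr (-1/4)" .
    have "?Q * (2 * (1 + t) powr (1/2) - 2) \<le> (2 * (1 + t) powr (-3/4)) * (2 * (1 + t) powr (1/2))"
    proof (rule mult_mono)
      show "?Q \<le> 2 * (1 + t) powr (-3/4)" unfolding Q using two by (intro mult_right_mono) auto
      show "0 \<le> 2 * (1 + t) powr (1/2) - 2" using ge_one_powr_ge_zero[of "1 + t" "1/2"] t by simp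
    qed simp_all
    also have "\<dots> = 4 * (1 + t) powr (-1/4)" by (simp flip: powr_add)
    finally show "?P * (4 * t powr (1/4)) + ?Q * (2 * (1 + t) powr (1/2) - 2) \<le> 12 * (1 + t) powr (-1/4)"
      using 1 by linarith
  qed (use B in simp)
  finally have "norm I * norm I \<le> norm I * (12 * B * (1 + t) powr (-1/4))"
    by (simp add: mult_ac flip: power2_norm_eq_inner power2_eq_square)
  then show ?thesis using False by (simp add: mult_le_cancel_left)
qed

text \<open>If the conclusion failed, the assumption on single steps would be violated at the first time at which
  \<open>\<phi>\<close> reaches the level \<open>M\<close>.\<close>

lemma continuity_argument:
  fixes \<phi> :: "real \<Rightarrow> real"
  assumes cont: "continuous_on {0..} \<phi>"
    and step: "\<And>t. t \<ge> 0 \<Longrightarrow> (\<And>s. 0 \<le> s \<Longrightarrow> s < t \<Longrightarrow> \<phi> s \<le> M) \<Longrightarrow> \<phi> t < M"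
    and t: "t \<ge> 0"
  shows "\<phi> t < M"
proof (rule ccontr)
  assume "\<not> \<phi> t < M"
  define E where "E = {s \<in> {0..t}. M \<le> \<phi> s}"
  have "closed E" unfolding E_def
    using cont by (intro continuous_on_closed_Collect_le continuous_intros) (auto elim: continuous_on_subset)
  moreover have "t \<in> E" using t \<open>\<not> \<phi> t < M\<close> by (simp add: E_def)
  moreover have "bdd_below E" by (auto simp: E_def)
  ultimately have "Inf E \<in> E" by (intro closed_contains_Inf) auto
  then have i: "0 \<le> Inf E" "M \<le> \<phi> (Inf E)" "Inf E \<le> t" by (auto simp: E_def)
  have "\<phi> s \<le> M" if "0 \<le> s" "s < Inf E" for s
  proof (rule ccontr)
    assume "\<not> \<phi> s \<le> M"
    then have "s \<in> E" using that i by (simp add: E_def)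
    then have "Inf E \<le> s" using \<open>bdd_below E\<close> by (rule cInf_lower)
    then show False using that by simp
  qed
  from step[OF i(1) this] i(2) show False by simp
qed

context parabolic_symbol
begin

lemma semigroup_decay:
  assumes v: "in_L1 v" and t: "t \<ge> 0"
  shows "norm (multiplier2 (S t) v)
    \<le> (2 * C + 4 * C * (2 * \<beta>) powr (-1/4)) * (L1_norm v + norm v) * (1 + t) powr (-1/4)"
proof -
  have L: "L1_norm v \<ge> 0" by (simp add: L1_norm_def)
  let ?c = "(2 * \<beta>) powr (-1/4)"
  have q: "2 powr (1/4) \<le> (2::real)" using powr_mono[of "1/4" 1 "2::real"] by simp
  show ?thesis
  proof (cases "t \<le> 1")
    case True
    have "1 = (1 + t) powr (1/4) * (1 + t) powr (-1/4)" using t by (simp flip: powr_add)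
    also have "\<dots> \<le> 2 powr (1/4) * (1 + t) powr (-1/4)"
      using True t by (intro mult_right_mono powr_mono2) auto
    also have "\<dots> \<le> 2 * (1 + t) powr (-1/4)" using q by (intro mult_right_mono) auto
    finally have one: "1 \<le> 2 * (1 + t) powr (-1/4)" .
    have "norm (multiplier2 (S t) v) \<le> C * norm v * 1" using semigroup_bounded[OF t] by simp
    also have "\<dots> \<le> C * norm v * (2 * (1 + t) powr (-1/4))" using C one by (intro mult_left_mono) auto
    also have "\<dots> = 2 * C * norm v * (1 + t) powr (-1/4)" by simp
    also have "\<dots> \<le> (2 * C + 4 * C * ?c) * (L1_norm v + norm v) * (1 + t) powr (-1/4)"
      using C L by (intro mult_right_mono mult_mono) auto
    finally show ?thesis .
  next
    case False
    have "t powr (-1/4) \<le> ((1 + t) / 2) powr (-1/4)" using False by (intro powr_mono2') auto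
    also have "\<dots> = 2 powr (1/4) * (1 + t) powr (-1/4)"
      using t by (simp add: powr_divide powr_minus divide_simps)
    also have "\<dots> \<le> 2 * (1 + t) powr (-1/4)" using q by (intro mult_right_mono) auto
    finally have tt: "t powr (-1/4) \<le> 2 * (1 + t) powr (-1/4)" .
    have "norm (multiplier2 (S t) v) \<le> 2 * C * ?c * t powr (-1/4) * L1_norm v"
      using False by (intro semigroup_decay_L1 v) simp
    also have "\<dots> \<le> 2 * C * ?c * (2 * (1 + t) powr (-1/4)) * L1_norm v"
      using C L tt by (intro mult_right_mono mult_left_mono) auto
    also have "\<dots> = 4 * C * ?c * L1_norm v * (1 + t) powr (-1/4)" by simp
    also have "\<dots> \<le> (2 * C + 4 * C * ?c) * (L1_norm v + norm v) * (1 + t) powr (-1/4)"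
      using C L by (intro mult_right_mono mult_mono) auto
    finally show ?thesis .
  qed
qed

text \<open>With \<open>\<phi> t = norm (v t) * (1 + t) powr (1/4)\<close>, Duhamel's formula yields an inequality of the form
  \<open>\<phi> t \<le> A \<epsilon> + 12 D M\<^sup>2\<close> as long as \<open>\<phi> \<le> M\<close> before time \<open>t\<close>. The nonlinearity is quadratic, so for a
  suitable \<open>M\<close> and small data the right-hand side is strictly less than \<open>M\<close>, and the bound never breaks.\<close>

theorem small_solution_decay:
  fixes F :: "L2 \<times> L2 \<Rightarrow> real \<Rightarrow> complex^2"
  assumes F: "\<And>v i. (\<lambda>\<xi>. F v \<xi> $ i) \<in> borel_measurable borel" "\<And>v \<xi>. norm (F v \<xi>) \<le> K * (norm v)^2"
  shows "\<exists>\<epsilon>>0. \<exists>M. \<forall>v0 v. continuous_on {0..} v \<and>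
     (\<forall>t\<ge>0. \<exists>I. ((\<lambda>s. semigroup_derivative (t - s) (F (v s))) has_integral I) {0..t} \<and>
              v t = multiplier2 (S t) v0 - I) \<and> in_L1 v0 \<and> L1_norm v0 + norm v0 \<le> \<epsilon> \<longrightarrow>
     (\<forall>t\<ge>0. norm (v t) \<le> M * (1 + t) powr (-1/4))"
proof -
  define A where "A = 2 * C + 4 * C * (2 * \<beta>) powr (-1/4)"
  define D where "D = C * \<beta> powr (-3/4) * max K 1"
  have A: "A > 0" using C by (simp add: A_def add_pos_nonneg)
  have D: "D > 0" using C beta by (simp add: D_def)
  \<comment> \<open>the bound that reproduces itself: the linear part takes half of it, the quadratic part a quarter\<close>
  define M where "M = 1 / (48 * D)"
  have M: "M > 0" using D by (simp add: M_def)
  define \<epsilon> where "\<epsilon> = M / (2 * A)"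
  have \<epsilon>: "\<epsilon> > 0" using M A by (simp add: \<epsilon>_def)
  have "norm (v t) \<le> M * (1 + t) powr (-1/4)"
    if cont: "continuous_on {0..} v"
      and sol: "\<And>t. t \<ge> 0 \<Longrightarrow> \<exists>I. ((\<lambda>s. semigroup_derivative (t - s) (F (v s))) has_integral I) {0..t} \<and>
              v t = multiplier2 (S t) v0 - I"
      and v0: "in_L1 v0" "L1_norm v0 + norm v0 \<le> \<epsilon>" and t: "t \<ge> 0"
    for v0 v t
  proof -
    define \<phi> where "\<phi> t = norm (v t) * (1 + t) powr (1/4)" for t
    have eq: "norm (v t) = \<phi> t * (1 + t) powr (-1/4)" if "t \<ge> 0" for t
      using that by (simp add: \<phi>_def mult.assoc flip: powr_add)
    have "\<phi> t < M"
    proof (rule continuity_argument[of \<phi>])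
      show "continuous_on {0..} \<phi>"
        unfolding \<phi>_def using cont by (intro continuous_intros continuous_on_powr) auto
      fix T :: real assume T: "T \<ge> 0" and bound: "\<And>s. 0 \<le> s \<Longrightarrow> s < T \<Longrightarrow> \<phi> s \<le> M"
      obtain I where I: "((\<lambda>s. semigroup_derivative (T - s) (F (v s))) has_integral I) {0..T}"
        and vT: "v T = multiplier2 (S T) v0 - I" using sol[OF T] by blast
      have "norm I \<le> 12 * (D * M^2) * (1 + T) powr (-1/4)"
      proof (rule duhamel_bound[OF I T])
        fix s assume s: "0 \<le> s" "s < T"
        have n: "(norm (v s))^2 \<le> M^2 * (1 + s) powr (-1/2)"
        proof -
          have "norm (v s) \<le> M * (1 + s) powr (-1/4)"
            unfolding eq[OF s(1)] using bound[OF s] by (intro mult_right_mono) auto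
          then have "(norm (v s))^2 \<le> (M * (1 + s) powr (-1/4))^2" by (intro power_mono) auto
          then show ?thesis by (simp add: power_mult_distrib powr_square)
        qed
        have Fb: "norm (F (v s) \<xi>) \<le> max K 1 * (norm (v s))^2" for \<xi>
          by (rule order_trans[OF F(2)]) (intro mult_right_mono, auto)
        have "norm (semigroup_derivative (T - s) (F (v s)))
            \<le> C * \<beta> powr (-3/4) * (T - s) powr (-3/4) * (max K 1 * (norm (v s))^2)"
          using s by (intro semigroup_derivative_decay F(1) Fb) simp
        also have "\<dots> \<le> C * \<beta> powr (-3/4) * (T - s) powr (-3/4) * (max K 1 * (M^2 * (1 + s) powr (-1/2)))"
          using C n by (intro mult_left_mono) auto
        also have "\<dots> = D * M^2 * ((T - s) powr (-3/4) * (1 + s) powr (-1/2))"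
          by (simp add: D_def mult_ac)
        finally show "norm (semigroup_derivative (T - s) (F (v s)))
            \<le> D * M^2 * ((T - s) powr (-3/4) * (1 + s) powr (-1/2))" .
      qed (use D in simp)
      moreover have "norm (multiplier2 (S T) v0) \<le> A * \<epsilon> * (1 + T) powr (-1/4)"
      proof -
        have "A * (L1_norm v0 + norm v0) * (1 + T) powr (-1/4) \<le> A * \<epsilon> * (1 + T) powr (-1/4)"
          using A v0(2) by (intro mult_right_mono mult_left_mono) auto
        with semigroup_decay[OF v0(1) T] show ?thesis by (simp add: A_def)
      qed
      ultimately have "norm (v T) \<le> (A * \<epsilon> + 12 * (D * M^2)) * (1 + T) powr (-1/4)"
        unfolding vT using norm_triangle_ineq4[of "multiplier2 (S T) v0" I] by (simp add: distrib_right)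
      also have "A * \<epsilon> + 12 * (D * M^2) = 3/4 * M"
        using A D by (simp add: \<epsilon>_def M_def power2_eq_square field_simps)
      finally have "\<phi> T \<le> 3/4 * M * (1 + T) powr (-1/4) * (1 + T) powr (1/4)"
        unfolding \<phi>_def by (intro mult_right_mono) auto
      also have "\<dots> = 3/4 * M" using T by (simp add: mult.assoc flip: powr_add)
      also have "\<dots> < M" using M by simp
      finally show "\<phi> T < M" .
    qed (rule t)
    then show ?thesis unfolding eq[OF t] by (intro mult_right_mono) auto
  qed
  with \<epsilon> show ?thesis by blast
qed

end

section \<open>The exponential of a two by two matrix\<close>

definition mat_pow :: "complex^2^2 \<Rightarrow> nat \<Rightarrow> complex^2^2" where
  "mat_pow B n = ((**) B ^^ n) (mat 1)"

lemma mat_pow_Suc: "mat_pow B (Suc n) $ i $ j = B $ i $ 1 * mat_pow B n $ 1 $ j + B $ i $ 2 * mat_pow B n $ 2 $ j"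
  by (simp add: mat_pow_def matrix_matrix_mult_def sum_2)

lemma mat_pow_0: "mat_pow B 0 $ i $ j = (if i = j then 1 else 0)"
  by (simp add: mat_pow_def mat_def)

lemma mat_pow_scaleR: "mat_pow (t *\<^sub>R B) n = t ^ n *\<^sub>R mat_pow B n"
proof (induction n)
  case 0
  then show ?case by (simp add: mat_pow_def)
next
  case (Suc n)
  show ?case unfolding vec_eq_iff by (simp add: mat_pow_Suc Suc algebra_simps)
qed

lemma norm_mat_pow_le:
  assumes "\<And>i j. norm (B $ i $ j) \<le> b"
  shows "norm (mat_pow B n $ i $ j) \<le> (2 * b) ^ n"
proof (induction n arbitrary: i j)
  case 0
  then show ?case by (simp add: mat_pow_0)
next
  case (Suc n)
  have b: "0 \<le> b" using order_trans[OF norm_ge_zero assms] .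
  have le: "norm (B $ i $ k * mat_pow B n $ k $ j) \<le> b * (2 * b) ^ n" for k
    using assms Suc b by (simp add: norm_mult mult_mono)
  show ?case unfolding mat_pow_Suc
    using norm_triangle_ineq[of "B $ i $ 1 * mat_pow B n $ 1 $ j" "B $ i $ 2 * mat_pow B n $ 2 $ j"] le[of 1] le[of 2]
    by simp
qed

lemma summable_mat_pow_entry: "summable (\<lambda>n. norm (mat_pow B n $ i $ j /\<^sub>R fact n * y ^ n))"
proof -
  define b where "b = (\<Sum>i\<in>UNIV. \<Sum>j\<in>UNIV. norm (B $ i $ j))"
  have b: "norm (B $ i $ j) \<le> b" for i j
  proof -
    have "norm (B $ i $ j) \<le> (\<Sum>j\<in>UNIV. norm (B $ i $ j))" by (rule member_le_sum) auto
    also have "\<dots> \<le> b" unfolding b_def by (rule member_le_sum) (auto intro: sum_nonneg)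
    finally show ?thesis .
  qed
  have "summable (\<lambda>n. (2 * b * norm y) ^ n /\<^sub>R fact n)" by (rule summable_exp_generic)
  then show ?thesis
  proof (rule summable_comparison_test'[where N=0])
    fix n :: nat
    have "norm (mat_pow B n $ i $ j /\<^sub>R fact n * y ^ n) = (norm (mat_pow B n $ i $ j) * norm y ^ n) /\<^sub>R fact n"
      by (simp add: norm_mult norm_power)
    also have "\<dots> \<le> ((2 * b) ^ n * norm y ^ n) /\<^sub>R fact n"
      using norm_mat_pow_le[OF b, of n i j] by (intro scaleR_left_mono mult_right_mono) auto
    finally show "norm (norm (mat_pow B n $ i $ j /\<^sub>R fact n * y ^ n)) \<le> (2 * b * norm y) ^ n /\<^sub>R fact n"
      by (simp add: power_mult_distrib)
  qed
qed

text \<open>Entrywise the exponential is a scalar power series, to which termwise differentiation applies.\<close>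

lemma matrix_exp_nth: "matrix_exp B $ i $ j = (\<Sum>n. mat_pow B n $ i $ j /\<^sub>R fact n)"
proof -
  have "summable (\<lambda>n. mat_pow B n /\<^sub>R fact n)"
  proof (rule summable_comparison_test'[where N=0])
    show "summable (\<lambda>n. \<Sum>i\<in>UNIV. \<Sum>j\<in>UNIV. norm (mat_pow B n $ i $ j /\<^sub>R fact n))"
      using summable_mat_pow_entry[of B _ _ 1] by (intro summable_sum) simp
    show "norm (mat_pow B n /\<^sub>R fact n) \<le> (\<Sum>i\<in>UNIV. \<Sum>j\<in>UNIV. norm (mat_pow B n $ i $ j /\<^sub>R fact n))" for n
    proof -
      have l1: "norm x \<le> (\<Sum>i\<in>UNIV. norm (x $ i))" for x :: "'z::real_normed_vector ^ 2"
        unfolding norm_vec_def by (rule L2_set_le_sum) simp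
      have "norm (mat_pow B n /\<^sub>R fact n) \<le> (\<Sum>i\<in>UNIV. norm ((mat_pow B n /\<^sub>R fact n) $ i))" by (rule l1)
      also have "\<dots> \<le> (\<Sum>i\<in>UNIV. \<Sum>j\<in>UNIV. norm ((mat_pow B n /\<^sub>R fact n) $ i $ j))" by (intro sum_mono l1)
      finally show ?thesis by simp
    qed
  qed
  from bounded_linear.suminf[OF bounded_linear_compose[OF bounded_linear_vec_nth[of j] bounded_linear_vec_nth[of i]] this]
  show ?thesis unfolding matrix_exp_def mat_pow_def[symmetric] by simp
qed

lemma matrix_exp_measurable:
  assumes B: "\<And>i j. (\<lambda>\<xi>. B \<xi> $ i $ j) \<in> borel_measurable M"
  shows "(\<lambda>\<xi>. matrix_exp (B \<xi>) $ i $ j) \<in> borel_measurable M"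
proof -
  have "(\<lambda>\<xi>. mat_pow (B \<xi>) n $ i $ j) \<in> borel_measurable M" for n i j
  proof (induction n arbitrary: i j)
    case 0
    then show ?case by (simp add: mat_pow_0)
  next
    case (Suc n)
    then show ?case unfolding mat_pow_Suc using B by (intro borel_measurable_add borel_measurable_times)
  qed
  then show ?thesis unfolding matrix_exp_nth
    by (intro borel_measurable_suminf borel_measurable_scaleR) auto
qed

lemma matrix_exp_has_derivative:
  "((\<lambda>t. matrix_exp (t *\<^sub>R B) $ i $ j) has_vector_derivative
     B $ i $ 1 * matrix_exp (t *\<^sub>R B) $ 1 $ j + B $ i $ 2 * matrix_exp (t *\<^sub>R B) $ 2 $ j) (at t)"
proof -
  define c where "c i j n = mat_pow B n $ i $ j /\<^sub>R fact n" for i j n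
  have e: "matrix_exp (t *\<^sub>R B) $ i $ j = (\<Sum>n. c i j n * of_real t ^ n)" for t i j
    unfolding matrix_exp_nth mat_pow_scaleR c_def vector_scaleR_component
    by (simp add: scaleR_conv_of_real mult_ac)
  have sm: "summable (\<lambda>n. c i j n * y ^ n)" for i j y
    unfolding c_def by (rule summable_norm_cancel[OF summable_mat_pow_entry])
  have d: "diffs (c i j) n = B $ i $ 1 * c 1 j n + B $ i $ 2 * c 2 j n" for n
  proof -
    have "diffs (c i j) n = mat_pow B (Suc n) $ i $ j /\<^sub>R fact n"
      by (simp add: diffs_def c_def scaleR_conv_of_real field_simps del: of_nat_Suc)
    then show ?thesis unfolding mat_pow_Suc by (simp add: c_def scaleR_add_right)
  qed
  have "(\<Sum>n. diffs (c i j) n * of_real t ^ n)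
      = (\<Sum>n. B $ i $ 1 * (c 1 j n * of_real t ^ n) + B $ i $ 2 * (c 2 j n * of_real t ^ n))"
    by (simp add: d algebra_simps)
  also have "\<dots> = B $ i $ 1 * (\<Sum>n. c 1 j n * of_real t ^ n) + B $ i $ 2 * (\<Sum>n. c 2 j n * of_real t ^ n)"
    by (simp add: suminf_add[symmetric] suminf_mult summable_mult sm)
  finally show ?thesis
    using has_vector_derivative_real_field[OF termdiffs_strong_converges_everywhere[OF sm[of i j]], of t UNIV]
    by (simp add: e)
qed

lemma matrix_exp_flow:
  assumes "y = (\<lambda>t. matrix_exp (t *\<^sub>R B) *v x)"
  shows "y 0 = x" "((\<lambda>t. y t $ i) has_vector_derivative (B *v y t) $ i) (at t)"
proof -
  have "matrix_exp (0 *\<^sub>R B) $ i $ j = (if i = j then 1 else 0)" for i j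
  proof -
    have "matrix_exp (0 *\<^sub>R B) $ i $ j = (\<Sum>n. if n = 0 then mat_pow B 0 $ i $ j else 0)"
      unfolding matrix_exp_nth mat_pow_scaleR by (intro arg_cong[where f=suminf]) (auto simp: fun_eq_iff power_0_left)
    also have "\<dots> = mat_pow B 0 $ i $ j"
      using sums_single[of 0 "\<lambda>_. mat_pow B 0 $ i $ j"] by (simp add: sums_iff)
    finally show ?thesis by (simp add: mat_pow_0)
  qed
  then have "y 0 $ i = x $ i" for i
    unfolding assms matrix_vector_2 using exhaust_2[of i] by auto
  then show "y 0 = x" by (simp add: vec_eq_iff)
  show "((\<lambda>t. y t $ i) has_vector_derivative (B *v y t) $ i) (at t)"
    unfolding assms matrix_vector_2
    by (auto intro!: derivative_eq_intros matrix_exp_has_derivative simp: algebra_simps)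
qed

section \<open>Decay of the linear flow\<close>

text \<open>The quadratic form in the dissipation inequality for the energy
  \<open>|y\<^sub>1|\<^sup>2 + |y\<^sub>2|\<^sup>2 + 2 k Im (y\<^sub>1 cnj y\<^sub>2)\<close> of the linear system with damping coefficients \<open>p\<close>, \<open>r\<close> and coupling
  \<open>i q\<close>; here \<open>X\<close> and \<open>Y\<close> stand for \<open>|y\<^sub>1|\<close> and \<open>|y\<^sub>2|\<close>. The condition on \<open>k\<close> makes the energy comparable with the
  square of the norm.\<close>

definition dissipates :: "real \<Rightarrow> real \<Rightarrow> real \<Rightarrow> real \<Rightarrow> real \<Rightarrow> bool" where
  "dissipates \<mu> p q r k \<longleftrightarrow> \<bar>k\<bar> \<le> 1/2 \<and> (\<forall>X\<ge>0. \<forall>Y\<ge>0.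
     \<mu> * (X^2 + Y^2) \<le> (p - k * q) * X^2 + (r + k * q) * Y^2 - \<bar>k\<bar> * (p + r) * (X * Y))"

lemma dissipates_swap:
  assumes "dissipates \<mu> p q r k"
  shows "dissipates \<mu> r q p (- k)"
  unfolding dissipates_def
proof (intro conjI allI impI)
  fix X Y :: real assume XY: "X \<ge> 0" "Y \<ge> 0"
  then have "\<mu> * (Y^2 + X^2) \<le> (p - k * q) * Y^2 + (r + k * q) * X^2 - \<bar>k\<bar> * (p + r) * (Y * X)"
    using assms by (simp add: dissipates_def)
  then show "\<mu> * (X^2 + Y^2) \<le> (r - - k * q) * X^2 + (p + - k * q) * Y^2 - \<bar>- k\<bar> * (r + p) * (X * Y)"
    by (simp add: ac_simps)
qed (use assms in \<open>simp add: dissipates_def\<close>)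

text \<open>The sign of the mixed term has to follow the sign of the coupling.\<close>

lemma dissipates_abs:
  assumes "dissipates \<mu> p \<bar>q\<bar> r k"
  obtains k' where "dissipates \<mu> p q r k'"
proof
  show "dissipates \<mu> p q r (if q \<ge> 0 then k else - k)"
    using assms by (auto simp: dissipates_def)
qed

lemma dissipates_mono:
  assumes "dissipates \<mu> p q r k" "\<mu>' \<le> \<mu>"
  shows "dissipates \<mu>' p q r k"
proof -
  have "\<mu>' * (X^2 + Y^2) \<le> \<mu> * (X^2 + Y^2)" for X Y :: real using assms(2) by (intro mult_right_mono) auto
  then show ?thesis using assms(1) unfolding dissipates_def by (blast intro: order_trans)
qed

lemma dissipates_uncoupled:
  assumes "\<mu> \<le> p" "\<mu> \<le> r"
  shows "dissipates \<mu> p q r 0"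
  using assms by (simp add: dissipates_def distrib_left add_mono mult_right_mono)

text \<open>The mixed term in the energy transfers the dissipation of the strongly damped component to the
  other one through the coupling \<open>q\<close>. Gronwall's argument then gives the exponential rate.\<close>

lemma energy_decay:
  fixes y1 y2 :: "real \<Rightarrow> complex" and p q r k \<mu> :: real
  assumes d1: "\<And>t. (y1 has_vector_derivative - (of_real p * y1 t + \<i> * of_real q * y2 t)) (at t)"
    and d2: "\<And>t. (y2 has_vector_derivative - (\<i> * of_real q * y1 t + of_real r * y2 t)) (at t)"
    and pos: "p \<ge> 0" "r \<ge> 0" "\<mu> \<ge> 0"
    and diss: "dissipates \<mu> p q r k"
    and t: "t \<ge> 0"
  shows "(norm (y1 t))^2 + (norm (y2 t))^2 \<le> 3 * exp (- (4/3 * \<mu> * t)) * ((norm (y1 0))^2 + (norm (y2 0))^2)"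
proof -
  have k: "\<bar>k\<bar> \<le> 1/2" and coercive: "\<And>X Y. X \<ge> 0 \<Longrightarrow> Y \<ge> 0 \<Longrightarrow>
      \<mu> * (X^2 + Y^2) \<le> (p - k * q) * X^2 + (r + k * q) * Y^2 - \<bar>k\<bar> * (p + r) * (X * Y)"
    using diss by (auto simp: dissipates_def)
  define a b c d where "a t = Re (y1 t)" and "b t = Im (y1 t)" and "c t = Re (y2 t)" and "d t = Im (y2 t)" for t
  have da: "(a has_real_derivative - p * a t + q * d t) (at t)" for t
    using has_field_derivative_Re[OF d1[of t]] by (simp add: a_def[abs_def] b_def c_def d_def)
  have db: "(b has_real_derivative - p * b t - q * c t) (at t)" for t
    using has_field_derivative_Im[OF d1[of t]] by (simp add: a_def b_def[abs_def] c_def d_def)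
  have dc: "(c has_real_derivative q * b t - r * c t) (at t)" for t
    using has_field_derivative_Re[OF d2[of t]] by (simp add: a_def b_def c_def[abs_def] d_def)
  have dd: "(d has_real_derivative - q * a t - r * d t) (at t)" for t
    using has_field_derivative_Im[OF d2[of t]] by (simp add: a_def b_def c_def d_def[abs_def])
  define X2 Y2 z where "X2 t = (a t)^2 + (b t)^2" and "Y2 t = (c t)^2 + (d t)^2" and "z t = b t * c t - a t * d t" for t
  define E where "E t = X2 t + Y2 t + 2 * k * z t" for t
  have XY: "X2 t \<ge> 0" "Y2 t \<ge> 0" for t by (simp_all add: X2_def Y2_def)
  have zle: "\<bar>z t\<bar> \<le> sqrt (X2 t) * sqrt (Y2 t)" for t
  proof -
    have "(z t)^2 \<le> X2 t * Y2 t"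
      using zero_le_power2[of "b t * d t + a t * c t"]
      by (simp add: z_def X2_def Y2_def power2_eq_square algebra_simps)
    then have "sqrt ((z t)^2) \<le> sqrt (X2 t * Y2 t)" by (rule real_sqrt_le_mono)
    then show ?thesis by (simp add: real_sqrt_mult)
  qed
  have z2: "\<bar>2 * k * z t\<bar> \<le> (X2 t + Y2 t) / 2" for t
  proof -
    have "2 * (sqrt (X2 t) * sqrt (Y2 t)) \<le> X2 t + Y2 t"
      using sum_squares_bound[of "sqrt (X2 t)" "sqrt (Y2 t)"] XY[of t] by (simp add: mult.assoc)
    then have "2 * \<bar>z t\<bar> \<le> X2 t + Y2 t" using zle[of t] by simp
    then have "\<bar>k\<bar> * (2 * \<bar>z t\<bar>) \<le> 1/2 * (X2 t + Y2 t)" using k by (intro mult_mono) auto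
    then show ?thesis by (simp add: abs_mult mult_ac)
  qed
  have dE: "(E has_real_derivative
      - 2 * ((p - k * q) * X2 t + (r + k * q) * Y2 t + k * (p + r) * z t)) (at t)" for t
    unfolding E_def[abs_def] X2_def[abs_def] Y2_def[abs_def] z_def[abs_def]
    by (rule derivative_eq_intros refl da db dc dd | simp add: power2_eq_square algebra_simps)+
  have E': "- 2 * ((p - k * q) * X2 t + (r + k * q) * Y2 t + k * (p + r) * z t) \<le> - (4/3 * \<mu>) * E t" for t
  proof -
    have "\<bar>k * (p + r) * z t\<bar> \<le> \<bar>k\<bar> * (p + r) * (sqrt (X2 t) * sqrt (Y2 t))"
      using zle[of t] pos by (simp add: abs_mult mult_left_mono)
    then have "- (k * (p + r) * z t) \<le> \<bar>k\<bar> * (p + r) * (sqrt (X2 t) * sqrt (Y2 t))" by linarith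
    moreover have "\<mu> * (X2 t + Y2 t) \<le> (p - k * q) * X2 t + (r + k * q) * Y2 t - \<bar>k\<bar> * (p + r) * (sqrt (X2 t) * sqrt (Y2 t))"
      using coercive[of "sqrt (X2 t)" "sqrt (Y2 t)"] XY[of t] by simp
    ultimately have 1: "\<mu> * (X2 t + Y2 t) \<le> (p - k * q) * X2 t + (r + k * q) * Y2 t + k * (p + r) * z t"
      by linarith
    have "E t \<le> 3/2 * (X2 t + Y2 t)" using z2[of t] by (simp add: E_def abs_le_iff)
    then have "\<mu> * E t \<le> \<mu> * (3/2 * (X2 t + Y2 t))" using pos by (intro mult_left_mono) auto
    then have "\<mu> * E t \<le> 3/2 * (\<mu> * (X2 t + Y2 t))" by (simp only: mult.left_commute)
    also have "\<dots> \<le> 3/2 * ((p - k * q) * X2 t + (r + k * q) * Y2 t + k * (p + r) * z t)"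
      using 1 by (intro mult_left_mono) auto
    finally have "4/3 * (\<mu> * E t) \<le> 4/3 * (3/2 * ((p - k * q) * X2 t + (r + k * q) * Y2 t + k * (p + r) * z t))"
      by (rule mult_left_mono) simp
    then show ?thesis by simp
  qed
  have "exp (4/3 * \<mu> * t) * E t \<le> exp (4/3 * \<mu> * 0) * E 0"
  proof (rule DERIV_nonpos_imp_nonincreasing[OF t])
    fix s assume "0 \<le> s" "s \<le> t"
    let ?D = "- 2 * ((p - k * q) * X2 s + (r + k * q) * Y2 s + k * (p + r) * z s)"
    have "((\<lambda>s. exp (4/3 * \<mu> * s) * E s) has_real_derivative exp (4/3 * \<mu> * s) * (?D + 4/3 * \<mu> * E s)) (at s)"
      by (rule derivative_eq_intros refl dE | simp add: algebra_simps)+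
    moreover have "exp (4/3 * \<mu> * s) * (?D + 4/3 * \<mu> * E s) \<le> 0"
      using E'[of s] by (intro mult_nonneg_nonpos) auto
    ultimately show "\<exists>y. ((\<lambda>s. exp (4/3 * \<mu> * s) * E s) has_real_derivative y) (at s) \<and> y \<le> 0" by blast
  qed
  then have "exp (- (4/3 * \<mu> * t)) * (exp (4/3 * \<mu> * t) * E t) \<le> exp (- (4/3 * \<mu> * t)) * E 0"
    by (intro mult_left_mono) auto
  then have Et: "E t \<le> exp (- (4/3 * \<mu> * t)) * E 0"
    by (simp add: mult.assoc[symmetric] flip: exp_add)
  have lower: "(X2 t + Y2 t) / 2 \<le> E t" using z2[of t] by (simp add: E_def abs_le_iff field_simps)
  have "E 0 \<le> 3/2 * (X2 0 + Y2 0)" using z2[of 0] by (simp add: E_def abs_le_iff)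
  then have "exp (- (4/3 * \<mu> * t)) * E 0 \<le> exp (- (4/3 * \<mu> * t)) * (3/2 * (X2 0 + Y2 0))"
    by (rule mult_left_mono) simp
  with Et have "E t \<le> exp (- (4/3 * \<mu> * t)) * (3/2 * (X2 0 + Y2 0))" by (rule order_trans)
  with lower have "(X2 t + Y2 t) / 2 \<le> exp (- (4/3 * \<mu> * t)) * (3/2 * (X2 0 + Y2 0))" by (rule order_trans)
  then have "X2 t + Y2 t \<le> 3 * exp (- (4/3 * \<mu> * t)) * (X2 0 + Y2 0)"
    by (simp add: field_simps)
  then show ?thesis
    by (simp add: X2_def Y2_def a_def b_def c_def d_def cmod_power2)
qed

lemma matrix_exp_decay:
  fixes A :: "complex^2^2" and p q r k \<mu> :: real
  assumes A: "A = vector [vector [of_real p, \<i> * of_real q], vector [\<i> * of_real q, of_real r]]"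
    and pos: "p \<ge> 0" "r \<ge> 0" "\<mu> \<ge> 0"
    and diss: "dissipates \<mu> p q r k"
    and t: "t \<ge> 0"
  shows "norm (matrix_exp (- (t *\<^sub>R A)) *v x) \<le> 2 * exp (- (2/3 * \<mu> * t)) * norm x"
proof -
  define y where "y = (\<lambda>t. matrix_exp (t *\<^sub>R (- A)) *v x)"
  note flow = matrix_exp_flow[OF y_def]
  have e: "(norm (y t $ 1))^2 + (norm (y t $ 2))^2
      \<le> 3 * exp (- (4/3 * \<mu> * t)) * ((norm (y 0 $ 1))^2 + (norm (y 0 $ 2))^2)"
  proof (rule energy_decay[OF _ _ pos diss t])
    show "((\<lambda>t. y t $ 1) has_vector_derivative - (of_real p * y t $ 1 + \<i> * of_real q * y t $ 2)) (at t)" for t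
      using flow(2)[of 1 t] by (simp add: matrix_vector_2 A algebra_simps)
    show "((\<lambda>t. y t $ 2) has_vector_derivative - (\<i> * of_real q * y t $ 1 + of_real r * y t $ 2)) (at t)" for t
      using flow(2)[of 2 t] by (simp add: matrix_vector_2 A algebra_simps)
  qed
  have "(norm (y t))^2 \<le> 3 * exp (- (4/3 * \<mu> * t)) * (norm x)^2"
    using e unfolding norm_complex2_sq[symmetric] flow(1) .
  also have "\<dots> \<le> 4 * exp (- (4/3 * \<mu> * t)) * (norm x)^2" by (intro mult_right_mono) auto
  also have "\<dots> = (2 * exp (- (2/3 * \<mu> * t)) * norm x)^2"
    by (simp add: power_mult_distrib flip: exp_of_nat_mult)
  finally have "norm (y t) \<le> 2 * exp (- (2/3 * \<mu> * t)) * norm x"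
    by (rule power2_le_imp_le) simp
  then show ?thesis by (simp add: y_def)
qed

text \<open>Strong damping \<open>\<rho>\<close> of one component suffices if the coupling is of the same size. The constant \<open>k\<close> is so
  small that the loss \<open>k |q|\<close> and the part of the mixed product that is charged to \<open>X\<close> use up at most half
  of \<open>\<rho>\<close>; the rest of the mixed product is half of the gain \<open>k m \<rho>\<close> for \<open>Y\<close>.\<close>

lemma coercive_coupled:
  fixes q r \<rho> m Q :: real
  assumes r: "0 \<le> r" "r \<le> \<rho>" and m: "m > 0"
    and q: "m * \<rho> \<le> \<bar>q\<bar>" "\<bar>q\<bar> \<le> Q * \<rho>" and Q: "Q > 0"
    and k: "k = min (1/2) (1 / (2 * (Q + 2 / m)))" and \<mu>: "\<mu> = k * m / 2 * \<rho>" and m1: "m \<le> 1"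
  shows "dissipates \<mu> \<rho> \<bar>q\<bar> r k"
proof -
  have \<rho>: "\<rho> \<ge> 0" using r by simp
  have k0: "k > 0" using m Q by (simp add: k add_pos_pos)
  have kQ: "k * Q + k * (2 / m) \<le> 1/2"
  proof -
    have D: "2 * (Q + 2 / m) > 0" using m Q by (simp add: add_pos_pos)
    have "k * (2 * (Q + 2 / m)) \<le> 1"
      using D by (simp add: k min_def divide_simps split: if_splits)
    then show ?thesis by (simp add: algebra_simps)
  qed
  have kh: "k \<le> 1/2" by (simp add: k)
  have "\<mu> * (X^2 + Y^2) \<le> (\<rho> - k * \<bar>q\<bar>) * X^2 + (r + k * \<bar>q\<bar>) * Y^2 - k * (\<rho> + r) * (X * Y)"
    if XY: "X \<ge> 0" "Y \<ge> 0" for X Y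
  proof -
    have "2 * (X * Y) \<le> 2 / m * X^2 + m / 2 * Y^2"
    proof -
      have "0 \<le> (sqrt (2 / m) * X - sqrt (m / 2) * Y)^2" by simp
      also have "\<dots> = 2 / m * X^2 + m / 2 * Y^2 - 2 * (sqrt (2 / m) * sqrt (m / 2)) * (X * Y)"
        using m by (simp add: power2_diff power_mult_distrib)
      also have "sqrt (2 / m) * sqrt (m / 2) = 1" using m by (simp flip: real_sqrt_mult)
      finally show ?thesis by simp
    qed
    then have "k * \<rho> * (2 * (X * Y)) \<le> k * \<rho> * (2 / m * X^2 + m / 2 * Y^2)"
      using k0 \<rho> by (intro mult_left_mono) auto
    moreover have "k * (\<rho> + r) * (X * Y) \<le> k * \<rho> * (2 * (X * Y))"
    proof -
      have "k * (\<rho> + r) * (X * Y) \<le> k * (2 * \<rho>) * (X * Y)"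
        using k0 r XY by (intro mult_right_mono mult_left_mono) auto
      then show ?thesis by simp
    qed
    ultimately have 1: "k * (\<rho> + r) * (X * Y) \<le> k * \<rho> * (2 / m) * X^2 + k * \<rho> * (m / 2) * Y^2"
      by (simp add: algebra_simps)
    have 2: "(1 - k * Q) * \<rho> * X^2 \<le> (\<rho> - k * \<bar>q\<bar>) * X^2"
      using q(2) k0 by (intro mult_right_mono) (auto simp: algebra_simps)
    have 3: "k * m * \<rho> * Y^2 \<le> (r + k * \<bar>q\<bar>) * Y^2"
    proof (rule mult_right_mono)
      have "k * (m * \<rho>) \<le> k * \<bar>q\<bar>" using q(1) k0 by (intro mult_left_mono) auto
      then show "k * m * \<rho> \<le> r + k * \<bar>q\<bar>" using r by (simp add: mult.assoc)
    qed simp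
    have 4: "\<mu> * X^2 \<le> (1 - k * Q - k * (2 / m)) * \<rho> * X^2"
    proof (rule mult_right_mono)
      have "k * m \<le> 1/2 * 1" using kh m1 k0 m by (intro mult_mono) auto
      then have "k * m / 2 \<le> 1 - k * Q - k * (2 / m)" using kQ by linarith
      then show "\<mu> \<le> (1 - k * Q - k * (2 / m)) * \<rho>" unfolding \<mu> using \<rho> by (rule mult_right_mono)
    qed simp
    have "\<mu> * (X^2 + Y^2) = \<mu> * X^2 + \<mu> * Y^2" by (simp add: distrib_left)
    also have "\<dots> \<le> (1 - k * Q - k * (2 / m)) * \<rho> * X^2 + \<mu> * Y^2" using 4 by simp
    also have "\<dots> = (1 - k * Q) * \<rho> * X^2 - k * \<rho> * (2 / m) * X^2 + (k * m * \<rho> * Y^2 - k * \<rho> * (m / 2) * Y^2)"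
      by (simp add: \<mu> algebra_simps)
    also have "\<dots> \<le> (\<rho> - k * \<bar>q\<bar>) * X^2 + (r + k * \<bar>q\<bar>) * Y^2 - k * (\<rho> + r) * (X * Y)"
      using 1 2 3 by linarith
    finally show ?thesis .
  qed
  with k0 kh show ?thesis by (simp add: dissipates_def)
qed

section \<open>The symbols of the system\<close>

subsection \<open>The order of a symbol\<close>

text \<open>Only the behaviour towards \<open>+\<infinity>\<close> is extracted, which is enough to tell different orders apart.\<close>

lemma has_order_bounds:
  assumes "has_order \<kappa> m"
  obtains C where "C > 0" "\<forall>\<^sub>F \<xi> in at_top. \<kappa> \<xi> \<ge> C * \<xi> powr m" "\<forall>\<^sub>F \<xi> in at_top. \<kappa> \<xi> \<le> 3 * C * \<xi> powr m"
proof -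
  obtain C where C: "C > 0" and eq: "\<kappa> \<sim>[at_infinity] (\<lambda>\<xi>. C * \<bar>\<xi>\<bar> powr m)"
    using assms by (auto simp: has_order_def)
  let ?g = "\<lambda>\<xi>. C * \<bar>\<xi>\<bar> powr m"
  have "((\<lambda>\<xi>. if \<kappa> \<xi> = 0 \<and> ?g \<xi> = 0 then 1 else \<kappa> \<xi> / ?g \<xi>) \<longlongrightarrow> 1) at_top"
    using eq unfolding asymp_equiv_def by (rule tendsto_mono[OF at_top_le_at_infinity])
  then have "\<forall>\<^sub>F \<xi> in at_top. dist (if \<kappa> \<xi> = 0 \<and> ?g \<xi> = 0 then 1 else \<kappa> \<xi> / ?g \<xi>) 1 < 1/2"
    by (rule tendstoD) simp
  then have "\<forall>\<^sub>F \<xi> in at_top. \<kappa> \<xi> \<ge> C / 2 * \<xi> powr m \<and> \<kappa> \<xi> \<le> 3 * (C / 2) * \<xi> powr m"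
    using eventually_gt_at_top[of 0]
  proof eventually_elim
    case (elim \<xi>)
    have g: "?g \<xi> > 0" using elim C by simp
    define r where "r = \<kappa> \<xi> / ?g \<xi>"
    have "\<bar>r - 1\<bar> < 1/2" using elim g by (simp add: r_def dist_real_def split: if_splits)
    then have r: "1/2 < r" "r < 3/2" by linarith+
    have "1/2 * ?g \<xi> < r * ?g \<xi>" using r(1) g by (rule mult_strict_right_mono)
    moreover have "r * ?g \<xi> < 3/2 * ?g \<xi>" using r(2) g by (rule mult_strict_right_mono)
    moreover have "r * ?g \<xi> = \<kappa> \<xi>"
      using nonzero_divide_eq_eq[OF less_imp_neq[OF g, symmetric], of "\<kappa> \<xi>" r] r_def by simp
    ultimately have "1/2 * ?g \<xi> < \<kappa> \<xi>" "\<kappa> \<xi> < 3/2 * ?g \<xi>" by simp_all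
    then show ?case using elim by simp
  qed
  then show ?thesis using C that[of "C / 2"] by (auto simp: eventually_conj_iff)
qed

lemma has_order_not_bounded:
  assumes "has_order \<kappa> m" "m \<ge> 1"
  shows "\<not> (\<forall>\<xi>. \<kappa> \<xi> \<le> B)"
proof
  assume B: "\<forall>\<xi>. \<kappa> \<xi> \<le> B"
  obtain C where C: "C > 0" "\<forall>\<^sub>F \<xi> in at_top. \<kappa> \<xi> \<ge> C * \<xi> powr m"
    by (rule has_order_bounds[OF assms(1)])
  have "\<forall>\<^sub>F \<xi>::real in at_top. False"
    using C(2) eventually_gt_at_top[of "max 1 (B / C)"]
  proof eventually_elim
    case (elim \<xi>)
    have "\<xi> powr 1 \<le> \<xi> powr m" using elim assms(2) by (intro powr_mono) auto
    then have "C * \<xi> \<le> C * \<xi> powr m" using elim C(1) by simp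
    also have "\<dots> \<le> B" using elim(1) B by (blast intro: order_trans)
    finally show False using elim(2) C(1) by (simp add: field_simps)
  qed
  then show False by simp
qed

lemma has_order_neg_small:
  assumes "has_order \<kappa> (-1)" "B > 0"
  shows "\<not> (\<forall>\<xi>. \<kappa> \<xi> \<ge> B)"
proof
  assume B: "\<forall>\<xi>. \<kappa> \<xi> \<ge> B"
  obtain C where C: "C > 0" "\<forall>\<^sub>F \<xi> in at_top. \<kappa> \<xi> \<le> 3 * C * \<xi> powr (-1)"
    by (rule has_order_bounds[OF assms(1)])
  have "\<forall>\<^sub>F \<xi>::real in at_top. False"
    using C(2) eventually_gt_at_top[of "max 1 (3 * C / B)"]
  proof eventually_elim
    case (elim \<xi>)
    have "B \<le> 3 * C * \<xi> powr (-1)" using elim(1) B by (blast intro: order_trans)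
    then have "B * \<xi> \<le> 3 * C" using elim by (simp add: powr_minus field_simps)
    then show False using elim(2) assms(2) by (simp add: field_simps)
  qed
  then show False by simp
qed

lemma has_order_zero_not_decaying:
  assumes "has_order \<kappa> 0"
  shows "\<not> (\<forall>\<xi>. \<kappa> \<xi> * sqrt (1 + \<xi>^2) \<le> K)"
proof
  assume K: "\<forall>\<xi>. \<kappa> \<xi> * sqrt (1 + \<xi>^2) \<le> K"
  obtain C where C: "C > 0" "\<forall>\<^sub>F \<xi> in at_top. \<kappa> \<xi> \<ge> C * \<xi> powr 0"
    by (rule has_order_bounds[OF assms])
  have "\<forall>\<^sub>F \<xi>::real in at_top. False"
    using C(2) eventually_gt_at_top[of "max 1 (K / C)"]
  proof eventually_elim
    case (elim \<xi>)
    have "\<xi> \<le> sqrt (1 + \<xi>^2)" by (rule real_le_rsqrt) simp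
    then have "C * \<xi> \<le> \<kappa> \<xi> * sqrt (1 + \<xi>^2)" using elim C(1) by (intro mult_mono) auto
    also have "\<dots> \<le> K" using K by blast
    finally show False using elim(2) C(1) by (simp add: field_simps)
  qed
  then show False by simp
qed

subsection \<open>The systems of KdV--Burgers class\<close>

text \<open>The two sign patterns in which both dispersive coefficients are nonzero and \<open>\<omega>\<^sub>1\<close> and \<open>\<omega>\<^sub>2\<close> have
  everywhere the same sign for nonnegative \<open>b\<close> and \<open>d\<close>, so that the coupling of the linear system is skew-adjoint.\<close>

definition dispersive_pair :: "real \<Rightarrow> real \<Rightarrow> bool" where
  "dispersive_pair a c \<longleftrightarrow> (a < 0 \<and> c < 0) \<or> (a = c \<and> c > 0)"

lemma dispersive_pair_commute: "dispersive_pair a c \<Longrightarrow> dispersive_pair c a"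
  by (auto simp: dispersive_pair_def)

lemma dispersive_pair_nonneg: "dispersive_pair a c \<Longrightarrow> 0 \<le> (1 - a * x^2) * (1 - c * x^2)"
  unfolding dispersive_pair_def
proof (elim disjE conjE)
  assume "a < 0" "c < 0"
  then have "a * x^2 \<le> 0" "c * x^2 \<le> 0" by (simp_all add: mult_nonpos_nonneg)
  then show ?thesis by (intro mult_nonneg_nonneg) auto
qed simp

lemma sigma_symbol_commute: "sigma_symbol a b c d = sigma_symbol c d a b"
  by (simp add: sigma_symbol_def fun_eq_iff omega1_def omega2_def mult.commute)

lemma numerator_le:
  fixes a b x :: real
  assumes "b \<ge> 0" "b > 0 \<or> a = 0"
  shows "\<bar>1 - a * x^2\<bar> \<le> (1 + \<bar>a\<bar> / b) * (1 + b * x^2)"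
proof -
  have "\<bar>1 - a * x^2\<bar> \<le> 1 + \<bar>a\<bar> * x^2"
    using abs_triangle_ineq4[of 1 "a * x^2"] by (simp add: abs_mult)
  also have "\<dots> \<le> (1 + \<bar>a\<bar> / b) * (1 + b * x^2)"
  proof (cases "a = 0")
    case False
    then have "(1 + \<bar>a\<bar> / b) * (1 + b * x^2) = 1 + \<bar>a\<bar> * x^2 + (b * x^2 + \<bar>a\<bar> / b)"
      using assms by (simp add: field_simps)
    then show ?thesis using assms by simp
  qed (use assms in simp)
  finally show ?thesis .
qed

text \<open>Each nonconstant numerator is matched with a nonconstant denominator of its own, in one of the two
  possible ways; the quotients of matched factors are bounded.\<close>

lemma sigma_bounded:
  assumes "b \<ge> 0" "d \<ge> 0" and "(b > 0 \<or> a = 0) \<and> (d > 0 \<or> c = 0) \<or> (d > 0 \<or> a = 0) \<and> (b > 0 \<or> c = 0)"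
  shows "\<exists>B. \<forall>\<xi>. sigma_symbol a b c d \<xi> \<le> B"
proof -
  have pos: "1 + b * x^2 > 0" "1 + d * x^2 > 0" for x using assms by (simp_all add: add_pos_nonneg)
  have "\<exists>B. \<forall>x. \<bar>1 - a * x^2\<bar> * \<bar>1 - c * x^2\<bar> \<le> B * ((1 + b * x^2) * (1 + d * x^2))"
    using assms(3)
  proof
    assume h: "(b > 0 \<or> a = 0) \<and> (d > 0 \<or> c = 0)"
    have "\<bar>1 - a * x^2\<bar> * \<bar>1 - c * x^2\<bar> \<le> ((1 + \<bar>a\<bar> / b) * (1 + b * x^2)) * ((1 + \<bar>c\<bar> / d) * (1 + d * x^2))" for x
      using assms h less_imp_le[OF pos(1)] by (intro mult_mono numerator_le mult_nonneg_nonneg) auto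
    then show ?thesis by (intro exI[of _ "(1 + \<bar>a\<bar> / b) * (1 + \<bar>c\<bar> / d)"]) (simp add: mult_ac)
  next
    assume h: "(d > 0 \<or> a = 0) \<and> (b > 0 \<or> c = 0)"
    have "\<bar>1 - a * x^2\<bar> * \<bar>1 - c * x^2\<bar> \<le> ((1 + \<bar>a\<bar> / d) * (1 + d * x^2)) * ((1 + \<bar>c\<bar> / b) * (1 + b * x^2))" for x
      using assms h less_imp_le[OF pos(2)] by (intro mult_mono numerator_le mult_nonneg_nonneg) auto
    then show ?thesis by (intro exI[of _ "(1 + \<bar>a\<bar> / d) * (1 + \<bar>c\<bar> / b)"]) (simp add: mult_ac)
  qed
  then obtain B where B: "\<And>x. \<bar>1 - a * x^2\<bar> * \<bar>1 - c * x^2\<bar> \<le> B * ((1 + b * x^2) * (1 + d * x^2))" by blast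
  have "sigma_symbol a b c d \<xi> \<le> sqrt B" for \<xi>
  proof -
    have "omega1 a b \<xi> * omega2 c d \<xi> \<le> (\<bar>1 - a * \<xi>^2\<bar> * \<bar>1 - c * \<xi>^2\<bar>) / ((1 + b * \<xi>^2) * (1 + d * \<xi>^2))"
      unfolding omega1_def omega2_def times_divide_times_eq abs_mult[symmetric]
      using pos[of \<xi>] by (intro divide_right_mono abs_ge_self) auto
    also have "\<dots> \<le> B" using B[of \<xi>] pos[of \<xi>] by (subst pos_divide_le_eq) auto
    finally show ?thesis by (simp add: sigma_symbol_def)
  qed
  then show ?thesis by blast
qed

text \<open>An unbounded \<open>\<sigma>\<close> needs more nonconstant numerators than denominators; condition (C0) excludes
  the remaining sign patterns. The three cases correspond to the orders 0, 1 and -1 of \<open>H\<close>.\<close>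

lemma KdV_Burgers_cases:
  assumes C0: "cond_C0 a b c d" and C12: "cond_C1 a b c d \<or> cond_C2 a b c d"
    and order: "\<exists>m\<ge>1. has_order (sigma_symbol a b c d) m"
  obtains (unregularised) "b = 0" "d = 0" "a = c" "c > 0"
    | (regularised_u) "b = 0" "d > 0" "dispersive_pair a c"
    | (regularised_eta) "b > 0" "d = 0" "dispersive_pair a c"
proof -
  have nb: "\<not> (\<exists>B. \<forall>\<xi>. sigma_symbol a b c d \<xi> \<le> B)"
    using order has_order_not_bounded by blast
  have bd: "b \<ge> 0" "d \<ge> 0" using C12 by (auto simp: cond_C1_def cond_C2_def)
  have sum: "a + b + c + d = 1/3" "c + d \<ge> 0" using C0 by (auto simp: cond_C0_def)
  note unb = nb sigma_bounded[OF bd, of a c]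
  have n: "\<not> (b > 0 \<and> d > 0)" using unb by blast
  show ?thesis
  proof (cases "cond_C2 a b c d")
    case True
    then have "a = c" "c > 0" "dispersive_pair a c" by (auto simp: cond_C2_def dispersive_pair_def)
    then show ?thesis using that n bd by (cases "b = 0"; cases "d = 0") auto
  next
    case False
    then have ac: "a \<le> 0" "c \<le> 0" using C12 by (auto simp: cond_C1_def)
    have "b > 0 \<or> d > 0" using sum ac bd by linarith
    moreover have "a \<noteq> 0"
    proof
      assume "a = 0"
      show False
      proof (cases "d = 0")
        case True
        then have "c = 0" using sum ac by simp
        with \<open>a = 0\<close> show False using unb by blast
      next
        case False
        with \<open>a = 0\<close> show False using unb bd by (metis less_eq_real_def)
      qed
    qed
    moreover have "c \<noteq> 0"
    proof
      assume "c = 0"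
      show False
      proof (cases "b = 0")
        case True
        then have "d > 0" using sum ac \<open>c = 0\<close> by linarith
        with \<open>c = 0\<close> show False using unb by blast
      next
        case False
        with \<open>c = 0\<close> show False using unb bd by (metis less_eq_real_def)
      qed
    qed
    ultimately show ?thesis using that ac n bd by (auto simp: dispersive_pair_def)
  qed
qed

subsection \<open>Size of the symbols\<close>

lemma H_symbol_measurable [measurable]: "H_symbol a b c d \<in> borel_measurable borel"
  unfolding H_symbol_def[abs_def] omega1_def omega2_def by measurable

text \<open>The convention \<open>0/0 = 1\<close> is symmetric, so exchanging the roles of the two equations inverts \<open>H\<close>.\<close>

lemma H_symbol_inverse: "1 / H_symbol a b c d \<xi> = H_symbol c d a b \<xi>"
  by (auto simp: H_symbol_def omega1_def omega2_def real_sqrt_divide mult.commute)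

lemma H_symbol_unregularised: "H_symbol c 0 c 0 \<xi> = 1"
  by (simp add: H_symbol_def omega1_def omega2_def)

lemma H_symbol_size:
  assumes d: "d > 0" and pair: "dispersive_pair a c"
  obtains K where "K > 0" "\<And>\<xi>. H_symbol a 0 c d \<xi> \<le> K * sqrt (1 + \<xi>^2)" "\<And>\<xi>. sqrt (1 + \<xi>^2) \<le> K * H_symbol a 0 c d \<xi>"
proof -
  have "\<exists>K>0. \<forall>\<xi>. (H_symbol a 0 c d \<xi>)^2 \<le> K * (1 + \<xi>^2) \<and> 1 + \<xi>^2 \<le> K * (H_symbol a 0 c d \<xi>)^2"
    using pair unfolding dispersive_pair_def
  proof
    assume ac: "a < 0 \<and> c < 0"
    define k where "k = (1 + a / c) * (1 + d) + (1 + c / a) * (1 + 1 / d)"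
    have q: "a / c > 0" "c / a > 0" using ac by (simp_all add: divide_neg_neg)
    have k: "(1 + a / c) * (1 + d) \<le> k" "(1 + c / a) * (1 + 1 / d) \<le> k" "k > 0"
      using q d by (simp_all add: k_def add_pos_pos)
    have "(H_symbol a 0 c d \<xi>)^2 \<le> k * (1 + \<xi>^2) \<and> 1 + \<xi>^2 \<le> k * (H_symbol a 0 c d \<xi>)^2" for \<xi>
    proof -
      define x where "x = \<xi>^2"
      have x: "x \<ge> 0" by (simp add: x_def)
      have nn: "a * x \<le> 0" "c * x \<le> 0" "d * x \<ge> 0" using ac d x by (simp_all add: mult_nonpos_nonneg)
      have pos: "1 - a * x > 0" "1 - c * x > 0" "1 + d * x > 0" using nn by linarith+
      have H2: "(H_symbol a 0 c d \<xi>)^2 = (1 - a * x) * (1 + d * x) / (1 - c * x)"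
        using pos by (simp add: H_symbol_def omega1_def omega2_def x_def)
      have 1: "1 - a * x \<le> (1 + a / c) * (1 - c * x)" and 2: "1 - c * x \<le> (1 + c / a) * (1 - a * x)"
        using q nn ac by (simp_all add: algebra_simps)
      have 3: "1 + d * x \<le> (1 + d) * (1 + x)" using d x by (simp add: algebra_simps)
      have 4: "1 + x \<le> (1 + 1 / d) * (1 + d * x)" using d x by (simp add: algebra_simps)
      have "(1 - a * x) * (1 + d * x) \<le> ((1 + a / c) * (1 - c * x)) * ((1 + d) * (1 + x))"
        using 1 3 pos q by (intro mult_mono) auto
      also have "\<dots> = (1 + a / c) * (1 + d) * ((1 + x) * (1 - c * x))" by (simp only: mult_ac)
      also have "\<dots> \<le> k * ((1 + x) * (1 - c * x))" using k(1) x pos by (intro mult_right_mono) auto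
      finally have A: "(H_symbol a 0 c d \<xi>)^2 \<le> k * (1 + x)"
        unfolding H2 using pos by (simp add: divide_le_eq mult.assoc)
      have "(1 + x) * (1 - c * x) \<le> ((1 + 1 / d) * (1 + d * x)) * ((1 + c / a) * (1 - a * x))"
        using 2 4 pos x d by (intro mult_mono) auto
      also have "\<dots> = (1 + c / a) * (1 + 1 / d) * ((1 - a * x) * (1 + d * x))" by (simp only: mult_ac)
      also have "\<dots> \<le> k * ((1 - a * x) * (1 + d * x))" using k(2) pos by (intro mult_right_mono) auto
      finally have "1 + x \<le> k * (H_symbol a 0 c d \<xi>)^2"
        unfolding H2 using pos by (simp add: le_divide_eq mult.assoc)
      with A show ?thesis by (simp add: x_def)
    qed
    with k(3) show ?thesis by blast
  next
    assume ac: "a = c \<and> c > 0"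
    define k where "k = (1 + d) + (1 + 1 / d) + (1 + 1 / c)"
    have k: "1 + d \<le> k" "1 + 1 / d \<le> k" "1 + 1 / c \<le> k" "1 \<le> k" using d ac by (simp_all add: k_def)
    have "(H_symbol a 0 c d \<xi>)^2 \<le> k * (1 + \<xi>^2) \<and> 1 + \<xi>^2 \<le> k * (H_symbol a 0 c d \<xi>)^2" for \<xi>
    proof (cases "1 - c * \<xi>^2 = 0")
      case True
      then have "\<xi>^2 = 1 / c" using ac by (simp add: field_simps)
      moreover have "H_symbol a 0 c d \<xi> = 1" using True ac by (simp add: H_symbol_def omega1_def omega2_def)
      moreover have "1 * 1 \<le> k * (1 + 1 / c)" using k ac by (intro mult_mono) auto
      ultimately show ?thesis using k by simp
    next
      case False
      have pos: "1 + d * \<xi>^2 > 0" using d by (simp add: add_pos_nonneg)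
      have H2: "(H_symbol a 0 c d \<xi>)^2 = 1 + d * \<xi>^2"
        using False ac pos by (simp add: H_symbol_def omega1_def omega2_def)
      have "1 + d * \<xi>^2 \<le> (1 + d) * (1 + \<xi>^2)" using d by (simp add: algebra_simps)
      also have "\<dots> \<le> k * (1 + \<xi>^2)" using k by (intro mult_right_mono) auto
      finally have A: "1 + d * \<xi>^2 \<le> k * (1 + \<xi>^2)" .
      have "1 + \<xi>^2 \<le> (1 + 1 / d) * (1 + d * \<xi>^2)" using d by (simp add: algebra_simps)
      also have "\<dots> \<le> k * (1 + d * \<xi>^2)" using k pos by (intro mult_right_mono) auto
      finally show ?thesis using A unfolding H2 by simp
    qed
    moreover have "k > 0" using k by simp
    ultimately show ?thesis by blast
  qed
  then obtain k where k: "k > 0" "\<And>\<xi>. (H_symbol a 0 c d \<xi>)^2 \<le> k * (1 + \<xi>^2)"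
    "\<And>\<xi>. 1 + \<xi>^2 \<le> k * (H_symbol a 0 c d \<xi>)^2" by blast
  have H0: "H_symbol a 0 c d \<xi> \<ge> 0" for \<xi>
  proof -
    have "0 \<le> omega1 a 0 \<xi> * omega2 c d \<xi>"
      using d dispersive_pair_nonneg[OF pair, of \<xi>] by (simp add: omega1_def omega2_def)
    then have "0 \<le> omega1 a 0 \<xi> / omega2 c d \<xi>"
      by (simp add: zero_le_mult_iff zero_le_divide_iff)
    then show ?thesis by (simp add: H_symbol_def)
  qed
  show ?thesis
  proof (rule that[of "sqrt k"])
    fix \<xi>
    have "sqrt ((H_symbol a 0 c d \<xi>)^2) \<le> sqrt (k * (1 + \<xi>^2))" by (intro real_sqrt_le_mono k)
    then show "H_symbol a 0 c d \<xi> \<le> sqrt k * sqrt (1 + \<xi>^2)" using H0 by (simp add: real_sqrt_mult)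
    have "sqrt (1 + \<xi>^2) \<le> sqrt (k * (H_symbol a 0 c d \<xi>)^2)" by (intro real_sqrt_le_mono k)
    then show "sqrt (1 + \<xi>^2) \<le> sqrt k * H_symbol a 0 c d \<xi>" using H0 by (simp add: real_sqrt_mult)
  qed (use k in simp)
qed

text \<open>For large frequencies the coupling \<open>|\<xi>| \<sigma>\<close> is comparable with \<open>\<xi>\<^sup>2\<close>, the size of the strong damping. The radius
  \<open>R\<close> stays away from the zeros of \<open>1 - a x\<close> and \<open>1 - c x\<close>.\<close>

lemma sigma_symbol_size:
  assumes d: "d > 0" and pair: "dispersive_pair a c"
  obtains R m Q where "R > 0" "0 < m" "m \<le> 1" "Q > 0"
    "\<And>\<xi>. \<xi>^2 \<ge> R \<Longrightarrow> m * \<xi>^2 \<le> \<bar>\<xi>\<bar> * sigma_symbol a 0 c d \<xi> \<and> \<bar>\<xi>\<bar> * sigma_symbol a 0 c d \<xi> \<le> Q * \<xi>^2"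
proof -
  have a0: "a \<noteq> 0" "c \<noteq> 0" using pair by (auto simp: dispersive_pair_def)
  define P where "P = \<bar>a\<bar> * \<bar>c\<bar>"
  have P: "P > 0" using a0 by (simp add: P_def)
  define R where "R = 1 + 2 / \<bar>a\<bar> + 2 / \<bar>c\<bar>"
  have R: "R > 0" using a0 by (simp add: R_def add_pos_pos)
  define m where "m = min 1 (sqrt (P / (4 * (1 + d))))"
  define Q where "Q = sqrt (4 * P / d)"
  have m: "0 < m" "m \<le> 1" "m \<le> sqrt (P / (4 * (1 + d)))" using P d by (auto simp: m_def)
  have Q: "Q > 0" using P d by (simp add: Q_def)
  have "m * \<xi>^2 \<le> \<bar>\<xi>\<bar> * sigma_symbol a 0 c d \<xi> \<and> \<bar>\<xi>\<bar> * sigma_symbol a 0 c d \<xi> \<le> Q * \<xi>^2"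
    if xi: "\<xi>^2 \<ge> R" for \<xi>
  proof -
    define x where "x = \<xi>^2"
    have sx: "sqrt x = \<bar>\<xi>\<bar>" by (simp add: x_def)
    have x: "x \<ge> 1" "x \<ge> 2 / \<bar>a\<bar>" "x \<ge> 2 / \<bar>c\<bar>"
      using xi a0 by (auto simp: x_def R_def intro: order_trans[rotated])
    have lin: "\<bar>e\<bar> * x / 2 \<le> \<bar>1 - e * x\<bar> \<and> \<bar>1 - e * x\<bar> \<le> 2 * \<bar>e\<bar> * x" if e: "e \<noteq> 0" "x \<ge> 2 / \<bar>e\<bar>" for e
    proof -
      have "2 \<le> \<bar>e\<bar> * x" using e by (simp add: divide_le_eq mult.commute)
      moreover have "\<bar>e * x\<bar> = \<bar>e\<bar> * x" using x by (simp add: abs_mult)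
      ultimately show ?thesis by (auto simp: abs_if split: if_splits)
    qed
    have prod: "omega1 a 0 \<xi> * omega2 c d \<xi> = \<bar>1 - a * x\<bar> * \<bar>1 - c * x\<bar> / (1 + d * x)"
      using dispersive_pair_nonneg[OF pair, of \<xi>]
      by (simp add: omega1_def omega2_def x_def abs_mult[symmetric])
    have dx: "1 + d * x > 0" "1 + d * x \<le> (1 + d) * x" using d x by (simp_all add: add_pos_nonneg algebra_simps)
    have "(\<bar>a\<bar> * x / 2) * (\<bar>c\<bar> * x / 2) \<le> \<bar>1 - a * x\<bar> * \<bar>1 - c * x\<bar>"
      using lin[OF a0(1) x(2)] lin[OF a0(2) x(3)] x(1) by (intro mult_mono) auto
    moreover have "(\<bar>a\<bar> * x / 2) * (\<bar>c\<bar> * x / 2) = P / (4 * (1 + d)) * x * ((1 + d) * x)"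
      using d by (simp add: P_def field_simps)
    moreover have "P / (4 * (1 + d)) * x * (1 + d * x) \<le> P / (4 * (1 + d)) * x * ((1 + d) * x)"
      using dx P d x by (intro mult_left_mono) auto
    ultimately have "P / (4 * (1 + d)) * x * (1 + d * x) \<le> \<bar>1 - a * x\<bar> * \<bar>1 - c * x\<bar>" by linarith
    then have lower: "P / (4 * (1 + d)) * x \<le> omega1 a 0 \<xi> * omega2 c d \<xi>"
      unfolding prod by (subst pos_le_divide_eq[OF dx(1)])
    have "\<bar>1 - a * x\<bar> * \<bar>1 - c * x\<bar> \<le> (2 * \<bar>a\<bar> * x) * (2 * \<bar>c\<bar> * x)"
      using lin[OF a0(1) x(2)] lin[OF a0(2) x(3)] x(1) by (intro mult_mono) auto
    also have "\<dots> = 4 * P / d * x * (d * x)" using d by (simp add: P_def)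
    also have "\<dots> \<le> 4 * P / d * x * (1 + d * x)" using P d x by (intro mult_left_mono) auto
    finally have upper: "omega1 a 0 \<xi> * omega2 c d \<xi> \<le> 4 * P / d * x"
      unfolding prod by (subst pos_divide_le_eq[OF dx(1)])
    have s1: "m * \<bar>\<xi>\<bar> \<le> sigma_symbol a 0 c d \<xi>"
    proof -
      have "m * \<bar>\<xi>\<bar> \<le> sqrt (P / (4 * (1 + d))) * \<bar>\<xi>\<bar>" using m by (intro mult_right_mono) auto
      also have "\<dots> = sqrt (P / (4 * (1 + d)) * x)" by (simp only: real_sqrt_mult sx)
      also have "\<dots> \<le> sigma_symbol a 0 c d \<xi>" unfolding sigma_symbol_def by (intro real_sqrt_le_mono lower)
      finally show ?thesis .
    qed
    have s2: "sigma_symbol a 0 c d \<xi> \<le> Q * \<bar>\<xi>\<bar>"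
    proof -
      have "sigma_symbol a 0 c d \<xi> \<le> sqrt (4 * P / d * x)" unfolding sigma_symbol_def by (intro real_sqrt_le_mono upper)
      also have "\<dots> = Q * \<bar>\<xi>\<bar>" by (simp only: real_sqrt_mult sx Q_def)
      finally show ?thesis .
    qed
    have "\<bar>\<xi>\<bar> * (m * \<bar>\<xi>\<bar>) \<le> \<bar>\<xi>\<bar> * sigma_symbol a 0 c d \<xi>" "\<bar>\<xi>\<bar> * sigma_symbol a 0 c d \<xi> \<le> \<bar>\<xi>\<bar> * (Q * \<bar>\<xi>\<bar>)"
      by (intro mult_left_mono s1 s2; simp)+
    moreover have "\<bar>\<xi>\<bar> * (y * \<bar>\<xi>\<bar>) = y * \<xi>^2" for y by (simp add: power2_eq_square mult_ac)
    ultimately show ?thesis by simp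
  qed
  then show ?thesis using that[OF R m(1,2) Q] by blast
qed

subsection \<open>Parabolic decay of the linear flow\<close>

text \<open>Equal signs of \<open>\<omega>\<^sub>1\<close> and \<open>\<omega>\<^sub>2\<close> give both off-diagonal entries the same value \<open>i q\<close>.\<close>

lemma A_symbol_pair:
  fixes \<xi> :: real
  assumes "b \<ge> 0" "d \<ge> 0" "dispersive_pair a c"
  defines "q \<equiv> sgn (omega1 a b \<xi>) * \<xi> * sigma_symbol a b c d \<xi>"
  shows "A_symbol a b c d \<xi> = vector [vector [of_real (alpha_symbol b \<xi>), \<i> * of_real q],
                                       vector [\<i> * of_real q, of_real (epsilon_symbol d \<xi>)]]"
proof -
  have pos: "1 + b * \<xi>^2 > 0" "1 + d * \<xi>^2 > 0" using assms by (simp_all add: add_pos_nonneg)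
  have "sgn (omega1 a b \<xi>) = sgn (1 - a * \<xi>^2)" "sgn (omega2 c d \<xi>) = sgn (1 - c * \<xi>^2)"
    using pos by (simp_all add: omega1_def omega2_def sgn_divide)
  moreover have "sgn (1 - a * \<xi>^2) = sgn (1 - c * \<xi>^2)"
    using assms(3) unfolding dispersive_pair_def
  proof
    assume ac: "a < 0 \<and> c < 0"
    then have "a * \<xi>^2 \<le> 0" "c * \<xi>^2 \<le> 0" by (simp_all add: mult_nonpos_nonneg)
    then have "1 - a * \<xi>^2 > 0" "1 - c * \<xi>^2 > 0" by linarith+
    then show ?thesis by simp
  qed simp
  ultimately show ?thesis by (simp add: A_symbol_def q_def)
qed

lemma abs_sgn_omega1_sigma: "\<bar>sgn (omega1 a b \<xi>) * \<xi> * sigma_symbol a b c d \<xi>\<bar> = \<bar>\<xi>\<bar> * \<bar>sigma_symbol a b c d \<xi>\<bar>"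
  by (auto simp: abs_mult sgn_if sigma_symbol_def)

lemma A_symbol_measurable:
  "(\<lambda>\<xi>. A_symbol a b c d \<xi> $ i $ j) \<in> borel_measurable borel"
proof -
  have [measurable]: "omega1 a b \<in> borel_measurable borel" "omega2 c d \<in> borel_measurable borel"
    "alpha_symbol b \<in> borel_measurable borel" "epsilon_symbol d \<in> borel_measurable borel"
    unfolding omega1_def[abs_def] omega2_def[abs_def] alpha_symbol_def[abs_def] epsilon_symbol_def[abs_def]
    by measurable
  have [measurable]: "sigma_symbol a b c d \<in> borel_measurable borel"
    unfolding sigma_symbol_def[abs_def] by measurable
  show ?thesis
    using exhaust_2[of i] exhaust_2[of j] by (auto simp: A_symbol_def sgn_if)
qed

lemma parabolic_S_symbolI:
  assumes \<mu>: "\<mu> > 0" and bd: "b \<ge> 0" "d \<ge> 0" and pair: "dispersive_pair a c"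
    and diss: "\<And>\<xi>. \<exists>k. dissipates (\<mu> * \<xi>^2) (alpha_symbol b \<xi>) (\<bar>\<xi>\<bar> * \<bar>sigma_symbol a b c d \<xi>\<bar>) (epsilon_symbol d \<xi>) k"
  shows "parabolic_symbol (S_symbol a b c d) 2 (2/3 * \<mu>)"
proof
  show "(\<lambda>\<xi>. S_symbol a b c d t \<xi> $ i $ j) \<in> borel_measurable borel" for t i j
    unfolding S_symbol_def
  proof (rule matrix_exp_measurable)
    show "(\<lambda>\<xi>. (- (t *\<^sub>R A_symbol a b c d \<xi>)) $ i $ j) \<in> borel_measurable borel" for i j
      using A_symbol_measurable[of a b c d i j] by simp
  qed
  show "norm (S_symbol a b c d t \<xi> *v x) \<le> 2 * exp (- (2/3 * \<mu>) * \<xi>^2 * t) * norm x"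
    if t: "t \<ge> 0" for t \<xi> x
  proof -
    obtain k where k: "dissipates (\<mu> * \<xi>^2) (alpha_symbol b \<xi>) (sgn (omega1 a b \<xi>) * \<xi> * sigma_symbol a b c d \<xi>) (epsilon_symbol d \<xi>) k"
      using diss[of \<xi>] dissipates_abs unfolding abs_sgn_omega1_sigma[symmetric] by blast
    have "norm (S_symbol a b c d t \<xi> *v x) \<le> 2 * exp (- (2/3 * (\<mu> * \<xi>^2) * t)) * norm x"
      unfolding S_symbol_def
    proof (rule matrix_exp_decay[OF A_symbol_pair[OF bd pair] _ _ _ k t])
      show "0 \<le> alpha_symbol b \<xi>" "0 \<le> epsilon_symbol d \<xi>" "0 \<le> \<mu> * \<xi>^2"
        using bd \<mu> by (simp_all add: alpha_symbol_def epsilon_symbol_def)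
    qed
    then show ?thesis by (simp add: mult_ac)
  qed
qed (use \<mu> in auto)

text \<open>The weak damping \<open>\<xi>\<^sup>2 / (1 + d \<xi>\<^sup>2)\<close> stays bounded as \<open>|\<xi>|\<close> grows. At high frequencies the coupling compensates
  for this; at low frequencies both components are damped at the rate \<open>\<xi>\<^sup>2\<close> and the mixed term is switched off,
  because there the coupling may be much larger than the damping.\<close>

lemma coupled_frequency:
  assumes d: "d > 0" and pair: "dispersive_pair a c"
  obtains \<mu> where "\<mu> > 0"
    "\<And>\<xi>. \<exists>k. dissipates (\<mu> * \<xi>^2) (\<xi>^2) (\<bar>\<xi>\<bar> * \<bar>sigma_symbol a 0 c d \<xi>\<bar>) (\<xi>^2 / (1 + d * \<xi>^2)) k"
proof -
  obtain R m Q where R: "R > 0" and m: "0 < m" "m \<le> 1" and Q: "Q > 0" and s: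
    "\<And>\<xi>. \<xi>^2 \<ge> R \<Longrightarrow> m * \<xi>^2 \<le> \<bar>\<xi>\<bar> * sigma_symbol a 0 c d \<xi> \<and> \<bar>\<xi>\<bar> * sigma_symbol a 0 c d \<xi> \<le> Q * \<xi>^2"
    by (rule sigma_symbol_size[OF d pair]) blast
  define k where "k = min (1/2) (1 / (2 * (Q + 2 / m)))"
  have k: "k > 0" using m Q by (auto simp: k_def add_pos_pos)
  define \<mu> where "\<mu> = min (k * m / 2) (1 / (1 + d * R))"
  have dR: "1 + d * R > 0" using d R by (simp add: add_pos_pos)
  have \<mu>: "\<mu> > 0" using k m dR by (simp add: \<mu>_def)
  have r: "0 \<le> \<xi>^2 / (1 + d * \<xi>^2)" "\<xi>^2 / (1 + d * \<xi>^2) \<le> \<xi>^2" for \<xi> :: real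
  proof -
    have "1 \<le> 1 + d * \<xi>^2" using d by simp
    then have "\<xi>^2 / (1 + d * \<xi>^2) \<le> \<xi>^2 / 1" by (intro divide_left_mono) auto
    then show "\<xi>^2 / (1 + d * \<xi>^2) \<le> \<xi>^2" by simp
  qed (use d in simp)
  have "\<exists>k. dissipates (\<mu> * \<xi>^2) (\<xi>^2) (\<bar>\<xi>\<bar> * \<bar>sigma_symbol a 0 c d \<xi>\<bar>) (\<xi>^2 / (1 + d * \<xi>^2)) k" for \<xi> :: real
  proof (cases "\<xi>^2 \<ge> R")
    case True
    note s = s[OF True]
    have "0 \<le> \<bar>\<xi>\<bar> * sigma_symbol a 0 c d \<xi>"
      using s m by (auto intro: order_trans[rotated])
    then have q: "m * \<xi>^2 \<le> \<bar>\<bar>\<xi>\<bar> * sigma_symbol a 0 c d \<xi>\<bar>" "\<bar>\<bar>\<xi>\<bar> * sigma_symbol a 0 c d \<xi>\<bar> \<le> Q * \<xi>^2"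
      using s by simp_all
    have "\<mu> * \<xi>^2 \<le> k * m / 2 * \<xi>^2" by (intro mult_right_mono) (auto simp: \<mu>_def)
    from dissipates_mono[OF coercive_coupled[OF r m(1) q Q k_def refl m(2)] this]
    show ?thesis by (auto simp: abs_mult)
  next
    case False
    have "\<mu> * \<xi>^2 \<le> \<xi>^2 / (1 + d * \<xi>^2)"
    proof -
      have "1 + d * \<xi>^2 \<le> 1 + d * R" using False d by simp
      moreover have "1 + d * \<xi>^2 > 0" using d by (simp add: add_pos_nonneg)
      ultimately have "1 / (1 + d * R) \<le> 1 / (1 + d * \<xi>^2)" by (intro divide_left_mono) auto
      then have "\<mu> \<le> 1 / (1 + d * \<xi>^2)" by (simp add: \<mu>_def)
      then have "\<mu> * \<xi>^2 \<le> 1 / (1 + d * \<xi>^2) * \<xi>^2" by (rule mult_right_mono) simp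
      then show ?thesis by simp
    qed
    then show ?thesis using r(2)[of \<xi>] by (intro exI[of _ 0] dissipates_uncoupled) auto
  qed
  with \<mu> show ?thesis by (rule that)
qed

lemma parabolic_unregularised:
  assumes "c > 0"
  shows "\<exists>\<beta>. parabolic_symbol (S_symbol c 0 c 0) 2 \<beta>"
proof -
  have "parabolic_symbol (S_symbol c 0 c 0) 2 (2/3 * 1)"
  proof (rule parabolic_S_symbolI)
    show "dispersive_pair c c" using assms by (simp add: dispersive_pair_def)
  qed (auto simp: alpha_symbol_def epsilon_symbol_def intro!: exI[of _ 0] dissipates_uncoupled)
  then show ?thesis by blast
qed

lemma parabolic_regularised_u:
  assumes d: "d > 0" and pair: "dispersive_pair a c"
  shows "\<exists>\<beta>. parabolic_symbol (S_symbol a 0 c d) 2 \<beta>"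
proof -
  obtain \<mu> where \<mu>: "\<mu> > 0" and "\<And>\<xi>. \<exists>k. dissipates (\<mu> * \<xi>^2) (\<xi>^2) (\<bar>\<xi>\<bar> * \<bar>sigma_symbol a 0 c d \<xi>\<bar>) (\<xi>^2 / (1 + d * \<xi>^2)) k"
    by (rule coupled_frequency[OF d pair]) blast
  then have "parabolic_symbol (S_symbol a 0 c d) 2 (2/3 * \<mu>)"
    using d by (intro parabolic_S_symbolI[OF \<mu> _ _ pair]) (auto simp: alpha_symbol_def epsilon_symbol_def)
  then show ?thesis by blast
qed

lemma parabolic_regularised_eta:
  assumes b: "b > 0" and pair: "dispersive_pair a c"
  shows "\<exists>\<beta>. parabolic_symbol (S_symbol a b c 0) 2 \<beta>"
proof -
  obtain \<mu> where \<mu>: "\<mu> > 0" and c: "\<And>\<xi>. \<exists>k. dissipates (\<mu> * \<xi>^2) (\<xi>^2) (\<bar>\<xi>\<bar> * \<bar>sigma_symbol a b c 0 \<xi>\<bar>) (\<xi>^2 / (1 + b * \<xi>^2)) k"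
    using coupled_frequency[OF b dispersive_pair_commute[OF pair]]
    unfolding sigma_symbol_commute[of c 0 a b] by blast
  have "parabolic_symbol (S_symbol a b c 0) 2 (2/3 * \<mu>)"
  proof (rule parabolic_S_symbolI[OF \<mu> _ _ pair])
    show "\<exists>k. dissipates (\<mu> * \<xi>^2) (alpha_symbol b \<xi>) (\<bar>\<xi>\<bar> * \<bar>sigma_symbol a b c 0 \<xi>\<bar>) (epsilon_symbol 0 \<xi>) k" for \<xi>
    proof -
      obtain k where "dissipates (\<mu> * \<xi>^2) (\<xi>^2) (\<bar>\<xi>\<bar> * \<bar>sigma_symbol a b c 0 \<xi>\<bar>) (\<xi>^2 / (1 + b * \<xi>^2)) k"
        using c by blast
      from dissipates_swap[OF this] show ?thesis by (auto simp: alpha_symbol_def epsilon_symbol_def)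
    qed
  qed (use b in auto)
  then show ?thesis by blast
qed

section \<open>The nonlinearity\<close>

lemma multiplier_bounded:
  assumes m [measurable]: "m \<in> borel_measurable borel" and K: "\<And>\<xi>. norm (m \<xi>) \<le> K"
  shows "AE \<xi> in lborel. rep_L2 (fourier (multiplier m f)) \<xi> = m \<xi> * rep_L2 (fourier f) \<xi>"
    "norm (multiplier m f) \<le> K * norm f"
proof -
  let ?g = "\<lambda>\<xi>. m \<xi> * rep_L2 (fourier f) \<xi>"
  have K0: "0 \<le> K" using order_trans[OF norm_ge_zero K] .
  have g: "square_integrable ?g"
    by (rule square_integrable_bound[OF square_integrable_rep_L2[of "fourier f"], where C=K])
      (auto simp: norm_mult K mult_right_mono)
  show "AE \<xi> in lborel. rep_L2 (fourier (multiplier m f)) \<xi> = m \<xi> * rep_L2 (fourier f) \<xi>"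
    unfolding multiplier_def by (rule rep_inv_fourier[OF g])
  have "2 * pi * (norm (multiplier m f))^2 = (LBINT \<xi>. (norm (?g \<xi>))^2)"
    unfolding multiplier_def by (rule norm_inv_fourier[OF g])
  also have "\<dots> \<le> (LBINT \<xi>. K^2 * (norm (rep_L2 (fourier f) \<xi>))^2)"
  proof (rule integral_mono)
    show "integrable lborel (\<lambda>\<xi>. (norm (?g \<xi>))^2)" using g by (simp add: square_integrable_def)
    show "integrable lborel (\<lambda>\<xi>. K^2 * (norm (rep_L2 (fourier f) \<xi>))^2)"
      using square_integrable_rep_L2[of "fourier f"] by (simp add: square_integrable_def)
    show "(norm (?g \<xi>))^2 \<le> K^2 * (norm (rep_L2 (fourier f) \<xi>))^2" for \<xi>
      using K[of \<xi>] by (simp add: norm_mult power_mult_distrib mult_right_mono power_mono)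
  qed
  also have "\<dots> = 2 * pi * (K * norm f)^2"
    by (simp add: Plancherel power_mult_distrib flip: norm_L2_sq)
  finally have "(norm (multiplier m f))^2 \<le> (K * norm f)^2" by simp
  then show "norm (multiplier m f) \<le> K * norm f" by (rule power2_le_imp_le) (use K0 in simp)
qed

text \<open>A symbol of order \<open>-1\<close> gains one derivative.\<close>

lemma multiplier_H1:
  assumes m [measurable]: "m \<in> borel_measurable borel" and K: "\<And>\<xi>. sqrt (1 + \<xi>^2) * norm (m \<xi>) \<le> K"
  shows "multiplier m f \<in> H1" "H1_norm (multiplier m f) \<le> K * norm f"
proof -
  have K0: "0 \<le> K" using order_trans[OF _ K[of 0]] by simp
  have mK: "norm (m \<xi>) \<le> K" for \<xi>
  proof -
    have "1 * norm (m \<xi>) \<le> sqrt (1 + \<xi>^2) * norm (m \<xi>)" by (intro mult_right_mono) auto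
    then show ?thesis using K[of \<xi>] by simp
  qed
  have le: "AE \<xi> in lborel. (1 + \<xi>^2) * (norm (rep_L2 (fourier (multiplier m f)) \<xi>))^2
      \<le> K^2 * (norm (rep_L2 (fourier f) \<xi>))^2"
    using multiplier_bounded(1)[OF m mK, of f]
  proof eventually_elim
    case (elim \<xi>)
    have "(sqrt (1 + \<xi>^2) * norm (m \<xi>))^2 \<le> K^2" by (intro power_mono K) auto
    then have "(1 + \<xi>^2) * (norm (m \<xi>))^2 \<le> K^2" by (simp add: power_mult_distrib)
    then have "((1 + \<xi>^2) * (norm (m \<xi>))^2) * (norm (rep_L2 (fourier f) \<xi>))^2 \<le> K^2 * (norm (rep_L2 (fourier f) \<xi>))^2"
      by (rule mult_right_mono) simp
    then show ?case unfolding elim by (simp add: norm_mult power_mult_distrib mult.assoc)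
  qed
  have i: "integrable lborel (\<lambda>\<xi>. K^2 * (norm (rep_L2 (fourier f) \<xi>))^2)"
    using square_integrable_rep_L2[of "fourier f"] by (simp add: square_integrable_def)
  have j: "integrable lborel (\<lambda>\<xi>. (1 + \<xi>^2) * (norm (rep_L2 (fourier (multiplier m f)) \<xi>))^2)"
  proof (rule Bochner_Integration.integrable_bound[OF i])
    show "AE \<xi> in lborel. norm ((1 + \<xi>^2) * (norm (rep_L2 (fourier (multiplier m f)) \<xi>))^2)
        \<le> norm (K^2 * (norm (rep_L2 (fourier f) \<xi>))^2)"
      using le by eventually_elim (simp add: abs_mult)
  qed measurable
  then show "multiplier m f \<in> H1" by (simp add: H1_def)
  have "(LBINT \<xi>. (1 + \<xi>^2) * (norm (rep_L2 (fourier (multiplier m f)) \<xi>))^2) / (2 * pi)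
      \<le> (LBINT \<xi>. K^2 * (norm (rep_L2 (fourier f) \<xi>))^2) / (2 * pi)"
    by (intro divide_right_mono integral_mono_AE j i le) simp
  also have "\<dots> = (K * norm f)^2"
    by (simp add: Plancherel power_mult_distrib flip: norm_L2_sq)
  finally have "H1_norm (multiplier m f) \<le> sqrt ((K * norm f)^2)"
    unfolding H1_norm_def by (rule real_sqrt_le_mono)
  then show "H1_norm (multiplier m f) \<le> K * norm f" using K0 by simp
qed

text \<open>The product is only integrable, and its transform is bounded by the norms of the factors.\<close>

lemma fourier_L1_product:
  "norm (fourier_L1 (\<lambda>x. rep_L2 f x * rep_L2 g x) \<xi>) \<le> ((norm f)^2 + (norm g)^2) / 2"
proof -
  have i: "integrable lborel (\<lambda>x. (norm (rep_L2 h x))^2)" for h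
    using square_integrable_rep_L2[of h] by (simp add: square_integrable_def)
  have "norm (fourier_L1 (\<lambda>x. rep_L2 f x * rep_L2 g x) \<xi>) \<le> (LBINT x. norm (rep_L2 f x * rep_L2 g x))"
    by (rule norm_fourier_L1_le)
  also have "\<dots> \<le> (LBINT x. ((norm (rep_L2 f x))^2 + (norm (rep_L2 g x))^2) / 2)"
  proof (rule integral_mono')
    show "integrable lborel (\<lambda>x. ((norm (rep_L2 f x))^2 + (norm (rep_L2 g x))^2) / 2)"
      using i by simp
    show "norm (rep_L2 f x * rep_L2 g x) \<le> ((norm (rep_L2 f x))^2 + (norm (rep_L2 g x))^2) / 2" for x
      using sum_squares_bound[of "norm (rep_L2 f x)" "norm (rep_L2 g x)"] by (simp add: norm_mult)
  qed simp
  also have "\<dots> = ((norm f)^2 + (norm g)^2) / 2"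
    using i by (simp add: norm_L2_sq)
  finally show ?thesis .
qed

lemma norm_complex2_le: "norm (x :: complex^2) \<le> norm (x $ 1) + norm (x $ 2)"
  by (rule power2_le_imp_le) (auto simp: norm_complex2_sq power2_sum)

text \<open>The common shape of the two nonlinearities: bounded symbols in front of transforms of products
  whose factors are bounded multiples of the components of \<open>v\<close>.\<close>

lemma quadratic_F_bound:
  fixes m1 m2 :: "real \<Rightarrow> real" and f g h :: L2
  assumes m: "\<bar>m1 \<xi>\<bar> \<le> K" "\<bar>m2 \<xi>\<bar> \<le> K" and L: "norm f \<le> L * N" "norm g \<le> L * N"
    and F: "F = vector [of_real (m1 \<xi>) * fourier_L1 (\<lambda>x. rep_L2 f x * rep_L2 g x) \<xi>,
                        of_real (m2 \<xi>) * fourier_L1 (\<lambda>x. (rep_L2 h x)^2) \<xi>]" and h: "norm h \<le> L * N"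
  shows "norm (F :: complex^2) \<le> 2 * K * L^2 * N^2"
proof -
  have K: "K \<ge> 0" using m(1) by linarith
  have sq: "(norm e)^2 \<le> L^2 * N^2" if "norm e \<le> L * N" for e :: L2
    using power_mono[OF that, of 2] by (simp add: power_mult_distrib)
  have avg: "(x + y) / 2 \<le> B" if "x \<le> B" "y \<le> B" for x y B :: real using that by simp
  have 1: "norm (fourier_L1 (\<lambda>x. rep_L2 f x * rep_L2 g x) \<xi>) \<le> L^2 * N^2"
    by (rule order_trans[OF fourier_L1_product avg[OF sq[OF L(1)] sq[OF L(2)]]])
  have 2: "norm (fourier_L1 (\<lambda>x. (rep_L2 h x)^2) \<xi>) \<le> L^2 * N^2"
    using order_trans[OF fourier_L1_product avg[OF sq[OF h] sq[OF h]]] by (simp add: power2_eq_square[of "rep_L2 h _"])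
  have "norm F \<le> norm (F $ 1) + norm (F $ 2)" by (rule norm_complex2_le)
  also have "\<dots> \<le> K * (L^2 * N^2) + K * (L^2 * N^2)"
    unfolding F vector_2 norm_mult norm_of_real by (intro add_mono mult_mono m 1 2 K) auto
  finally show ?thesis by simp
qed

lemma F_hat_w_measurable: "(\<lambda>\<xi>. F_hat_w a b c d v \<xi> $ i) \<in> borel_measurable borel"
  using exhaust_2[of i] by (auto simp: F_hat_w_def Let_def)

lemma F_hat_tau_measurable: "(\<lambda>\<xi>. F_hat_tau a b c d v \<xi> $ i) \<in> borel_measurable borel"
  using exhaust_2[of i] by (auto simp: F_hat_tau_def Let_def)

lemma norm_fst_snd_le: "norm (fst v) \<le> norm v" "norm (snd v) \<le> norm v"
  using norm_fst_le[of "fst v" "snd v"] norm_snd_le[of "snd v" "fst v"] by simp_all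

lemma F_hat_w_bound:
  assumes K: "\<And>\<xi>. \<bar>1 / H_symbol a 0 c d \<xi>\<bar> \<le> K" "\<And>\<xi>. \<bar>H_symbol a 0 c d \<xi> / (1 + d * \<xi>^2)\<bar> \<le> K" and K1: "K \<ge> 1"
  shows "norm (F_hat_w a 0 c d v \<xi>) \<le> 2 * K * K^2 * (norm v)^2"
proof -
  let ?u = "H_inv_op a 0 c d (snd v)"
  have u: "norm ?u \<le> K * norm v"
  proof -
    have "norm ?u \<le> K * norm (snd v)"
      unfolding H_inv_op_def
    proof (rule multiplier_bounded(2))
      show "norm (complex_of_real (1 / H_symbol a 0 c d \<xi>)) \<le> K" for \<xi>
        using K(1) unfolding norm_of_real .
    qed measurable
    also have "\<dots> \<le> K * norm v" using K1 norm_fst_snd_le[of v] by (intro mult_left_mono) auto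
    finally show ?thesis .
  qed
  have \<eta>: "norm (fst v) \<le> K * norm v"
    using mult_mono[OF K1 norm_fst_snd_le(1)[of v]] K1 by simp
  show ?thesis
  proof (rule quadratic_F_bound[OF _ _ \<eta> u _ u])
    show "F_hat_w a 0 c d v \<xi> = vector [of_real ((\<lambda>\<xi>. 1) \<xi>) * fourier_L1 (\<lambda>x. rep_L2 (fst v) x * rep_L2 ?u x) \<xi>,
        of_real ((\<lambda>\<xi>. 1/2 * (H_symbol a 0 c d \<xi> / (1 + d * \<xi>^2))) \<xi>) * fourier_L1 (\<lambda>x. (rep_L2 ?u x)^2) \<xi>]"
      by (simp add: F_hat_w_def Let_def)
    show "\<bar>1 / 2 * (H_symbol a 0 c d \<xi> / (1 + d * \<xi>^2))\<bar> \<le> K"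
      using K(2)[of \<xi>] K1 unfolding abs_mult by simp
  qed (use K1 in simp)
qed

lemma F_hat_tau_bound:
  assumes K: "\<And>\<xi>. \<bar>H_symbol a b c 0 \<xi>\<bar> \<le> K" "\<And>\<xi>. \<bar>1 / H_symbol a b c 0 \<xi> / (1 + b * \<xi>^2)\<bar> \<le> K" and K1: "K \<ge> 1"
  shows "norm (F_hat_tau a b c 0 v \<xi>) \<le> 2 * K * K^2 * (norm v)^2"
proof -
  let ?\<eta> = "H_op a b c 0 (fst v)"
  have \<eta>: "norm ?\<eta> \<le> K * norm v"
  proof -
    have "norm ?\<eta> \<le> K * norm (fst v)"
      unfolding H_op_def
    proof (rule multiplier_bounded(2))
      show "norm (complex_of_real (H_symbol a b c 0 \<xi>)) \<le> K" for \<xi>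
        using K(1) unfolding norm_of_real .
    qed measurable
    also have "\<dots> \<le> K * norm v" using K1 norm_fst_snd_le[of v] by (intro mult_left_mono) auto
    finally show ?thesis .
  qed
  have u: "norm (snd v) \<le> K * norm v"
    using mult_mono[OF K1 norm_fst_snd_le(2)[of v]] K1 by simp
  show ?thesis
  proof (rule quadratic_F_bound[OF _ _ u \<eta> _ u])
    show "F_hat_tau a b c 0 v \<xi> = vector [of_real ((\<lambda>\<xi>. 1 / H_symbol a b c 0 \<xi> / (1 + b * \<xi>^2)) \<xi>)
          * fourier_L1 (\<lambda>x. rep_L2 (snd v) x * rep_L2 ?\<eta> x) \<xi>,
        of_real ((\<lambda>\<xi>. 1/2) \<xi>) * fourier_L1 (\<lambda>x. (rep_L2 (snd v) x)^2) \<xi>]"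
      by (simp add: F_hat_tau_def Let_def)
    show "\<bar>1 / H_symbol a b c 0 \<xi> / (1 + b * \<xi>^2)\<bar> \<le> K" by (rule K(2))
  qed (use K1 in simp)
qed

section \<open>The decay theorem\<close>

text \<open>The datum is existentially quantified, since the decay estimate depends on it only through the
  size \<open>\<epsilon>\<close>.\<close>

definition small_mild_solution where
  "small_mild_solution a b c d F \<epsilon> v \<longleftrightarrow>
     (\<exists>v0. mild_solution a b c d F v0 v \<and> in_L1 v0 \<and> L1_norm v0 + norm v0 \<le> \<epsilon>)"

lemma mild_solution_decay:
  assumes S: "parabolic_symbol (S_symbol a b c d) C \<beta>"
    and F: "\<And>v i. (\<lambda>\<xi>. F v \<xi> $ i) \<in> borel_measurable borel" "\<And>v \<xi>. norm (F v \<xi>) \<le> K * (norm v)^2"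
  obtains \<epsilon> M where "\<epsilon> > 0"
    "\<And>v t. small_mild_solution a b c d F \<epsilon> v \<Longrightarrow> t \<ge> 0 \<Longrightarrow> norm (v t) \<le> M * (1 + t) powr (-1/4)"
proof -
  interpret parabolic_symbol "S_symbol a b c d" C \<beta> by (rule S)
  show ?thesis
    using small_solution_decay[of F K, OF F] that
    unfolding small_mild_solution_def mild_solution_def S_dx_op_def S_op_def by blast
qed

lemma solution_square_decay:
  fixes v :: "real \<Rightarrow> L2 \<times> L2" and x :: "real \<Rightarrow> real"
  assumes v: "\<And>t. t \<ge> 0 \<Longrightarrow> norm (v t) \<le> M * (1 + t) powr (-1/4)"
    and x: "\<And>t. x t \<le> K * norm (snd (v t))" "\<And>t. x t \<ge> 0"
  shows "(\<lambda>t. (norm (fst (v t)))^2 + (x t)^2) \<in> O[at_top](\<lambda>t. t powr (-1/2))"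
proof (rule bigoI)
  show "\<forall>\<^sub>F t in at_top. norm ((norm (fst (v t)))^2 + (x t)^2) \<le> (1 + K^2) * M^2 * norm (t powr (-1/2))"
    using eventually_gt_at_top[of 0]
  proof eventually_elim
    case (elim t)
    have "(x t)^2 \<le> K^2 * (norm (snd (v t)))^2"
      using power_mono[OF x, of t 2] by (simp add: power_mult_distrib)
    also have "\<dots> \<le> K^2 * (norm (v t))^2" by (intro mult_left_mono power_mono norm_fst_snd_le) auto
    finally have xt: "(x t)^2 \<le> K^2 * (norm (v t))^2" .
    have "(norm (fst (v t)))^2 \<le> (norm (v t))^2" by (intro power_mono norm_fst_snd_le) auto
    from add_mono[OF this xt] have "(norm (fst (v t)))^2 + (x t)^2 \<le> (1 + K^2) * (norm (v t))^2"
      by (simp only: distrib_right mult_1)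
    also have "(norm (v t))^2 \<le> (M * (1 + t) powr (-1/4))^2" using v elim by (intro power_mono) auto
    also have "\<dots> = M^2 * (1 + t) powr (-1/2)" by (simp add: power_mult_distrib powr_square)
    also have "\<dots> \<le> M^2 * t powr (-1/2)" using elim by (intro mult_left_mono powr_mono2') auto
    finally show ?case using elim by (simp add: mult.assoc mult_left_mono add_nonneg_nonneg)
  qed
qed

lemma solution_square_decay':
  fixes v :: "real \<Rightarrow> L2 \<times> L2" and x :: "real \<Rightarrow> real"
  assumes v: "\<And>t. t \<ge> 0 \<Longrightarrow> norm (v t) \<le> M * (1 + t) powr (-1/4)"
    and x: "\<And>t. x t \<le> K * norm (fst (v t))" "\<And>t. x t \<ge> 0"
  shows "(\<lambda>t. (x t)^2 + (norm (snd (v t)))^2) \<in> O[at_top](\<lambda>t. t powr (-1/2))"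
  using solution_square_decay[of "\<lambda>t. (snd (v t), fst (v t))" M x K] assms
  by (simp add: norm_prod_def add.commute)

lemma H1_norm_nonneg: "H1_norm u \<ge> 0"
  unfolding H1_norm_def by (intro real_sqrt_ge_zero divide_nonneg_nonneg integral_nonneg) auto

lemma H_inv_op_bound:
  assumes "\<And>\<xi>. \<bar>1 / H_symbol a b c d \<xi>\<bar> \<le> K"
  shows "norm (H_inv_op a b c d w) \<le> K * norm w"
  unfolding H_inv_op_def
proof (rule multiplier_bounded(2))
  show "norm (complex_of_real (1 / H_symbol a b c d \<xi>)) \<le> K" for \<xi>
    using assms unfolding norm_of_real .
qed measurable

text \<open>Everything follows from \<open>H\<close> being comparable with \<open>sqrt (1 + \<xi>\<^sup>2)\<close>: its inverse gains one derivative, and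
  the denominator \<open>1 + d \<xi>\<^sup>2\<close> compensates for its growth.\<close>

lemma H_symbol_multiplier_bounds:
  assumes d: "d > 0" and pair: "dispersive_pair a c"
  obtains K where "K \<ge> 1" "\<And>\<xi>. \<bar>1 / H_symbol a 0 c d \<xi>\<bar> \<le> K" "\<And>\<xi>. sqrt (1 + \<xi>^2) * \<bar>1 / H_symbol a 0 c d \<xi>\<bar> \<le> K"
    "\<And>\<xi>. \<bar>H_symbol a 0 c d \<xi> / (1 + d * \<xi>^2)\<bar> \<le> K" "\<And>\<xi>. sqrt (1 + \<xi>^2) \<le> K * H_symbol a 0 c d \<xi>"
proof -
  obtain k where k: "k > 0" "\<And>\<xi>. H_symbol a 0 c d \<xi> \<le> k * sqrt (1 + \<xi>^2)" "\<And>\<xi>. sqrt (1 + \<xi>^2) \<le> k * H_symbol a 0 c d \<xi>"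
    by (rule H_symbol_size[OF d pair]) blast
  have H: "H_symbol a 0 c d \<xi> > 0" for \<xi>
  proof -
    have "0 < sqrt (1 + \<xi>^2)" by (simp add: add_pos_nonneg)
    also note k(3)
    finally show ?thesis using k(1) by (simp add: zero_less_mult_iff)
  qed
  have one: "1 \<le> sqrt (1 + \<xi>^2)" for \<xi> :: real by simp
  define K where "K = max 1 (max k (k * (1 + 1 / d)))"
  have K: "K \<ge> 1" "K \<ge> k" "K \<ge> k * (1 + 1 / d)" by (auto simp: K_def)
  have 1: "sqrt (1 + \<xi>^2) * \<bar>1 / H_symbol a 0 c d \<xi>\<bar> \<le> K" for \<xi>
  proof -
    have "sqrt (1 + \<xi>^2) / H_symbol a 0 c d \<xi> \<le> k" using k(3)[of \<xi>] H[of \<xi>] by (simp add: divide_le_eq)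
    then show ?thesis using K(2) H[of \<xi>] by simp
  qed
  show ?thesis
  proof (rule that[OF K(1) _ 1])
    fix \<xi>
    have "1 * \<bar>1 / H_symbol a 0 c d \<xi>\<bar> \<le> sqrt (1 + \<xi>^2) * \<bar>1 / H_symbol a 0 c d \<xi>\<bar>"
      by (intro mult_right_mono one) auto
    then show "\<bar>1 / H_symbol a 0 c d \<xi>\<bar> \<le> K" using 1[of \<xi>] by simp
    have pos: "1 + d * \<xi>^2 > 0" using d by (simp add: add_pos_nonneg)
    have "sqrt (1 + \<xi>^2) * 1 \<le> sqrt (1 + \<xi>^2) * sqrt (1 + \<xi>^2)" by (intro mult_left_mono one) auto
    then have "sqrt (1 + \<xi>^2) \<le> 1 + \<xi>^2" by simp
    also have "\<dots> \<le> (1 + 1 / d) * (1 + d * \<xi>^2)" using d by (simp add: algebra_simps)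
    finally have "k * sqrt (1 + \<xi>^2) \<le> k * ((1 + 1 / d) * (1 + d * \<xi>^2))" using k(1) by (intro mult_left_mono) auto
    with k(2)[of \<xi>] have "H_symbol a 0 c d \<xi> \<le> (k * (1 + 1 / d)) * (1 + d * \<xi>^2)" by (simp add: mult.assoc)
    also have "\<dots> \<le> K * (1 + d * \<xi>^2)" using K(3) pos by (intro mult_right_mono) auto
    finally have "H_symbol a 0 c d \<xi> / (1 + d * \<xi>^2) \<le> K" using pos by (simp add: divide_le_eq)
    then show "\<bar>H_symbol a 0 c d \<xi> / (1 + d * \<xi>^2)\<bar> \<le> K"
      using H[of \<xi>] pos by simp
    have "k * H_symbol a 0 c d \<xi> \<le> K * H_symbol a 0 c d \<xi>" using K(2) H[of \<xi>] by (intro mult_right_mono) auto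
    with k(3)[of \<xi>] show "sqrt (1 + \<xi>^2) \<le> K * H_symbol a 0 c d \<xi>" by simp
  qed
qed

theorem theorem4p4:
  fixes a b c d :: real
  assumes "cond_C0 a b c d"
    and "cond_C1 a b c d \<or> cond_C2 a b c d"
    and "\<exists>m\<ge>1. has_order (sigma_symbol a b c d) m"
  shows "\<exists>\<epsilon>\<^sub>0>0.
    (has_order (H_symbol a b c d) 0 \<longrightarrow>
      (\<forall>v0 v. mild_solution a b c d (F_hat_w a b c d) v0 v \<and>
              in_L1 v0 \<and> L1_norm v0 + norm v0 \<le> \<epsilon>\<^sub>0 \<longrightarrow>
         (let \<eta> = (\<lambda>t. fst (v t)); u = (\<lambda>t. H_inv_op a b c d (snd (v t))) in
          (\<lambda>t. (norm (\<eta> t))\<^sup>2 + (norm (u t))\<^sup>2) \<in> O[at_top](\<lambda>t. t powr (-1/2))))) \<and>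
    (has_order (H_symbol a b c d) 1 \<longrightarrow>
      (\<forall>v0 v. mild_solution a b c d (F_hat_w a b c d) v0 v \<and>
              in_L1 v0 \<and> L1_norm v0 + norm v0 \<le> \<epsilon>\<^sub>0 \<longrightarrow>
         (let \<eta> = (\<lambda>t. fst (v t)); u = (\<lambda>t. H_inv_op a b c d (snd (v t))) in
          (\<forall>t\<ge>0. u t \<in> H1) \<and>
          (\<lambda>t. (norm (\<eta> t))\<^sup>2 + (H1_norm (u t))\<^sup>2) \<in> O[at_top](\<lambda>t. t powr (-1/2))))) \<and>
    (has_order (H_symbol a b c d) (-1) \<longrightarrow>
      (\<forall>v0 v. mild_solution a b c d (F_hat_tau a b c d) v0 v \<and>
              in_L1 v0 \<and> L1_norm v0 + norm v0 \<le> \<epsilon>\<^sub>0 \<longrightarrow>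
         (let \<eta> = (\<lambda>t. H_op a b c d (fst (v t))); u = (\<lambda>t. snd (v t)) in
          (\<forall>t\<ge>0. \<eta> t \<in> H1) \<and>
          (\<lambda>t. (H1_norm (\<eta> t))\<^sup>2 + (norm (u t))\<^sup>2) \<in> O[at_top](\<lambda>t. t powr (-1/2)))))"
proof -
  note order0 = has_order_zero_not_decaying[of "H_symbol a b c d"]
    and order1 = has_order_not_bounded[of "H_symbol a b c d" 1]
    and order_neg = has_order_neg_small[of "H_symbol a b c d"]
  show ?thesis
    using assms
  proof (cases rule: KdV_Burgers_cases)
    case unregularised
    have H: "H_symbol a b c d = (\<lambda>\<xi>. 1)" using unregularised H_symbol_unregularised by (simp add: fun_eq_iff)
    have n: "\<not> has_order (H_symbol a b c d) 1" "\<not> has_order (H_symbol a b c d) (-1)"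
      using order1[of 1] order_neg[of 1] by (auto simp: H)
    obtain \<beta> where S: "parabolic_symbol (S_symbol a b c d) 2 \<beta>"
      using parabolic_unregularised[OF unregularised(4)] unregularised by auto
    have K: "\<bar>1 / H_symbol a b c d \<xi>\<bar> \<le> 1" "\<bar>H_symbol a b c d \<xi> / (1 + d * \<xi>^2)\<bar> \<le> 1" "(1::real) \<le> 1" for \<xi>
      unfolding H by (simp_all add: unregularised(2))
    have F: "norm (F_hat_w a b c d v \<xi>) \<le> 2 * 1 * 1^2 * (norm v)^2" for v \<xi>
      using F_hat_w_bound[OF K[unfolded unregularised(1)]] unfolding unregularised(1) .
    obtain \<epsilon> M where \<epsilon>: "\<epsilon> > 0" and decay: "\<And>v t. small_mild_solution a b c d (F_hat_w a b c d) \<epsilon> v \<Longrightarrow>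
        t \<ge> 0 \<Longrightarrow> norm (v t) \<le> M * (1 + t) powr (-1/4)"
      by (rule mild_solution_decay[OF S F_hat_w_measurable F]) blast
    have L2: "(\<lambda>t. (norm (fst (v t)))^2 + (norm (H_inv_op a b c d (snd (v t))))^2) \<in> O[at_top](\<lambda>t. t powr (-1/2))"
      if "small_mild_solution a b c d (F_hat_w a b c d) \<epsilon> v" for v
      by (rule solution_square_decay[OF decay[OF that] H_inv_op_bound[OF K(1)] norm_ge_zero])
    show ?thesis
      using \<epsilon> n L2 unfolding Let_def small_mild_solution_def by (intro exI[of _ \<epsilon>]) blast
  next
    case regularised_u
    obtain K where K: "K \<ge> 1" "\<And>\<xi>. \<bar>1 / H_symbol a b c d \<xi>\<bar> \<le> K" "\<And>\<xi>. sqrt (1 + \<xi>^2) * \<bar>1 / H_symbol a b c d \<xi>\<bar> \<le> K"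
      "\<And>\<xi>. \<bar>H_symbol a b c d \<xi> / (1 + d * \<xi>^2)\<bar> \<le> K" "\<And>\<xi>. sqrt (1 + \<xi>^2) \<le> K * H_symbol a b c d \<xi>"
      unfolding regularised_u(1) by (rule H_symbol_multiplier_bounds[OF regularised_u(2,3)]) blast
    have "H_symbol a b c d \<xi> \<ge> 1 / K" for \<xi>
    proof -
      have "1 \<le> sqrt (1 + \<xi>^2)" by simp
      also note K(5)
      finally show ?thesis using K(1) by (simp add: divide_le_eq mult.commute)
    qed
    then have n: "\<not> has_order (H_symbol a b c d) (-1)" using order_neg[of "1 / K"] K(1) by auto
    obtain \<beta> where S: "parabolic_symbol (S_symbol a b c d) 2 \<beta>"
      using parabolic_regularised_u[OF regularised_u(2,3)] unfolding regularised_u(1) by blast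
    have F: "norm (F_hat_w a b c d v \<xi>) \<le> 2 * K * K^2 * (norm v)^2" for v \<xi>
      using F_hat_w_bound[OF K(2,4)[unfolded regularised_u(1)] K(1)] unfolding regularised_u(1) .
    obtain \<epsilon> M where \<epsilon>: "\<epsilon> > 0" and decay: "\<And>v t. small_mild_solution a b c d (F_hat_w a b c d) \<epsilon> v \<Longrightarrow>
        t \<ge> 0 \<Longrightarrow> norm (v t) \<le> M * (1 + t) powr (-1/4)"
      by (rule mild_solution_decay[OF S F_hat_w_measurable F]) blast
    have L2: "(\<lambda>t. (norm (fst (v t)))^2 + (norm (H_inv_op a b c d (snd (v t))))^2) \<in> O[at_top](\<lambda>t. t powr (-1/2))"
      if "small_mild_solution a b c d (F_hat_w a b c d) \<epsilon> v" for v
      by (rule solution_square_decay[OF decay[OF that] H_inv_op_bound[OF K(2)] norm_ge_zero])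
    have m: "(\<lambda>\<xi>. complex_of_real (1 / H_symbol a b c d \<xi>)) \<in> borel_measurable borel" by measurable
    have "sqrt (1 + \<xi>^2) * norm (complex_of_real (1 / H_symbol a b c d \<xi>)) \<le> K" for \<xi>
      unfolding norm_of_real by (rule K(3))
    note u = multiplier_H1[OF m this, folded H_inv_op_def]
    have H1: "(\<lambda>t. (norm (fst (v t)))^2 + (H1_norm (H_inv_op a b c d (snd (v t))))^2) \<in> O[at_top](\<lambda>t. t powr (-1/2))"
      if "small_mild_solution a b c d (F_hat_w a b c d) \<epsilon> v" for v
      by (rule solution_square_decay[OF decay[OF that] u(2) H1_norm_nonneg])
    show ?thesis
      using \<epsilon> n L2 H1 u(1) unfolding Let_def small_mild_solution_def by (intro exI[of _ \<epsilon>]) blast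
  next
    case regularised_eta
    have inv: "H_symbol a b c d \<xi> = 1 / H_symbol c d a b \<xi>" "1 / H_symbol a b c d \<xi> = H_symbol c d a b \<xi>" for \<xi>
      by (simp_all only: H_symbol_inverse)
    obtain K where K: "K \<ge> 1" "\<And>\<xi>. \<bar>H_symbol a b c d \<xi>\<bar> \<le> K" "\<And>\<xi>. sqrt (1 + \<xi>^2) * \<bar>H_symbol a b c d \<xi>\<bar> \<le> K"
      "\<And>\<xi>. \<bar>1 / H_symbol a b c d \<xi> / (1 + b * \<xi>^2)\<bar> \<le> K"
      unfolding inv(2) unfolding inv(1) unfolding regularised_eta(2)
      by (rule H_symbol_multiplier_bounds[OF regularised_eta(1) dispersive_pair_commute[OF regularised_eta(3)]]) blast
    have le: "H_symbol a b c d \<xi> \<le> K" "H_symbol a b c d \<xi> * sqrt (1 + \<xi>^2) \<le> K" for \<xi>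
    proof -
      show "H_symbol a b c d \<xi> \<le> K" using K(2)[of \<xi>] by simp
      have "H_symbol a b c d \<xi> * sqrt (1 + \<xi>^2) \<le> \<bar>H_symbol a b c d \<xi>\<bar> * sqrt (1 + \<xi>^2)"
        by (intro mult_right_mono) auto
      with K(3)[of \<xi>] show "H_symbol a b c d \<xi> * sqrt (1 + \<xi>^2) \<le> K" by (simp add: mult.commute)
    qed
    then have n: "\<not> has_order (H_symbol a b c d) 0" "\<not> has_order (H_symbol a b c d) 1"
      using order0 order1 by blast+
    obtain \<beta> where S: "parabolic_symbol (S_symbol a b c d) 2 \<beta>"
      using parabolic_regularised_eta[OF regularised_eta(1,3)] unfolding regularised_eta(2) by blast
    have F: "norm (F_hat_tau a b c d v \<xi>) \<le> 2 * K * K^2 * (norm v)^2" for v \<xi>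
      using F_hat_tau_bound[OF K(2,4)[unfolded regularised_eta(2)] K(1)] unfolding regularised_eta(2) .
    obtain \<epsilon> M where \<epsilon>: "\<epsilon> > 0" and decay: "\<And>v t. small_mild_solution a b c d (F_hat_tau a b c d) \<epsilon> v \<Longrightarrow>
        t \<ge> 0 \<Longrightarrow> norm (v t) \<le> M * (1 + t) powr (-1/4)"
      by (rule mild_solution_decay[OF S F_hat_tau_measurable F]) blast
    have m: "(\<lambda>\<xi>. complex_of_real (H_symbol a b c d \<xi>)) \<in> borel_measurable borel" by measurable
    have "sqrt (1 + \<xi>^2) * norm (complex_of_real (H_symbol a b c d \<xi>)) \<le> K" for \<xi>
      unfolding norm_of_real by (rule K(3))
    note \<eta> = multiplier_H1[OF m this, folded H_op_def]
    have H1: "(\<lambda>t. (H1_norm (H_op a b c d (fst (v t))))^2 + (norm (snd (v t)))^2) \<in> O[at_top](\<lambda>t. t powr (-1/2))"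
      if "small_mild_solution a b c d (F_hat_tau a b c d) \<epsilon> v" for v
      by (rule solution_square_decay'[OF decay[OF that] \<eta>(2) H1_norm_nonneg])
    show ?thesis
      using \<epsilon> n H1 \<eta>(1) unfolding Let_def small_mild_solution_def by (intro exI[of _ \<epsilon>]) blast
  qed
qed

end
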